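(* Let $n\ge1$, let $m$ be a positive integer or half-integer, and let $\eta$ be a vector of integers or of half-integers in $\mathcal A^{\tilde B_n}_m=\{(x_1,\dots,x_n): x_1>\dots>x_n>0,\ x_1+x_2<2m\}$. Put $K_k=\left(2^n\prod_{j=1}^n\cos\frac{(2j-1)\pi}{4m}\right)^k$, $$E=\prod_{1\le h<t\le n}\left(\sin\frac{\pi(\eta_h-\eta_t)}{2m}\sin\frac{\pi(t-h)}{2m}\sin\frac{\pi(\eta_h+\eta_t)}{2m}\sin\frac{\pi(t+h)}{2m}\right)\prod_{h=1}^n\left(\sin\frac{\pi\eta_h}{2m}\sin\frac{\pi h}{2m}\right),$$ $$E'=\prod_{1\le h<t\le n}\left(\sin\frac{\pi(\eta_h-\eta_t)}{2m}\sin\frac{\pi(t-h)}{2m}\sin\frac{\pi(\eta_h+\eta_t)}{2m}\sin\frac{\pi(t+h-1)}{2m}\right)\prod_{h=1}^n\left(\sin\frac{\pi\eta_h}{2m}\sin\frac{\pi(2h-1)}{4m}\right),$$ and for real $c$ $$A(c)=\prod_{h=1}^{2n}\frac{\sin\frac{\pi(c-n+h)}{4m}}{\sin\frac{\pi h}{4m}}\prod_{h=1}^{n-1}\prod_{t=1}^n\frac{\sin\frac{\pi(c+t-h)}{2m}}{\sin\frac{\pi(n+t-h)}{2m}},$$ $$U(c)=\prod_{h=1}^{2n}\frac{\sin\frac{\pi(c-n+h)}{4m}}{\sin\frac{\pi h}{4m}}\prod_{h=1}^{n}\prod_{t=1}^n\frac{\sin\frac{\pi(c+t-h)}{2m}}{\sin\frac{\pi(n+t-h)}{2m}}\prod_{h=1}^n\frac{\sin\frac{\pi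 h}{2m}}{\sin\frac{\pi(c-n+2h)}{4m}}\cdot\frac{\cos\frac{\pi(2h-1)}{4m}}{\cos\frac{\pi(c-n+2h-1)}{4m}}.$$ Then, as $k\to\infty$, the number of walks which start at $\eta$, consist of exactly $k$ diagonal steps (arbitrary end point), and stay in $\mathcal A^{\tilde B_n}_m$ is asymptotically: $\frac{4^{n^2}}{2(2m)^n}K_kE\,(A(m)+A(m-1))$ if $m$ is an integer and $k+2\eta_j$ is even; $\frac{4^{n^2}}{(2m)^n}K_kE\,A(\lfloor m\rfloor)$ if $m$ is a half-integer and $k+2\eta_j$ is even; $\frac{4^{n^2}}{(2m)^n}K_kE'\,U(m)$ if $m$ is an integer and $k+2\eta_j$ is odd; $\frac{4^{n^2}}{2(2m)^n}K_kE'\,(U(\lceil m\rceil)+U(\lfloor m\rfloor))$ if $m$ is a half-integer and $k+2\eta_j$ is odd.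
   Context: A half-integer is an odd integer divided by $2$; $\lfloor\cdot\rfloor,\lceil\cdot\rceil$ are floor and ceiling. A walk with $k$ diagonal steps is a sequence $p_0,\dots,p_k$ with $p_i-p_{i-1}\in\{(\pm\frac12,\dots,\pm\frac12)\}$; it stays in $R$ if all $p_i\in R$. "Asymptotically $E$" means the ratio of the count to the expression tends to $1$. *)

theory Defs
  imports Complex_Main "HOL-Library.Landau_Symbols"
begin

definition half_integer :: "real \<Rightarrow> bool" where
  "half_integer x \<longleftrightarrow> (\<exists>a::int. odd a \<and> x = of_int a / 2)"

text \<open>
  A point \<open>(x\<^sub>1, \<dots>, x\<^sub>n)\<close> of real \<open>n\<close>-space is a function on \<open>nat\<close> with coordinates
  \<open>x 1, \<dots>, x n\<close> that vanishes at all other arguments, so that every point has exactly one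
  representation.
\<close>

definition points :: "nat \<Rightarrow> (nat \<Rightarrow> real) set" where
  "points n = {x. \<forall>i. i \<notin> {1..n} \<longrightarrow> x i = 0}"

text \<open>
  For \<open>n = 1\<close> there is no coordinate \<open>x\<^sub>2\<close>; it is read as \<open>0\<close>, which makes the alcove the
  interval from \<open>0\<close> to \<open>2m\<close>.
\<close>

definition alcove_B :: "nat \<Rightarrow> real \<Rightarrow> (nat \<Rightarrow> real) set" where
  "alcove_B n m = {x \<in> points n.
     (\<forall>i\<in>{1..<n}. x i > x (i + 1)) \<and> x n > 0 \<and> x 1 + x 2 < 2 * m}"

definition diagonal_steps :: "nat \<Rightarrow> (nat \<Rightarrow> real) set" where
  "diagonal_steps n = {s \<in> points n. \<forall>i\<in>{1..n}. s i = 1/2 \<or> s i = - (1/2)}"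

text \<open>A walk \<open>p\<^sub>0, \<dots>, p\<^sub>k\<close> is the list of its \<open>k + 1\<close> points.\<close>

definition diagonal_walks ::
  "nat \<Rightarrow> (nat \<Rightarrow> real) set \<Rightarrow> (nat \<Rightarrow> real) \<Rightarrow> nat \<Rightarrow> (nat \<Rightarrow> real) list set" where
  "diagonal_walks n R \<eta> k = {p. length p = k + 1 \<and> p ! 0 = \<eta> \<and> set p \<subseteq> R \<and>
     (\<forall>i\<in>{1..k}. (\<lambda>j. (p ! i) j - (p ! (i - 1)) j) \<in> diagonal_steps n)}"

definition K_factor :: "nat \<Rightarrow> real \<Rightarrow> nat \<Rightarrow> real" where
  "K_factor n m k = (2 ^ n * (\<Prod>j=1..n. cos ((2 * real j - 1) * pi / (4 * m)))) ^ k"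

definition E_even :: "nat \<Rightarrow> real \<Rightarrow> (nat \<Rightarrow> real) \<Rightarrow> real" where
  "E_even n m \<eta> =
     (\<Prod>(h, t) \<in> {(h, t). 1 \<le> h \<and> h < t \<and> t \<le> n}.
        sin (pi * (\<eta> h - \<eta> t) / (2 * m)) * sin (pi * (real t - real h) / (2 * m)) *
        sin (pi * (\<eta> h + \<eta> t) / (2 * m)) * sin (pi * (real t + real h) / (2 * m))) *
     (\<Prod>h=1..n. sin (pi * \<eta> h / (2 * m)) * sin (pi * real h / (2 * m)))"

definition E_odd :: "nat \<Rightarrow> real \<Rightarrow> (nat \<Rightarrow> real) \<Rightarrow> real" where
  "E_odd n m \<eta> =
     (\<Prod>(h, t) \<in> {(h, t). 1 \<le> h \<and> h < t \<and> t \<le> n}.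
        sin (pi * (\<eta> h - \<eta> t) / (2 * m)) * sin (pi * (real t - real h) / (2 * m)) *
        sin (pi * (\<eta> h + \<eta> t) / (2 * m)) * sin (pi * (real t + real h - 1) / (2 * m))) *
     (\<Prod>h=1..n. sin (pi * \<eta> h / (2 * m)) * sin (pi * (2 * real h - 1) / (4 * m)))"

definition A_factor :: "nat \<Rightarrow> real \<Rightarrow> real \<Rightarrow> real" where
  "A_factor n m c =
     (\<Prod>h=1..2*n. sin (pi * (c - real n + real h) / (4 * m)) / sin (pi * real h / (4 * m))) *
     (\<Prod>h=1..n-1. \<Prod>t=1..n.
        sin (pi * (c + real t - real h) / (2 * m)) /
        sin (pi * (real n + real t - real h) / (2 * m)))"

definition U_factor :: "nat \<Rightarrow> real \<Rightarrow> real \<Rightarrow> real" where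
  "U_factor n m c =
     (\<Prod>h=1..2*n. sin (pi * (c - real n + real h) / (4 * m)) / sin (pi * real h / (4 * m))) *
     (\<Prod>h=1..n. \<Prod>t=1..n.
        sin (pi * (c + real t - real h) / (2 * m)) /
        sin (pi * (real n + real t - real h) / (2 * m))) *
     (\<Prod>h=1..n.
        sin (pi * real h / (2 * m)) / sin (pi * (c - real n + 2 * real h) / (4 * m)) *
        (cos (pi * (2 * real h - 1) / (4 * m)) /
         cos (pi * (c - real n + 2 * real h - 1) / (4 * m))))"

text \<open>
  The filters below let \<open>k\<close> tend to infinity through those \<open>k\<close> for which \<open>k + 2\<eta>\<^sub>j\<close> is even
  (respectively odd). For integer or half-integer coordinates the floor is exact and all
  coordinates give the same parity.
\<close>

definition at_top_even :: "nat \<Rightarrow> (nat \<Rightarrow> real) \<Rightarrow> nat filter" where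
  "at_top_even n \<eta> =
     inf at_top (principal {k. \<forall>j\<in>{1..n}. even (int k + \<lfloor>2 * \<eta> j\<rfloor>)})"

definition at_top_odd :: "nat \<Rightarrow> (nat \<Rightarrow> real) \<Rightarrow> nat filter" where
  "at_top_odd n \<eta> =
     inf at_top (principal {k. \<forall>j\<in>{1..n}. odd (int k + \<lfloor>2 * \<eta> j\<rfloor>)})"

end

(* Counting walks is iterating the neighbour-sum operator T on the alcove. Its dominant
   eigenfunction f is the alternant det (sin ((2i-1) pi x_j / (2m))), with eigenvalue
   K = prod 2 cos ((2i-1) pi / (4m)): it vanishes on the walls, and Weyl's denominator formula of
   type B turns it into a product of sines, which is positive inside. T swaps integer and
   half-integer points, and a power of T^2 reaches a fixed point from every integer point, so a
   Doeblin contraction gives T^k 1 ~ K^k f(eta) (sum f) / (sum f^2), the sum in the numerator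
   running over the end points of the parity of k.

   The alcove is the union of the region m >= x_1 > ... > x_n > 0 and its image under the
   reflection x_1 -> 2m - x_1, which leaves f invariant. Thus sum f becomes a sum over strictly decreasing points of a
   one-dimensional grid, that is, a sum over all tuples weighted with the product of the signs of
   x_i - x_j: a Pfaffian. Its entries are of the form
   (u_i - u_j) / (u_i + u_j), up to symmetric modifications, with u_i a signed cotangent or cosecant,
   so it is evaluated by Schur's Pfaffian identity and a variant of it. The expansion of these
   Pfaffians along an index is Lagrange interpolation; the expansion of the sign product is its
   limit for rapidly separating arguments. Orthogonality of the sines gives sum f^2. *)

theory Submission
  imports Defs "HOL-Computational_Algebra.Polynomial" "HOL-Combinatorics.Permutations" Complex_Main
begin

text \<open>Only two parameters carry the geometry: the first grid point \<open>d\<close>, 1 or 1/2,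
  and the position of the reflecting wall \<open>m\<close>, which either is a grid point, and then
  must count half, or lies midway between two. Their four combinations are the four cases of the
  statement. At the wall every frequency has cosine 0 and sine 1 or -1; moving this sign into the
  angle lets one formula cover all Pfaffian entries. Up to row factors the entries are plain Schur
  quotients if the wall lies between grid points. If it is a grid point they carry a factor
  \<open>c\<^sup>2 + u_i * u_j\<close>, with c the imaginary unit for cotangents and 1 for
  cosecants, and the Pfaffian gains the even part in c of the product of all \<open>u_i + c\<close>;
  hence the sums of two factors in the statement. Pfaffians are not defined: their expansion rules
  determine the sums. T is bipartite, so its square is contracted, on the integer points only;
  half-integer starts are one step away from them. The case of eigenvalue 0,
  \<open>2 * m = 2 * n - 1\<close>, is separate: there no walk of positive length stays in the
  alcove.\<close>

subsection \<open>Lagrange sums of Schur quotients\<close>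

text \<open>A polynomial of degree below \<open>card A\<close> is its own interpolant at the nodes
  \<open>A\<close>. The Lagrange basis numerators are monic of degree \<open>card A - 1\<close>, so
  comparing that coefficient yields the sum.\<close>

lemma sum_lagrange:
  fixes A :: "'a::field set"
  assumes "finite A" "A \<noteq> {}" "degree p < card A"
  shows "(\<Sum>v\<in>A. poly p v / (\<Prod>u\<in>A-{v}. v - u)) = coeff p (card A - 1)"
proof -
  define L where "L = (\<Sum>v\<in>A. smult (poly p v / (\<Prod>u\<in>A-{v}. v - u)) (\<Prod>u\<in>A-{v}. [:-u, 1:]))"
  have deg: "degree (\<Prod>u\<in>A-{v}. [:-u, 1:]) = card A - 1" if "v \<in> A" for v
    using that assms(1) by (subst degree_prod_eq_sum_degree) auto
  have "degree L \<le> card A - 1"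
    unfolding L_def by (rule degree_sum_le) (use assms deg in \<open>auto intro: order_trans[OF degree_smult_le]\<close>)
  with assms have dL: "degree L < card A"
    by (metis card_gt_0_iff diff_less le_less_trans less_numeral_extra(1))
  have "p = L"
  proof (rule poly_eqI_degree[OF _ assms(3) dL])
    fix x assume x: "x \<in> A"
    have "poly L x = (\<Sum>v\<in>A. poly p v / (\<Prod>u\<in>A-{v}. v - u) * (\<Prod>u\<in>A-{v}. x - u))"
      by (simp add: L_def poly_sum poly_prod)
    also have "\<dots> = (\<Sum>v\<in>A. if v = x then poly p x else 0)"
    proof (rule sum.cong[OF refl], goal_cases)
      case (1 v)
      show ?case
      proof (cases "v = x")
        case False
        with x assms(1) have "(\<Prod>u\<in>A-{v}. x - u) = 0" by (intro prod_zero) auto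
        with False show ?thesis by simp
      next
        case True
        have "(\<Prod>u\<in>A-{v}. v - u) \<noteq> 0" using assms(1) by auto
        with True show ?thesis by simp
      qed
    qed
    finally show "poly p x = poly L x" using x assms(1) by simp
  qed
  have "coeff L (card A - 1) = (\<Sum>v\<in>A. poly p v / (\<Prod>u\<in>A-{v}. v - u))"
  proof -
    have "coeff (\<Prod>u\<in>A-{v}. [:-u, 1:]) (card A - 1) = 1" if "v \<in> A" for v
      using lead_coeff_prod[of "\<lambda>u. [:-u, 1:]" "A-{v}"] deg[OF that] by simp
    then show ?thesis by (simp add: L_def coeff_sum)
  qed
  with \<open>p = L\<close> show ?thesis by simp
qed

lemma
  fixes A :: "'a::field set"
  assumes "finite A"
  shows degree_prod_linear: "degree (\<Prod>u\<in>A. [:u, 1:]) = card A"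
    and coeff_prod_linear: "coeff (\<Prod>u\<in>A. [:u, 1:]) (card A) = 1"
proof -
  show *: "degree (\<Prod>u\<in>A. [:u, 1:]) = card A"
    by (subst degree_prod_eq_sum_degree) auto
  show "coeff (\<Prod>u\<in>A. [:u, 1:]) (card A) = 1"
    using lead_coeff_prod[of "\<lambda>u. [:u, 1:]" A] * by simp
qed

text \<open>Entry of Schur's Pfaffian: in even order the Pfaffian of all
  \<open>schur (x i) (x j)\<close> is the product of these entries over
  \<open>i < j\<close>.\<close>

abbreviation schur :: "'a::field \<Rightarrow> 'a \<Rightarrow> 'a" where
  "schur u v \<equiv> (u - v) / (u + v)"

text \<open>Brings the reciprocal product into the shape of a Lagrange summand for the monic
  polynomial with roots \<open>- u\<close>; its factor at \<open>u = v\<close> is compensated by the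
  \<open>2 * v\<close> in the denominator.\<close>

lemma schur_term:
  fixes A :: "'a::field_char_0 set"
  assumes "finite A" "v \<in> A" "v \<noteq> 0"
  shows "inverse (\<Prod>u\<in>A-{v}. schur v u) = (\<Prod>u\<in>A. v + u) / (2 * v * (\<Prod>u\<in>A-{v}. v - u))"
proof -
  have "(\<Prod>u\<in>A. v + u) = 2 * v * (\<Prod>u\<in>A-{v}. v + u)"
    using assms by (subst prod.remove[of _ v]) auto
  then show ?thesis using assms by (simp add: prod_dividef)
qed

text \<open>Lagrange sum of the monic polynomial with roots \<open>- u\<close> over the nodes
  \<open>A\<close> and 0. The node 0 gives -1 because \<open>card A\<close> is odd, the nodes in
  \<open>A\<close> give twice the sum, and the top coefficient is 1.\<close>

lemma schur_odd:
  fixes A :: "'a::field_char_0 set"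
  assumes "finite A" "odd (card A)" "0 \<notin> A"
  shows "(\<Sum>v\<in>A. inverse (\<Prod>u\<in>A-{v}. schur v u)) = 1"
proof -
  let ?E = "\<Prod>u\<in>A. [:u, 1:]"
  have "1 = (\<Sum>v\<in>insert 0 A. poly ?E v / (\<Prod>u\<in>insert 0 A-{v}. v - u))"
    using assms by (subst sum_lagrange) (auto simp: degree_prod_linear coeff_prod_linear)
  also have "\<dots> = (\<Prod>u\<in>A. u) / (\<Prod>u\<in>A. -u) +
      (\<Sum>v\<in>A. (\<Prod>u\<in>A. v + u) / (v * (\<Prod>u\<in>A-{v}. v - u)))"
  proof -
    have "insert 0 A - {v} = insert 0 (A - {v})" if "v \<in> A" for v using that assms by auto
    with assms show ?thesis by (simp add: poly_prod add.commute cong: sum.cong)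
  qed
  also have "(\<Prod>u\<in>A. u) / (\<Prod>u\<in>A. -u) = -1"
    using assms by (simp add: prod_uminus)
  also have "(\<Sum>v\<in>A. (\<Prod>u\<in>A. v + u) / (v * (\<Prod>u\<in>A-{v}. v - u))) =
      2 * (\<Sum>v\<in>A. inverse (\<Prod>u\<in>A-{v}. schur v u))"
    unfolding sum_distrib_left
  proof (rule sum.cong[OF refl], goal_cases)
    case (1 v)
    then show ?case using assms by (subst schur_term) auto
  qed
  finally show ?thesis by simp
qed

text \<open>The same polynomial times \<open>a - X\<close>, with \<open>- a\<close> as a further
  node. The node 0 contributes -1, which is also the top coefficient, so the sum over
  \<open>A\<close> must balance the node \<open>- a\<close>, whose term is -2 times the
  product.\<close>

lemma schur_even:
  fixes A :: "'a::field_char_0 set"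
  assumes "finite A" "odd (card A)" "0 \<notin> A" "a \<noteq> 0" "- a \<notin> A"
  shows "(\<Sum>v\<in>A. schur a v * inverse (\<Prod>u\<in>A-{v}. schur v u)) = (\<Prod>u\<in>A. schur a u)"
proof -
  let ?E = "\<Prod>u\<in>A. [:u, 1:]"
  define p where "p = [:a, -1:] * ?E"
  let ?B = "insert 0 (insert (-a) A)"
  have E: "degree ?E = card A" "coeff ?E (card A) = 1"
    using assms by (auto simp: degree_prod_linear coeff_prod_linear)
  have E0: "?E \<noteq> 0" using E by (metis coeff_0 zero_neq_one)
  have cB: "card ?B = card A + 2" using assms by auto
  have "degree p = card A + 1" unfolding p_def using E E0 by (subst degree_mult_eq) auto
  moreover have "coeff p (card A + 1) = -1"
    using E by (simp add: p_def coeff_eq_0)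
  moreover have pp: "poly p v = (a - v) * (\<Prod>u\<in>A. v + u)" for v
    by (simp add: p_def poly_prod algebra_simps)
  ultimately have "-1 = (\<Sum>v\<in>?B. poly p v / (\<Prod>u\<in>?B-{v}. v - u))"
    using assms cB by (subst sum_lagrange) auto
  also have "\<dots> = a * (\<Prod>u\<in>A. u) / (a * (\<Prod>u\<in>A. -u)) +
      (2 * a * (\<Prod>u\<in>A. - a + u) / (- a * (\<Prod>u\<in>A. - a - u)) +
      (\<Sum>v\<in>A. (a - v) * (\<Prod>u\<in>A. v + u) / (v * (v + a) * (\<Prod>u\<in>A-{v}. v - u))))"
  proof -
    have "?B - {0} = insert (-a) A" "?B - {-a} = insert 0 A" using assms by auto
    moreover have "?B - {v} = insert 0 (insert (-a) (A - {v}))" if "v \<in> A" for v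
      using that assms by auto
    ultimately show ?thesis using assms
      by (simp add: pp add.commute mult.assoc cong: sum.cong)
  qed
  also have "a * (\<Prod>u\<in>A. u) / (a * (\<Prod>u\<in>A. -u)) = -1"
    using assms by (simp add: prod_uminus)
  also have "(\<Prod>u\<in>A. - a + u) = (\<Prod>u\<in>A. - (a - u))" by simp
  also have "(\<Prod>u\<in>A. - a - u) = (\<Prod>u\<in>A. - (a + u))" by simp
  also have "2 * a * (\<Prod>u\<in>A. - (a - u)) / (- a * (\<Prod>u\<in>A. - (a + u))) = - 2 * (\<Prod>u\<in>A. schur a u)"
    using assms by (simp only: prod_uminus prod_dividef) simp
  also have "(\<Sum>v\<in>A. (a - v) * (\<Prod>u\<in>A. v + u) / (v * (v + a) * (\<Prod>u\<in>A-{v}. v - u))) =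
      2 * (\<Sum>v\<in>A. schur a v * inverse (\<Prod>u\<in>A-{v}. schur v u))"
    unfolding sum_distrib_left
  proof (rule sum.cong[OF refl], goal_cases)
    case (1 v)
    then show ?case using assms by (subst schur_term) (auto simp: add.commute)
  qed
  finally show ?thesis by simp
qed

text \<open>The node \<open>- c\<close> takes the place of 0; its term is, up to sign, the quotient
  of the two products on the right. This is one half of the identity for \<open>sympart\<close>, the
  other half is the instance for \<open>- c\<close>.\<close>

lemma schur_odd_half:
  fixes A :: "'a::field_char_0 set"
  assumes "finite A" "odd (card A)" "0 \<notin> A" "-c \<notin> A"
  shows "(\<Sum>v\<in>A. v * (\<Prod>u\<in>A-{v}. u + c) * inverse (\<Prod>u\<in>A-{v}. schur v u)) =
    ((\<Prod>u\<in>A. u + c) + (\<Prod>u\<in>A. u - c)) / 2"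
proof -
  let ?E = "\<Prod>u\<in>A. [:u, 1:]"
  let ?M = "\<Prod>u\<in>A. u + c"
  have M: "?M \<noteq> 0" using assms by (auto simp: add_eq_0_iff2)
  have "1 = (\<Sum>v\<in>insert (-c) A. poly ?E v / (\<Prod>u\<in>insert (-c) A-{v}. v - u))"
    using assms by (subst sum_lagrange) (auto simp: degree_prod_linear coeff_prod_linear)
  also have "\<dots> = (\<Prod>u\<in>A. u - c) / (\<Prod>u\<in>A. - c - u) +
      (\<Sum>v\<in>A. (\<Prod>u\<in>A. v + u) / ((v + c) * (\<Prod>u\<in>A-{v}. v - u)))"
  proof -
    have "insert (-c) A - {v} = insert (-c) (A - {v})" if "v \<in> A" for v using that assms by auto
    with assms show ?thesis by (simp add: poly_prod add.commute cong: sum.cong)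
  qed
  also have "(\<Prod>u\<in>A. - c - u) = (\<Prod>u\<in>A. - (u + c))"
    by (intro prod.cong) auto
  also have "\<dots> = - ?M"
    using assms by (subst prod_uminus) simp
  also have "(\<Sum>v\<in>A. (\<Prod>u\<in>A. v + u) / ((v + c) * (\<Prod>u\<in>A-{v}. v - u))) =
      2 * (\<Sum>v\<in>A. v * (\<Prod>u\<in>A-{v}. u + c) * inverse (\<Prod>u\<in>A-{v}. schur v u)) / ?M"
    unfolding sum_distrib_left sum_divide_distrib
  proof (rule sum.cong[OF refl], goal_cases)
    case (1 v)
    have M': "?M = (v + c) * (\<Prod>u\<in>A-{v}. u + c)"
      using 1 assms by (subst prod.remove[of _ v]) auto
    with M have nz: "(\<Prod>u\<in>A-{v}. u + c) \<noteq> 0" by auto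
    have v0: "v \<noteq> 0" using 1 assms by auto
    show ?case
      unfolding schur_term[OF assms(1) 1 v0] M' using nz v0 by simp
  qed
  finally have "1 = (\<Prod>u\<in>A. u - c) / - ?M +
      2 * (\<Sum>v\<in>A. v * (\<Prod>u\<in>A-{v}. u + c) * inverse (\<Prod>u\<in>A-{v}. schur v u)) / ?M" .
  moreover have "z = (y + x) / 2" if "1 = x / - y + 2 * z / y" "y \<noteq> 0" for x y z :: 'a
    using that by (simp add: field_simps)
  ultimately show ?thesis using M by blast
qed

text \<open>The polynomial is \<open>(a - X) * (c\<^sup>2 + a * X)\<close> times the monic one with
  roots \<open>- u\<close>, the nodes are 0, \<open>- a\<close>, \<open>- c\<close> and
  \<open>A\<close>. The result is no product yet: the terms from 0, from \<open>- c\<close> and from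
  the top coefficient remain, and cancel only against their counterparts in the instance for
  \<open>- c\<close>.\<close>

lemma schur_even_half:
  fixes A :: "'a::field_char_0 set"
  assumes "finite A" "odd (card A)" "0 \<notin> A" "a \<noteq> 0" "- a \<notin> A" "c \<noteq> 0" "-c \<notin> A" "c \<noteq> a"
  shows "2 * (\<Sum>v\<in>A. schur a v * (c\<^sup>2 + a * v) * (\<Prod>u\<in>A-{v}. u + c) *
      inverse (\<Prod>u\<in>A-{v}. schur v u)) =
    (c - a) * (\<Prod>u\<in>A. u + c) + (a + c) * (\<Prod>u\<in>A. u - c) +
    2 * (a + c) * (\<Prod>u\<in>A. schur a u) * (\<Prod>u\<in>A. u + c)"
proof -
  let ?E = "\<Prod>u\<in>A. [:u, 1:]"
  define p where "p = [:a, -1:] * ([:c\<^sup>2, a:] * ?E)"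
  let ?B = "insert 0 (insert (-a) (insert (-c) A))"
  let ?M = "\<Prod>u\<in>A. u + c"
  have M: "?M \<noteq> 0" using assms by (auto simp: add_eq_0_iff2)
  have E: "degree ?E = card A" "coeff ?E (card A) = 1"
    using assms by (auto simp: degree_prod_linear coeff_prod_linear)
  have E0: "?E \<noteq> 0" using E by (metis coeff_0 zero_neq_one)
  have cB: "card ?B = card A + 3" using assms by auto
  have E1: "degree ([:c\<^sup>2, a:] * ?E) = card A + 1" using E E0 assms by (subst degree_mult_eq) auto
  have "degree p = card A + 2" unfolding p_def using E E0 E1 assms by (subst degree_mult_eq) auto
  moreover have "coeff p (card A + 2) = - a"
    using E E1 by (simp add: p_def coeff_eq_0)
  moreover have pp: "poly p v = (a - v) * ((c\<^sup>2 + a * v) * (\<Prod>u\<in>A. v + u))" for v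
    by (simp add: p_def poly_prod algebra_simps)
  ultimately have "- a = (\<Sum>v\<in>?B. poly p v / (\<Prod>u\<in>?B-{v}. v - u))"
    using assms cB by (subst sum_lagrange) auto
  also have "\<dots> = a * c\<^sup>2 * (\<Prod>u\<in>A. u) / (a * (c * (\<Prod>u\<in>A. -u))) +
      (2 * a * (c\<^sup>2 - a * a) * (\<Prod>u\<in>A. - a + u) / (- a * ((c - a) * (\<Prod>u\<in>A. - a - u))) +
      ((a + c) * (c\<^sup>2 - a * c) * (\<Prod>u\<in>A. - c + u) / (- c * ((a - c) * (\<Prod>u\<in>A. - c - u))) +
      (\<Sum>v\<in>A. (a - v) * (c\<^sup>2 + a * v) * (\<Prod>u\<in>A. v + u) /
         (v * ((v + a) * ((v + c) * (\<Prod>u\<in>A-{v}. v - u)))))))"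
  proof -
    have "?B - {0} = insert (-a) (insert (-c) A)" "?B - {-a} = insert 0 (insert (-c) A)"
       "?B - {-c} = insert 0 (insert (-a) A)" using assms by auto
    moreover have "?B - {v} = insert 0 (insert (-a) (insert (-c) (A - {v})))" if "v \<in> A" for v
      using that assms by auto
    ultimately show ?thesis using assms
      by (simp add: pp add.commute mult.assoc cong: sum.cong)
  qed
  also have "(\<Prod>u\<in>A. - a + u) = (\<Prod>u\<in>A. - (a - u))" by simp
  also have "(\<Prod>u\<in>A. - a - u) = (\<Prod>u\<in>A. - (a + u))" by simp
  also have "(\<Prod>u\<in>A. - c + u) = (\<Prod>u\<in>A. u - c)" by simp
  also have "(\<Prod>u\<in>A. - c - u) = (\<Prod>u\<in>A. - (u + c))"
    by (intro prod.cong) auto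
  also have "a * c\<^sup>2 * (\<Prod>u\<in>A. u) / (a * (c * (\<Prod>u\<in>A. -u))) = -c"
    using assms by (simp add: prod_uminus power2_eq_square)
  also have "2 * a * (c\<^sup>2 - a * a) * (\<Prod>u\<in>A. - (a - u)) / (- a * ((c - a) * (\<Prod>u\<in>A. - (a + u)))) =
     - (2 * (a + c) * (\<Prod>u\<in>A. schur a u))"
  proof -
    have "c\<^sup>2 - a * a = (c - a) * (a + c)" by (simp add: algebra_simps power2_eq_square)
    then show ?thesis using assms by (simp only: prod_uminus prod_dividef) simp
  qed
  also have "(a + c) * (c\<^sup>2 - a * c) * (\<Prod>u\<in>A. u - c) / (- c * ((a - c) * (\<Prod>u\<in>A. - (u + c)))) =
     - ((a + c) * (\<Prod>u\<in>A. u - c) / ?M)"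
  proof -
    have "c\<^sup>2 - a * c = (- c) * (a - c)" by (simp add: algebra_simps power2_eq_square)
    moreover have "a - c \<noteq> 0" using assms by auto
    ultimately show ?thesis using assms by (simp only: prod_uminus) simp
  qed
  also have "(\<Sum>v\<in>A. (a - v) * (c\<^sup>2 + a * v) * (\<Prod>u\<in>A. v + u) /
         (v * ((v + a) * ((v + c) * (\<Prod>u\<in>A-{v}. v - u))))) =
      2 * (\<Sum>v\<in>A. schur a v * (c\<^sup>2 + a * v) * (\<Prod>u\<in>A-{v}. u + c) *
         inverse (\<Prod>u\<in>A-{v}. schur v u)) / ?M"
    unfolding sum_distrib_left sum_divide_distrib
  proof (rule sum.cong[OF refl], goal_cases)
    case (1 v)
    moreover have "?M = (v + c) * (\<Prod>u\<in>A-{v}. u + c)"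
      using 1 assms by (subst prod.remove[of _ v]) auto
    ultimately show ?case using assms M by (subst schur_term) (auto simp: ac_simps)
  qed
  finally have "- a = - c + (- (2 * (a + c) * (\<Prod>u\<in>A. schur a u)) + (- ((a + c) * (\<Prod>u\<in>A. u - c) / ?M) +
      2 * (\<Sum>v\<in>A. schur a v * (c\<^sup>2 + a * v) * (\<Prod>u\<in>A-{v}. u + c) *
         inverse (\<Prod>u\<in>A-{v}. schur v u)) / ?M))"
    (is "- a = - c + (- (2 * (a + c) * ?R) + (- ((a + c) * ?N / ?M) + 2 * ?S / ?M))") .
  moreover have "z = c - a + x + y" if "- a = - c + (- x + (- y + z))" for x y z :: 'a
    using arg_cong[OF that, of "\<lambda>t. c + x + y + t"] by (simp add: algebra_simps)
  ultimately have "2 * ?S / ?M = c - a + 2 * (a + c) * ?R + (a + c) * ?N / ?M"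
    by blast
  moreover have "w = z * M" if "w / M = z" "M \<noteq> 0" for w z M :: 'a
    using that by (simp add: field_simps)
  ultimately have "2 * ?S = (c - a + 2 * (a + c) * ?R + (a + c) * ?N / ?M) * ?M"
    using M by blast
  also have "(c - a + 2 * (a + c) * r + (a + c) * z / y) * y =
      (c - a) * y + (a + c) * z + 2 * (a + c) * r * y" if "y \<noteq> 0" for r y z :: 'a
    using that by (simp add: field_simps)
  note this[OF M]
  finally show ?thesis .
qed

lemma mult_half_sum:
  fixes x y p q z :: "'a::field_char_0"
  shows "x * ((p + q) / 2) * z = (x * p * z + x * q * z) / 2"
    and "x * y * ((p + q) / 2) * z = (2 * (x * y * p * z) + 2 * (x * y * q * z)) / 4"
  by (simp_all add: field_simps)

text \<open>\<open>y\<close> and \<open>z\<close> are the products of \<open>u + c\<close> and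
  \<open>u - c\<close>, \<open>r\<close> is the Schur product. In the sum of the instances for
  \<open>c\<close> and \<open>- c\<close> the terms without \<open>r\<close> cancel.\<close>

lemma half_sum_identity:
  fixes a c r y z :: "'a::field_char_0"
  shows "((c - a) * y + (a + c) * z + 2 * (a + c) * r * y +
      ((- c - a) * z + (a - c) * y + 2 * (a - c) * r * z)) / 4 = r * (((a + c) * y + (a - c) * z) / 2)"
  by (simp add: field_simps)

text \<open>The part of the product of all \<open>u + c\<close> that is even in \<open>c\<close>. It
  depends on \<open>c\<close> only through \<open>c\<^sup>2\<close>, as the entries
  \<open>c\<^sup>2 + a * v\<close> do.\<close>

definition sympart :: "'a::field \<Rightarrow> 'a set \<Rightarrow> 'a" where
  "sympart c A = ((\<Prod>u\<in>A. u + c) + (\<Prod>u\<in>A. u - c)) / 2"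

lemma schur_odd_sympart:
  fixes A :: "'a::field_char_0 set"
  assumes "finite A" "odd (card A)" "0 \<notin> A" "c \<notin> A" "-c \<notin> A"
  shows "(\<Sum>v\<in>A. v * sympart c (A-{v}) * inverse (\<Prod>u\<in>A-{v}. schur v u)) = sympart c A"
proof -
  have "(\<Sum>v\<in>A. v * sympart c (A-{v}) * inverse (\<Prod>u\<in>A-{v}. schur v u)) =
    ((\<Sum>v\<in>A. v * (\<Prod>u\<in>A-{v}. u + c) * inverse (\<Prod>u\<in>A-{v}. schur v u)) +
     (\<Sum>v\<in>A. v * (\<Prod>u\<in>A-{v}. u + (-c)) * inverse (\<Prod>u\<in>A-{v}. schur v u))) / 2"
    unfolding sum.distrib[symmetric] sum_divide_distrib sympart_def
    by (rule sum.cong[OF refl], subst mult_half_sum) simp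
  also have "(\<Sum>v\<in>A. v * (\<Prod>u\<in>A-{v}. u + c) * inverse (\<Prod>u\<in>A-{v}. schur v u)) = sympart c A"
    using assms schur_odd_half[of A c] by (simp add: sympart_def)
  also have "(\<Sum>v\<in>A. v * (\<Prod>u\<in>A-{v}. u + (-c)) * inverse (\<Prod>u\<in>A-{v}. schur v u)) = sympart c A"
    using assms schur_odd_half[of A "-c"] by (simp add: sympart_def add.commute)
  also have "(sympart c A + sympart c A) / 2 = sympart c A" by simp
  finally show ?thesis .
qed

text \<open>Average of the instances for \<open>c\<close> and \<open>- c\<close>: only then does the
  sum become a multiple of the Schur product.\<close>

lemma schur_even_sympart:
  fixes A :: "'a::field_char_0 set"
  assumes "finite A" "odd (card A)" "0 \<notin> A" "a \<noteq> 0" "- a \<notin> A" "a \<notin> A" "c \<noteq> 0" "c \<notin> insert a A" "-c \<notin> insert a A"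
  shows "(\<Sum>v\<in>A. schur a v * (c\<^sup>2 + a * v) * sympart c (A-{v}) * inverse (\<Prod>u\<in>A-{v}. schur v u)) =
     (\<Prod>u\<in>A. schur a u) * sympart c (insert a A)"
proof -
  let ?f = "\<lambda>c. \<Sum>v\<in>A. schur a v * (c\<^sup>2 + a * v) * (\<Prod>u\<in>A-{v}. u + c) * inverse (\<Prod>u\<in>A-{v}. schur v u)"
  have "(\<Sum>v\<in>A. schur a v * (c\<^sup>2 + a * v) * sympart c (A-{v}) * inverse (\<Prod>u\<in>A-{v}. schur v u)) =
    (2 * ?f c + 2 * ?f (-c)) / 4"
    unfolding sum.distrib[symmetric] sum_divide_distrib sympart_def sum_distrib_left
    by (rule sum.cong[OF refl], subst mult_half_sum) simp
  also have "2 * ?f c = (c - a) * (\<Prod>u\<in>A. u + c) + (a + c) * (\<Prod>u\<in>A. u - c) +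
      2 * (a + c) * (\<Prod>u\<in>A. schur a u) * (\<Prod>u\<in>A. u + c)"
    using assms by (intro schur_even_half) auto
  also have "2 * ?f (-c) = (- c - a) * (\<Prod>u\<in>A. u + - c) + (a + - c) * (\<Prod>u\<in>A. u - - c) +
      2 * (a + - c) * (\<Prod>u\<in>A. schur a u) * (\<Prod>u\<in>A. u + - c)"
    using assms schur_even_half[of A a "-c"] by simp
  finally have sum_eq: "(\<Sum>v\<in>A. schur a v * (c\<^sup>2 + a * v) * sympart c (A-{v}) *
      inverse (\<Prod>u\<in>A-{v}. schur v u)) = (((c - a) * (\<Prod>u\<in>A. u + c) + (a + c) * (\<Prod>u\<in>A. u - c) +
      2 * (a + c) * (\<Prod>u\<in>A. schur a u) * (\<Prod>u\<in>A. u + c)) +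
      ((- c - a) * (\<Prod>u\<in>A. u + - c) + (a + - c) * (\<Prod>u\<in>A. u - - c) +
      2 * (a + - c) * (\<Prod>u\<in>A. schur a u) * (\<Prod>u\<in>A. u + - c))) / 4" .
  have ins: "sympart c (insert a A) =
      ((a + c) * (\<Prod>u\<in>A. u + c) + (a - c) * (\<Prod>u\<in>A. u - c)) / 2"
    using assms by (simp add: sympart_def)
  show ?thesis
    unfolding sum_eq ins diff_minus_eq_add add_uminus_conv_diff
    by (rule half_sum_identity)
qed

subsection \<open>Alternating products\<close>

text \<open>Product over the pairs \<open>i < j\<close> in \<open>I\<close>. The argument
  \<open>r\<close> will be \<open>schur\<close> (value of a Schur Pfaffian), the sign of the
  difference (sign of the sorting permutation) or the difference itself (Vandermonde).\<close>

definition altprod :: "('b \<Rightarrow> 'b \<Rightarrow> 'a::comm_ring_1) \<Rightarrow> (nat \<Rightarrow> 'b) \<Rightarrow> nat set \<Rightarrow> 'a" where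
  "altprod r x I = (\<Prod>j\<in>I. \<Prod>i\<in>{i\<in>I. i < j}. r (x i) (x j))"

text \<open>Sign of moving the index \<open>a\<close> in front of all smaller indices in
  \<open>I\<close>; it is the sign in a Pfaffian expansion.\<close>

definition possign :: "nat \<Rightarrow> nat set \<Rightarrow> 'a::comm_ring_1" where
  "possign a I = (\<Prod>k\<in>I. if k < a then -1 else 1)"

lemma of_real_possign: "of_real (possign a I) = possign a I"
  by (simp add: possign_def if_distrib cong: if_cong)

lemma altprod_empty [simp]: "altprod r x {} = 1"
  by (simp add: altprod_def)

lemma altprod_cong: "(\<And>i. i \<in> I \<Longrightarrow> x i = y i) \<Longrightarrow> altprod r x I = altprod r y I"
  unfolding altprod_def by (intro prod.cong) auto

text \<open>The pairs \<open>(k, a)\<close> with \<open>k < a\<close> occur in the wrong order;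
  turning each around costs one sign, together \<open>possign a I\<close>.\<close>

lemma altprod_insert:
  assumes r: "\<And>u v. r u v = - r v u" and "finite I" "a \<notin> I"
  shows "altprod r x (insert a I) = possign a I * (\<Prod>k\<in>I. r (x a) (x k)) * altprod r x I"
proof -
  have "altprod r x (insert a I) = (\<Prod>i\<in>{i\<in>insert a I. i < a}. r (x i) (x a)) *
      (\<Prod>j\<in>I. \<Prod>i\<in>{i\<in>insert a I. i < j}. r (x i) (x j))"
    using assms(2-) by (simp add: altprod_def)
  also have "(\<Prod>i\<in>{i\<in>insert a I. i < a}. r (x i) (x a)) =
      (\<Prod>k\<in>I. if k < a then r (x k) (x a) else 1)"
    using assms(2-) by (subst prod.inter_filter[symmetric]) (auto intro!: prod.cong)
  also have "(\<Prod>j\<in>I. \<Prod>i\<in>{i\<in>insert a I. i < j}. r (x i) (x j)) =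
      (\<Prod>j\<in>I. (if j < a then 1 else r (x a) (x j)) * (\<Prod>i\<in>{i\<in>I. i < j}. r (x i) (x j)))"
  proof (rule prod.cong[OF refl], goal_cases)
    case (1 j)
    show ?case
    proof (cases "j < a")
      case True
      then have "{i\<in>insert a I. i < j} = {i\<in>I. i < j}" by auto
      with True show ?thesis by simp
    next
      case False
      with 1 assms(2-) have "{i\<in>insert a I. i < j} = insert a {i\<in>I. i < j}"
        by (auto simp: not_less le_less)
      with False assms(2-) show ?thesis by simp
    qed
  qed
  also have "(\<Prod>k\<in>I. if k < a then r (x k) (x a) else 1) * \<dots> =
     (\<Prod>k\<in>I. (if k < a then r (x k) (x a) else 1) * (if k < a then 1 else r (x a) (x k))) *
     altprod r x I"
    by (simp add: altprod_def prod.distrib mult.assoc)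
  also have "(\<Prod>k\<in>I. (if k < a then r (x k) (x a) else 1) * (if k < a then 1 else r (x a) (x k))) =
     possign a I * (\<Prod>k\<in>I. r (x a) (x k))"
    unfolding possign_def prod.distrib[symmetric]
  proof (rule prod.cong[OF refl], goal_cases)
    case (1 k)
    show ?case using r[of "x k" "x a"] by (cases "k < a") simp_all
  qed
  finally show ?thesis .
qed

text \<open>Once both \<open>a\<close> and \<open>b\<close> are pulled out, the position signs do
  not involve \<open>x\<close>, the products over the remaining indices are exchanged, and only
  \<open>r (x a) (x b)\<close> changes sign.\<close>

lemma altprod_transpose:
  assumes r: "\<And>u v. r u v = - r v u" and "finite I" "a \<in> I" "b \<in> I" "a \<noteq> b"
  shows "altprod r (x \<circ> transpose a b) I = - altprod r x I"
proof -
  define J where "J = I - {a, b}"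
  have I: "I = insert a (insert b J)" and J: "finite J" "a \<notin> J" "b \<notin> J" "a \<notin> insert b J"
    using assms(2-) by (auto simp: J_def)
  have [simp]: "transpose a b k = k" if "k \<in> J" for k
    using that J by (auto simp: transpose_def)
  have *: "altprod r (x \<circ> transpose a b) J = altprod r x J"
    by (rule altprod_cong) auto
  have **: "(\<Prod>k\<in>J. r z ((x \<circ> transpose a b) k)) = (\<Prod>k\<in>J. r z (x k))" for z
    by (rule prod.cong) auto
  have "altprod r y I = (possign a (insert b J) * possign b J) *
      (r (y a) (y b) * ((\<Prod>k\<in>J. r (y a) (y k)) * (\<Prod>k\<in>J. r (y b) (y k)))) * altprod r y J" for y
  proof -
    have "altprod r y (insert a (insert b J)) = possign a (insert b J) *
        (\<Prod>k\<in>insert b J. r (y a) (y k)) * altprod r y (insert b J)"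
      by (rule altprod_insert[OF r]) (use J in auto)
    moreover have "altprod r y (insert b J) = possign b J * (\<Prod>k\<in>J. r (y b) (y k)) * altprod r y J"
      by (rule altprod_insert[OF r]) (use J in auto)
    ultimately show ?thesis unfolding I using J by (simp add: ac_simps)
  qed
  note e = this
  show ?thesis
    unfolding e[of x] e[of "x \<circ> transpose a b"] * **
    by (simp add: ac_simps) (subst r[of "x b" "x a"], simp)
qed

text \<open>Every permutation is a product of transpositions; the induction is generalized over
  \<open>x\<close> because each transposition is absorbed into \<open>x\<close>.\<close>

lemma altprod_permutes:
  assumes r: "\<And>u v. r u v = - r v u" and "finite I" "p permutes I"
  shows "altprod r (x \<circ> p) I = of_int (sign p) * altprod r x I"
proof -
  have "\<forall>x. altprod r (x \<circ> p) I = of_int (sign p) * altprod r x I"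
    using assms(3,2)
  proof (induction rule: permutes_induct)
    case id
    show ?case by (simp add: id_def[symmetric] sign_id)
  next
    case (swap a b p)
    show ?case
    proof
      fix x
      have "permutation p" "permutation (transpose a b)"
        using swap assms(2) permutation_permutes permutation_swap_id by auto
      then have sg: "sign (transpose a b \<circ> p) = - sign p" if "a \<noteq> b"
        using that by (simp add: sign_compose sign_swap_id)
      have "altprod r (x \<circ> (transpose a b \<circ> p)) I = of_int (sign p) * altprod r (x \<circ> transpose a b) I"
        using swap(5) by (metis o_assoc)
      then show "altprod r (x \<circ> (transpose a b \<circ> p)) I = of_int (sign (transpose a b \<circ> p)) * altprod r x I"
        using sg altprod_transpose[of r I a b x, OF r assms(2)] swap by (cases "a = b") auto
    qed
  qed
  then show ?thesis by blast
qed

text \<open>The cofactor of \<open>a\<close> in a Pfaffian expansion is the whole product divided by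
  the factors involving \<open>a\<close>. Hence such an expansion, divided by the product, is one of
  the Lagrange sums above.\<close>

lemma altprod_remove:
  fixes r :: "'b \<Rightarrow> 'b \<Rightarrow> 'a::field"
  assumes r: "\<And>u v. r u v = - r v u" and "finite I" "a \<in> I" "\<And>k. k \<in> I - {a} \<Longrightarrow> r (x a) (x k) \<noteq> 0"
  shows "possign a (I - {a}) * altprod r x (I - {a}) =
    altprod r x I * inverse (\<Prod>k\<in>I-{a}. r (x a) (x k))"
proof -
  have "altprod r x I = possign a (I-{a}) * (\<Prod>k\<in>I-{a}. r (x a) (x k)) * altprod r x (I-{a})"
    using altprod_insert[of r "I-{a}" a x, OF r] assms(2,3) by (simp add: insert_absorb)
  moreover have "(\<Prod>k\<in>I-{a}. r (x a) (x k)) \<noteq> 0" using assms(2-) by auto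
  ultimately show ?thesis by simp
qed

lemma schur_antisym: "schur u v = - schur v u"
  for u v :: "'a::field"
  by (simp add: minus_divide_left add.commute)

lemma prod_image_remove:
  assumes "inj_on x I" "j \<in> I"
  shows "(\<Prod>u\<in>x ` I - {x j}. f u) = (\<Prod>k\<in>I-{j}. f (x k))"
proof -
  have "x ` I - {x j} = x ` (I - {j})" using assms by (auto simp: inj_on_def)
  then show ?thesis using assms by (simp add: prod.reindex inj_on_diff)
qed

section \<open>Expansion of Schur products along an index\<close>

context
  fixes x :: "nat \<Rightarrow> 'a::field_char_0" and I :: "nat set"
  assumes fin: "finite I" and inj: "inj_on x I"
    and nz: "\<And>i j. i \<in> I \<Longrightarrow> j \<in> I \<Longrightarrow> x i + x j \<noteq> 0"
begin

lemma schur_nonzero: "i \<in> I \<Longrightarrow> j \<in> I - {i} \<Longrightarrow> schur (x i) (x j) \<noteq> 0"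
  using nz inj by (auto simp: inj_on_def)

lemma zero_notin: "0 \<notin> x ` I"
  using nz by (metis add_0 image_iff)

text \<open>Pfaffian of odd order, bordered by a row of ones. Divided by the left side it is
  \<open>schur_odd\<close> for the values of \<open>x\<close> on \<open>I\<close>.\<close>

lemma altprod_schur_odd:
  assumes "odd (card I)"
  shows "altprod schur x I = (\<Sum>j\<in>I. possign j (I-{j}) * altprod schur x (I-{j}))"
proof -
  have "(\<Sum>j\<in>I. possign j (I-{j}) * altprod schur x (I-{j})) =
    (\<Sum>j\<in>I. altprod schur x I * inverse (\<Prod>k\<in>I-{j}. schur (x j) (x k)))"
    using fin schur_nonzero by (intro sum.cong refl altprod_remove schur_antisym) auto
  also have "\<dots> = altprod schur x I * (\<Sum>v\<in>x ` I. inverse (\<Prod>u\<in>x ` I-{v}. schur v u))"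
    using inj by (simp add: sum.reindex sum_distrib_left prod_image_remove)
  also have "(\<Sum>v\<in>x ` I. inverse (\<Prod>u\<in>x ` I-{v}. schur v u)) = 1"
    using fin zero_notin assms inj by (intro schur_odd) (auto simp: card_image)
  finally show ?thesis by simp
qed

text \<open>Here the border entries are the \<open>x j\<close> themselves, which supply the factor
  \<open>v\<close> in \<open>schur_odd_sympart\<close>.\<close>

lemma altprod_schur_odd_sympart:
  assumes "odd (card I)" "c \<notin> x ` I" "-c \<notin> x ` I"
  shows "altprod schur x I * sympart c (x ` I) =
    (\<Sum>j\<in>I. possign j (I-{j}) * x j * (altprod schur x (I-{j}) * sympart c (x ` (I-{j}))))"
proof -
  have im: "x ` I - {x j} = x ` (I - {j})" if "j \<in> I" for j
    using inj that by (auto simp: inj_on_def)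
  have "(\<Sum>j\<in>I. possign j (I-{j}) * x j * (altprod schur x (I-{j}) * sympart c (x ` (I-{j})))) =
    (\<Sum>j\<in>I. (possign j (I-{j}) * altprod schur x (I-{j})) * (x j * sympart c (x ` (I-{j}))))"
    by (intro sum.cong) (auto simp: ac_simps)
  also have "\<dots> =
    (\<Sum>j\<in>I. (altprod schur x I * inverse (\<Prod>k\<in>I-{j}. schur (x j) (x k))) *
       (x j * sympart c (x ` (I-{j}))))"
    using fin schur_nonzero by (intro sum.cong refl arg_cong2[where f="(*)"] altprod_remove schur_antisym) auto
  also have "\<dots> = altprod schur x I *
    (\<Sum>v\<in>x ` I. v * sympart c (x ` I - {v}) * inverse (\<Prod>u\<in>x ` I-{v}. schur v u))"
    unfolding sum.reindex[OF inj] sum_distrib_left o_def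
    by (rule sum.cong[OF refl], subst prod_image_remove[OF inj], assumption,
        subst im, assumption, simp only: ac_simps)
  also have "(\<Sum>v\<in>x ` I. v * sympart c (x ` I - {v}) * inverse (\<Prod>u\<in>x ` I-{v}. schur v u)) =
      sympart c (x ` I)"
    using fin zero_notin assms inj by (intro schur_odd_sympart) (auto simp: card_image)
  finally show ?thesis by simp
qed

end

context
  fixes x :: "nat \<Rightarrow> 'a::field_char_0" and I :: "nat set" and a :: nat
  assumes fin: "finite I" and inj: "inj_on x (insert a I)" and a: "a \<notin> I"
    and nz: "\<And>i j. i \<in> insert a I \<Longrightarrow> j \<in> insert a I \<Longrightarrow> x i + x j \<noteq> 0"
begin

lemma schur_even_conditions:
  "inj_on x I" "\<And>i j. i \<in> I \<Longrightarrow> j \<in> I \<Longrightarrow> x i + x j \<noteq> 0"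
  "x a \<notin> x ` I" "- x a \<notin> x ` I" "x a \<noteq> 0" "0 \<notin> x ` I"
proof -
  show "- x a \<notin> x ` I"
    using nz by (metis add.right_inverse image_iff insertI1 insertI2)
  show "x a \<noteq> 0" using nz[of a a] by auto
  show "0 \<notin> x ` I" using nz by (metis add_0 image_iff insertI2)
qed (use inj a nz in auto)

text \<open>Expansion along \<open>a\<close>: the product of all \<open>schur (x a) (x j)\<close>
  that \<open>altprod_insert\<close> splits off is what \<open>schur_even\<close> produces from the
  sum.\<close>

lemma altprod_schur_even:
  assumes "odd (card I)"
  shows "altprod schur x (insert a I) = possign a I *
    (\<Sum>j\<in>I. possign j (I-{j}) * schur (x a) (x j) * altprod schur x (I-{j}))"
proof -
  note cond = schur_even_conditions
  have "(\<Sum>j\<in>I. possign j (I-{j}) * schur (x a) (x j) * altprod schur x (I-{j})) =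
    (\<Sum>j\<in>I. (possign j (I-{j}) * altprod schur x (I-{j})) * schur (x a) (x j))"
    by (simp add: ac_simps)
  also have "\<dots> = (\<Sum>j\<in>I. (altprod schur x I * inverse (\<Prod>k\<in>I-{j}. schur (x j) (x k))) * schur (x a) (x j))"
    using fin schur_nonzero[OF fin cond(1,2)]
    by (intro sum.cong refl arg_cong2[where f="(*)"] altprod_remove schur_antisym) auto
  also have "\<dots> = altprod schur x I *
     (\<Sum>v\<in>x ` I. schur (x a) v * inverse (\<Prod>u\<in>x ` I-{v}. schur v u))"
    using cond(1) by (simp add: sum.reindex sum_distrib_left prod_image_remove ac_simps)
  also have "(\<Sum>v\<in>x ` I. schur (x a) v * inverse (\<Prod>u\<in>x ` I-{v}. schur v u)) =
     (\<Prod>u\<in>x ` I. schur (x a) u)"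
    using fin cond assms by (intro schur_even) (auto simp: card_image)
  also have "\<dots> = (\<Prod>k\<in>I. schur (x a) (x k))"
    using cond(1) by (simp add: prod.reindex)
  finally show ?thesis
    using altprod_insert[of schur I a x, OF schur_antisym fin a] by (simp add: ac_simps)
qed

text \<open>The entries carry the additional factor \<open>c\<^sup>2 + x a * x j\<close>, and
  \<open>schur_even_sympart\<close> enlarges the argument of \<open>sympart\<close> from
  \<open>I\<close> without \<open>j\<close> to all of \<open>insert a I\<close>.\<close>

lemma altprod_schur_even_sympart:
  assumes "odd (card I)" "c \<noteq> 0" "c \<notin> x ` insert a I" "-c \<notin> x ` insert a I"
  shows "altprod schur x (insert a I) * sympart c (x ` insert a I) = possign a I *
    (\<Sum>j\<in>I. possign j (I-{j}) * (schur (x a) (x j) * (c\<^sup>2 + x a * x j)) *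
      (altprod schur x (I-{j}) * sympart c (x ` (I-{j}))))"
proof -
  note cond = schur_even_conditions
  have im: "x ` I - {x j} = x ` (I - {j})" if "j \<in> I" for j
    using cond(1) that by (auto simp: inj_on_def)
  have "(\<Sum>j\<in>I. possign j (I-{j}) * (schur (x a) (x j) * (c\<^sup>2 + x a * x j)) *
      (altprod schur x (I-{j}) * sympart c (x ` (I-{j})))) =
    (\<Sum>j\<in>I. (possign j (I-{j}) * altprod schur x (I-{j})) *
      (schur (x a) (x j) * (c\<^sup>2 + x a * x j) * sympart c (x ` (I-{j}))))"
    by (simp only: ac_simps)
  also have "\<dots> = (\<Sum>j\<in>I. (altprod schur x I * inverse (\<Prod>k\<in>I-{j}. schur (x j) (x k))) *
      (schur (x a) (x j) * (c\<^sup>2 + x a * x j) * sympart c (x ` (I-{j}))))"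
    using fin schur_nonzero[OF fin cond(1,2)]
    by (intro sum.cong refl arg_cong2[where f="(*)"] altprod_remove schur_antisym) auto
  also have "\<dots> = altprod schur x I *
     (\<Sum>v\<in>x ` I. schur (x a) v * (c\<^sup>2 + x a * v) * sympart c (x ` I - {v}) *
        inverse (\<Prod>u\<in>x ` I-{v}. schur v u))"
    unfolding sum.reindex[OF cond(1)] sum_distrib_left o_def
    by (rule sum.cong[OF refl], subst prod_image_remove[OF cond(1)], assumption,
        subst im, assumption, simp only: ac_simps)
  also have "(\<Sum>v\<in>x ` I. schur (x a) v * (c\<^sup>2 + x a * v) * sympart c (x ` I - {v}) *
        inverse (\<Prod>u\<in>x ` I-{v}. schur v u)) =
     (\<Prod>u\<in>x ` I. schur (x a) u) * sympart c (insert (x a) (x ` I))"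
    using fin cond assms by (intro schur_even_sympart) (auto simp: card_image)
  also have "(\<Prod>u\<in>x ` I. schur (x a) u) = (\<Prod>k\<in>I. schur (x a) (x k))"
    using cond(1) by (simp add: prod.reindex)
  finally show ?thesis
    using altprod_insert[of schur I a x, OF schur_antisym fin a] by (simp add: ac_simps)
qed

end

text \<open>The sign of a difference is a limit of Schur quotients; the factor \<open>1 + i / R\<close> keeps
  the arguments distinct when \<open>x i = x j\<close>.\<close>

definition schur_pt :: "(nat \<Rightarrow> real) \<Rightarrow> real \<Rightarrow> nat \<Rightarrow> real" where
  "schur_pt x R i = (1 + real i / R) * R powr x i"

lemma schur_pt_pos: "R > 0 \<Longrightarrow> schur_pt x R i > 0"
  by (auto simp: schur_pt_def intro!: mult_pos_pos add_pos_nonneg)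

text \<open>With \<open>L\<close> the limit of the quotient of the two points, the Schur quotient
  tends to \<open>(1 - L) / (1 + L)\<close>; here \<open>L\<close> is 0 for \<open>x i > x j\<close>
  and 1 for equality.\<close>

lemma tendsto_schur_pt: "((\<lambda>R. schur (schur_pt x R i) (schur_pt x R j)) \<longlongrightarrow> sgn (x i - x j)) at_top"
proof -
  have ev: "eventually (\<lambda>R::real. R > 0) at_top" by (rule eventually_gt_at_top)
  have inv0: "((\<lambda>R::real. c / R) \<longlongrightarrow> 0) at_top" for c
    by (intro real_tendsto_divide_at_top[where c = c] tendsto_const filterlim_ident)
  have base: "((\<lambda>R. schur (schur_pt x R i) (schur_pt x R j)) \<longlongrightarrow> (1 - L) / (1 + L)) at_top"
    if L: "((\<lambda>R. R powr (x j - x i)) \<longlongrightarrow> L) at_top" "L \<ge> 0" for L i j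
  proof -
    have "((\<lambda>R. (1 + real j / R) / (1 + real i / R) * R powr (x j - x i)) \<longlongrightarrow> (1 + 0) / (1 + 0) * L) at_top"
      by (intro tendsto_intros inv0 L) auto
    moreover have "eventually (\<lambda>R. (1 + real j / R) / (1 + real i / R) * R powr (x j - x i) =
        schur_pt x R j / schur_pt x R i) at_top"
      using ev by eventually_elim (simp add: schur_pt_def powr_diff)
    ultimately have "((\<lambda>R. schur_pt x R j / schur_pt x R i) \<longlongrightarrow> (1 + 0) / (1 + 0) * L) at_top"
      by (rule Lim_transform_eventually)
    then have q: "((\<lambda>R. schur_pt x R j / schur_pt x R i) \<longlongrightarrow> L) at_top" by simp
    have "((\<lambda>R. (1 - schur_pt x R j / schur_pt x R i) / (1 + schur_pt x R j / schur_pt x R i))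
        \<longlongrightarrow> (1 - L) / (1 + L)) at_top"
      using L by (intro tendsto_intros q) auto
    moreover have "eventually (\<lambda>R. (1 - schur_pt x R j / schur_pt x R i) / (1 + schur_pt x R j / schur_pt x R i)
        = schur (schur_pt x R i) (schur_pt x R j)) at_top"
      using ev
    proof eventually_elim
      case (elim R)
      have "(1 - v / u) / (1 + v / u) = schur u v" if "u > 0" "v > 0" for u v :: real
      proof -
        have "1 - v / u = (u - v) / u" "1 + v / u = (u + v) / u"
          using that by (simp_all add: field_simps)
        then show ?thesis using that by simp
      qed
      then show ?case using schur_pt_pos[OF elim] by blast
    qed
    ultimately show ?thesis by (rule Lim_transform_eventually)
  qed
  have neg: "((\<lambda>R. R powr c) \<longlongrightarrow> 0) at_top" if "c < 0" for c :: real
    using tendsto_neg_powr[OF that filterlim_ident] by simp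
  consider "x i = x j" | "x i > x j" | "x i < x j" by linarith
  then show ?thesis
  proof cases
    case 1
    have "((\<lambda>R. R powr (x j - x i)) \<longlongrightarrow> 1) at_top"
      by (rule Lim_transform_eventually[OF tendsto_const])
         (use ev 1 in \<open>auto elim!: eventually_mono\<close>)
    from base[OF this] 1 show ?thesis by simp
  next
    case 2
    with base[OF neg] show ?thesis by simp
  next
    case 3
    \<comment> \<open>The quotient of the points is unbounded here, so the limit is taken with
      \<open>i\<close> and \<open>j\<close> exchanged.\<close>
    have "((\<lambda>R. schur (schur_pt x R j) (schur_pt x R i)) \<longlongrightarrow> 1) at_top"
      using base[OF neg] 3 by fastforce
    from tendsto_minus[OF this] show ?thesis
      using 3 by (subst schur_antisym) simp
  qed
qed

lemma eventually_schur_pt_inj: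
  assumes "finite I"
  shows "eventually (\<lambda>R. inj_on (schur_pt x R) I) at_top"
proof -
  have "eventually (\<lambda>R. schur_pt x R i \<noteq> schur_pt x R j) at_top" if "i \<noteq> j" for i j
  proof (cases "x i = x j")
    case True
    show ?thesis using eventually_gt_at_top[of 0]
      by eventually_elim (use that True in \<open>simp add: schur_pt_def\<close>)
  next
    case False
    then have "sgn (x i - x j) \<noteq> 0" by (simp add: sgn_if)
    from tendsto_imp_eventually_ne[OF tendsto_schur_pt this]
    show ?thesis by (rule eventually_mono) auto
  qed
  then have "eventually (\<lambda>R. \<forall>i\<in>I. \<forall>j\<in>I. i \<noteq> j \<longrightarrow> schur_pt x R i \<noteq> schur_pt x R j) at_top"
    using assms by (intro eventually_ball_finite ballI) (auto simp: eventually_mono)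
  then show ?thesis by (rule eventually_mono) (auto simp: inj_on_def)
qed

abbreviation sgn_diff :: "real \<Rightarrow> real \<Rightarrow> real" where
  "sgn_diff u v \<equiv> sgn (u - v)"

lemma tendsto_altprod_schur_pt:
  "((\<lambda>R. altprod schur (schur_pt x R) I) \<longlongrightarrow> altprod sgn_diff x I) at_top"
  unfolding altprod_def by (intro tendsto_intros tendsto_schur_pt)

text \<open>The rule holds for the points \<open>schur_pt x R\<close>, which are positive and
  eventually distinct. In the limit it survives for all \<open>x\<close>, including those with equal
  coordinates, where \<open>sgn\<close> is 0.\<close>

lemma altprod_sgn_odd:
  assumes "finite I" "odd (card I)"
  shows "altprod sgn_diff x I = (\<Sum>j\<in>I. possign j (I-{j}) * altprod sgn_diff x (I-{j}))"
proof (rule tendsto_unique[OF _ tendsto_altprod_schur_pt])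
  have "((\<lambda>R. \<Sum>j\<in>I. possign j (I-{j}) * altprod schur (schur_pt x R) (I-{j})) \<longlongrightarrow>
    (\<Sum>j\<in>I. possign j (I-{j}) * altprod sgn_diff x (I-{j}))) at_top"
    by (intro tendsto_intros tendsto_altprod_schur_pt)
  moreover have "eventually (\<lambda>R. (\<Sum>j\<in>I. possign j (I-{j}) * altprod schur (schur_pt x R) (I-{j})) =
    altprod schur (schur_pt x R) I) at_top"
    using eventually_schur_pt_inj[OF assms(1), of x] eventually_gt_at_top[of 0]
  proof eventually_elim
    case (elim R)
    have "schur_pt x R i + schur_pt x R j \<noteq> 0" for i j
      using schur_pt_pos[OF elim(2), of x] by (metis add_pos_pos less_irrefl)
    then show ?case using assms elim by (intro altprod_schur_odd[symmetric]) auto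
  qed
  ultimately show "((\<lambda>R. altprod schur (schur_pt x R) I) \<longlongrightarrow>
      (\<Sum>j\<in>I. possign j (I-{j}) * altprod sgn_diff x (I-{j}))) at_top"
    by (rule Lim_transform_eventually)
qed auto

lemma altprod_sgn_even:
  assumes "finite I" "odd (card I)" "a \<notin> I"
  shows "altprod sgn_diff x (insert a I) = possign a I *
    (\<Sum>j\<in>I. possign j (I-{j}) * sgn_diff (x a) (x j) * altprod sgn_diff x (I-{j}))"
proof (rule tendsto_unique[OF _ tendsto_altprod_schur_pt])
  have "((\<lambda>R. possign a I * (\<Sum>j\<in>I. possign j (I-{j}) * schur (schur_pt x R a) (schur_pt x R j) *
        altprod schur (schur_pt x R) (I-{j}))) \<longlongrightarrow>
    possign a I * (\<Sum>j\<in>I. possign j (I-{j}) * sgn_diff (x a) (x j) * altprod sgn_diff x (I-{j}))) at_top"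
    by (intro tendsto_intros tendsto_altprod_schur_pt tendsto_schur_pt)
  moreover have "eventually (\<lambda>R. possign a I * (\<Sum>j\<in>I. possign j (I-{j}) *
      schur (schur_pt x R a) (schur_pt x R j) * altprod schur (schur_pt x R) (I-{j})) =
    altprod schur (schur_pt x R) (insert a I)) at_top"
    using eventually_schur_pt_inj[OF finite.insertI[OF assms(1)], of x a] eventually_gt_at_top[of 0]
  proof eventually_elim
    case (elim R)
    have "schur_pt x R i + schur_pt x R j \<noteq> 0" for i j
      using schur_pt_pos[OF elim(2), of x] by (metis add_pos_pos less_irrefl)
    then show ?case using assms elim by (intro altprod_schur_even[symmetric]) auto
  qed
  ultimately show "((\<lambda>R. altprod schur (schur_pt x R) (insert a I)) \<longlongrightarrow>
      possign a I * (\<Sum>j\<in>I. possign j (I-{j}) * sgn_diff (x a) (x j) * altprod sgn_diff x (I-{j}))) at_top"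
    by (rule Lim_transform_eventually)
qed auto

subsection \<open>Pfaffian expansion of sign-weighted sums\<close>

text \<open>Values outside \<open>I\<close> are fixed to 0, so that a tuple is exactly one function
  and matches the encoding of points.\<close>

definition tuples :: "nat set \<Rightarrow> real set \<Rightarrow> (nat \<Rightarrow> real) set" where
  "tuples I D = {x. (\<forall>i\<in>I. x i \<in> D) \<and> (\<forall>i. i \<notin> I \<longrightarrow> x i = 0)}"

lemma tuples_empty [simp]: "tuples {} D = {\<lambda>_. 0}"
  by (auto simp: tuples_def)

lemma bij_betw_tuples_insert:
  assumes "a \<notin> I"
  shows "bij_betw (\<lambda>(v, x). x(a := v)) (D \<times> tuples I D) (tuples (insert a I) D)"
proof (rule bij_betw_byWitness[where f' = "\<lambda>x. (x a, x(a := 0))"])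
  show "\<forall>z\<in>D \<times> tuples I D. ((case z of (v, x) \<Rightarrow> x(a := v)) a, (case z of (v, x) \<Rightarrow> x(a := v))(a := 0)) = z"
    using assms by (auto simp: tuples_def)
qed (use assms in \<open>auto simp: tuples_def\<close>)

lemma sum_tuples_insert:
  assumes "a \<notin> I"
  shows "(\<Sum>x\<in>tuples (insert a I) D. F x) = (\<Sum>v\<in>D. \<Sum>x\<in>tuples I D. F (x(a := v)))"
proof -
  have "(\<Sum>x\<in>tuples (insert a I) D. F x) = (\<Sum>z\<in>D \<times> tuples I D. F ((\<lambda>(v, x). x(a := v)) z))"
    by (rule sum.reindex_bij_betw[OF bij_betw_tuples_insert[OF assms], symmetric])
  then show ?thesis by (simp add: sum.cartesian_product split_def)
qed

lemma finite_tuples: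
  assumes "finite I" "finite D"
  shows "finite (tuples I D)"
  using assms(1)
proof induction
  case (insert a I)
  from bij_betw_finite[OF bij_betw_tuples_insert[OF insert(2)]] show ?case
    using insert assms(2) by auto
qed auto

lemma sum_prod_tuples:
  fixes g :: "nat \<Rightarrow> real \<Rightarrow> 'a::comm_semiring_1"
  assumes "finite I"
  shows "(\<Sum>x\<in>tuples I D. \<Prod>i\<in>I. g i (x i)) = (\<Prod>i\<in>I. \<Sum>v\<in>D. g i v)"
  using assms
proof induction
  case (insert a I)
  have "(\<Prod>i\<in>insert a I. g i ((x(a := v)) i)) = g a v * (\<Prod>i\<in>I. g i (x i))" for x v
    using insert by (simp, intro arg_cong2[where f = "(*)"] prod.cong) auto
  then show ?case
    using insert by (simp add: sum_tuples_insert sum_distrib_left[symmetric] sum_distrib_right[symmetric])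
qed auto

text \<open>The sum over all tuples weighted with the sign that sorts them is a Pfaffian; it is
  characterized here by expansion along an index.\<close>

definition sorted_sum :: "real set \<Rightarrow> (nat \<Rightarrow> real \<Rightarrow> 'a::real_field) \<Rightarrow> nat set \<Rightarrow> 'a" where
  "sorted_sum D g I = (\<Sum>x\<in>tuples I D. (\<Prod>i\<in>I. g i (x i)) * of_real (altprod sgn_diff x I))"

text \<open>Each term of the sign expansion leaves out one coordinate \<open>j\<close>, so the sum
  over that coordinate splits off. It is a border entry of the Pfaffian.\<close>

lemma sorted_sum_odd:
  assumes "finite I" "odd (card I)"
  shows "sorted_sum D g I = (\<Sum>j\<in>I. possign j (I-{j}) * (\<Sum>v\<in>D. g j v) * sorted_sum D g (I-{j}))"
proof -
  have "sorted_sum D g I = (\<Sum>x\<in>tuples I D. \<Sum>j\<in>I. (\<Prod>i\<in>I. g i (x i)) *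
      (possign j (I-{j}) * of_real (altprod sgn_diff x (I-{j}))))"
    unfolding sorted_sum_def
    by (subst altprod_sgn_odd[OF assms]) (simp add: sum_distrib_left of_real_possign)
  also have "\<dots> = (\<Sum>j\<in>I. \<Sum>x\<in>tuples I D. (\<Prod>i\<in>I. g i (x i)) *
      (possign j (I-{j}) * of_real (altprod sgn_diff x (I-{j}))))"
    by (rule sum.swap)
  also have "\<dots> = (\<Sum>j\<in>I. possign j (I-{j}) * (\<Sum>v\<in>D. g j v) * sorted_sum D g (I-{j}))"
  proof (rule sum.cong[OF refl])
    fix j assume j: "j \<in> I"
    define J where "J = I - {j}"
    have I: "I = insert j J" and J: "j \<notin> J" "finite J" using j assms by (auto simp: J_def)
    have p: "(\<Prod>i\<in>I. g i ((x(j := v)) i)) = g j v * (\<Prod>i\<in>J. g i (x i))" for x v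
    proof -
      have "(\<Prod>i\<in>J. g i ((x(j := v)) i)) = (\<Prod>i\<in>J. g i (x i))"
        using J by (intro prod.cong) auto
      then show ?thesis unfolding I using J by simp
    qed
    have a: "altprod sgn_diff (x(j := v)) J = altprod sgn_diff x J" for x v
      using J by (intro altprod_cong) auto
    have "(\<Sum>x\<in>tuples I D. (\<Prod>i\<in>I. g i (x i)) * (possign j J * of_real (altprod sgn_diff x J))) =
      (\<Sum>v\<in>D. \<Sum>x\<in>tuples J D. g j v * (\<Prod>i\<in>J. g i (x i)) * (possign j J * of_real (altprod sgn_diff x J)))"
      by (subst sum_tuples_insert[OF J(1), folded I]) (simp only: p a)
    also have "\<dots> = (\<Sum>v\<in>D. possign j J * g j v * sorted_sum D g J)"
      unfolding sorted_sum_def sum_distrib_left by (intro sum.cong refl) (simp only: ac_simps)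
    also have "\<dots> = possign j J * (\<Sum>v\<in>D. g j v) * sorted_sum D g J"
      by (simp only: sum_distrib_left sum_distrib_right)
    finally show "(\<Sum>x\<in>tuples I D. (\<Prod>i\<in>I. g i (x i)) *
        (possign j (I-{j}) * of_real (altprod sgn_diff x (I-{j})))) =
      possign j (I-{j}) * (\<Sum>v\<in>D. g j v) * sorted_sum D g (I-{j})"
      by (simp add: J_def)
  qed
  finally show ?thesis .
qed

text \<open>Here two coordinates split off, \<open>a\<close> and \<open>j\<close>; their double sum
  is the entry of the Pfaffian at this pair.\<close>

lemma sorted_sum_even:
  assumes "finite I" "odd (card I)" "a \<notin> I"
  shows "sorted_sum D g (insert a I) = possign a I * (\<Sum>j\<in>I. possign j (I-{j}) *
    (\<Sum>u\<in>D. \<Sum>v\<in>D. g a u * g j v * of_real (sgn_diff u v)) * sorted_sum D g (I-{j}))"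
proof -
  have "sorted_sum D g (insert a I) = (\<Sum>x\<in>tuples (insert a I) D. \<Sum>j\<in>I. (\<Prod>i\<in>insert a I. g i (x i)) *
      (possign a I * (possign j (I-{j}) * of_real (sgn_diff (x a) (x j)) *
       of_real (altprod sgn_diff x (I-{j})))))"
    unfolding sorted_sum_def
    by (subst altprod_sgn_even[OF assms]) (simp add: sum_distrib_left of_real_possign)
  also have "\<dots> = (\<Sum>j\<in>I. \<Sum>x\<in>tuples (insert a I) D. (\<Prod>i\<in>insert a I. g i (x i)) *
      (possign a I * (possign j (I-{j}) * of_real (sgn_diff (x a) (x j)) *
       of_real (altprod sgn_diff x (I-{j})))))"
    by (rule sum.swap)
  also have "\<dots> = (\<Sum>j\<in>I. possign a I * (possign j (I-{j}) *
    (\<Sum>u\<in>D. \<Sum>v\<in>D. g a u * g j v * of_real (sgn_diff u v)) * sorted_sum D g (I-{j})))"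
  proof (rule sum.cong[OF refl])
    fix j assume j: "j \<in> I"
    define J where "J = I - {j}"
    have I: "I = insert j J" and J: "j \<notin> J" "finite J" "a \<notin> J" "a \<noteq> j"
      using j assms by (auto simp: J_def)
    have p: "(\<Prod>i\<in>insert a I. g i ((x(j := v, a := u)) i)) = g a u * g j v * (\<Prod>i\<in>J. g i (x i))" for x u v
    proof -
      have "(\<Prod>i\<in>J. g i ((x(j := v, a := u)) i)) = (\<Prod>i\<in>J. g i (x i))"
        using J by (intro prod.cong) auto
      then show ?thesis unfolding I using J by (simp add: ac_simps)
    qed
    have al: "altprod sgn_diff (x(j := v, a := u)) J = altprod sgn_diff x J" for x u v
      using J by (intro altprod_cong) auto
    have s: "(\<Sum>x\<in>tuples (insert a I) D. F x) =
      (\<Sum>u\<in>D. \<Sum>v\<in>D. \<Sum>x\<in>tuples J D. F (x(j := v, a := u)))" for F :: "_ \<Rightarrow> 'a"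
      unfolding sum_tuples_insert[OF assms(3)]
      by (subst sum_tuples_insert[OF J(1), folded I]) (rule refl)
    have "(\<Sum>x\<in>tuples (insert a I) D. (\<Prod>i\<in>insert a I. g i (x i)) *
        (possign a I * (possign j J * of_real (sgn_diff (x a) (x j)) * of_real (altprod sgn_diff x J)))) =
      (\<Sum>u\<in>D. \<Sum>v\<in>D. \<Sum>x\<in>tuples J D. g a u * g j v * (\<Prod>i\<in>J. g i (x i)) *
        (possign a I * (possign j J * of_real (sgn_diff u v) * of_real (altprod sgn_diff x J))))"
      unfolding s p al using J by simp
    also have "\<dots> = (\<Sum>u\<in>D. \<Sum>v\<in>D. possign a I * (possign j J * (g a u * g j v * of_real (sgn_diff u v)) *
        sorted_sum D g J))"
      unfolding sorted_sum_def sum_distrib_left by (intro sum.cong refl) (simp only: ac_simps)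
    also have "\<dots> = possign a I * (possign j J * (\<Sum>u\<in>D. \<Sum>v\<in>D. g a u * g j v * of_real (sgn_diff u v)) *
        sorted_sum D g J)"
      by (simp only: sum_distrib_left sum_distrib_right)
    finally show "(\<Sum>x\<in>tuples (insert a I) D. (\<Prod>i\<in>insert a I. g i (x i)) *
      (possign a I * (possign j (I-{j}) * of_real (sgn_diff (x a) (x j)) *
       of_real (altprod sgn_diff x (I-{j}))))) =
      possign a I * (possign j (I-{j}) *
       (\<Sum>u\<in>D. \<Sum>v\<in>D. g a u * g j v * of_real (sgn_diff u v)) * sorted_sum D g (I-{j}))"
      by (simp add: J_def)
  qed
  finally show ?thesis by (simp add: sum_distrib_left)
qed

text \<open>The expansion rules express the value on an index set through smaller sets, so two
  functions obeying them agree. This takes the place of a definition of Pfaffians.\<close>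

lemma sorted_sum_eqI:
  fixes F :: "nat set \<Rightarrow> 'a::real_field"
  assumes "finite N" and empty: "F {} = 1"
    and odd: "\<And>I. I \<subseteq> N \<Longrightarrow> odd (card I) \<Longrightarrow>
      F I = (\<Sum>j\<in>I. possign j (I-{j}) * (\<Sum>v\<in>D. g j v) * F (I-{j}))"
    and even: "\<And>I a. insert a I \<subseteq> N \<Longrightarrow> odd (card I) \<Longrightarrow> a \<notin> I \<Longrightarrow>
      F (insert a I) = possign a I * (\<Sum>j\<in>I. possign j (I-{j}) *
        (\<Sum>u\<in>D. \<Sum>v\<in>D. g a u * g j v * of_real (sgn_diff u v)) * F (I-{j}))"
  shows "sorted_sum D g N = F N"
proof -
  have "sorted_sum D g I = F I" if "I \<subseteq> N" for I
    using finite_subset[OF that assms(1)] that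
  proof (induction I rule: finite_psubset_induct)
    case (psubset I)
    have IH: "sorted_sum D g J = F J" if "J \<subset> I" for J using psubset that by blast
    show ?case
    proof (cases "odd (card I)")
      case True
      then show ?thesis
        using psubset by (simp add: sorted_sum_odd odd IH psubset_eq cong: sum.cong)
          (auto intro!: sum.cong IH)
    next
      case even_card: False
      show ?thesis
      proof (cases "I = {}")
        case True
        then show ?thesis by (simp add: empty sorted_sum_def)
      next
        case False
        then obtain a where a: "a \<in> I" by auto
        define J where "J = I - {a}"
        have I: "I = insert a J" "a \<notin> J" "finite J" using a psubset by (auto simp: J_def)
        with even_card have "odd (card J)" by simp
        moreover have "J - {j} \<subset> I" for j using I by auto
        ultimately show ?thesis
          unfolding I(1) using I psubset(3) by (subst sorted_sum_even, simp_all add: even IH)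
      qed
    qed
  qed
  then show ?thesis by simp
qed

context
  fixes D :: "real set" and g :: "nat \<Rightarrow> real \<Rightarrow> 'a::real_field" and N :: "nat set"
    and c x :: "nat \<Rightarrow> 'a"
  assumes fin: "finite N" and inj: "inj_on x N"
    and nz: "\<And>i j. i \<in> N \<Longrightarrow> j \<in> N \<Longrightarrow> x i + x j \<noteq> 0"
begin

text \<open>Row factors \<open>c i\<close> come out of a Pfaffian as a product, since every index
  occurs once in every term. What is left obeys Schur's expansion.\<close>

lemma sorted_sum_schur:
  assumes single: "\<And>j. j \<in> N \<Longrightarrow> (\<Sum>v\<in>D. g j v) = c j"
    and double: "\<And>i j. i \<in> N \<Longrightarrow> j \<in> N \<Longrightarrow> i \<noteq> j \<Longrightarrow>
      (\<Sum>u\<in>D. \<Sum>v\<in>D. g i u * g j v * of_real (sgn_diff u v)) = c i * c j * schur (x i) (x j)"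
  shows "sorted_sum D g N = (\<Prod>i\<in>N. c i) * altprod schur x N"
proof (rule sorted_sum_eqI[OF fin])
  fix I assume I: "I \<subseteq> N" "odd (card I)"
  then have fI: "finite I" "inj_on x I" "\<And>i j. i \<in> I \<Longrightarrow> j \<in> I \<Longrightarrow> x i + x j \<noteq> 0"
    using fin inj nz by (auto intro: finite_subset inj_on_subset)
  have "(\<Prod>i\<in>I. c i) * altprod schur x I =
    (\<Sum>j\<in>I. (\<Prod>i\<in>I. c i) * (possign j (I-{j}) * altprod schur x (I-{j})))"
    by (subst altprod_schur_odd[OF fI I(2)]) (auto simp: sum_distrib_left)
  also have "\<dots> = (\<Sum>j\<in>I. possign j (I-{j}) * (\<Sum>v\<in>D. g j v) * ((\<Prod>i\<in>I-{j}. c i) * altprod schur x (I-{j})))"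
  proof (rule sum.cong[OF refl])
    fix j assume j: "j \<in> I"
    then have "(\<Prod>i\<in>I. c i) = c j * (\<Prod>i\<in>I-{j}. c i)" using fI by (intro prod.remove)
    moreover have "(\<Sum>v\<in>D. g j v) = c j" using single j I by auto
    ultimately show "(\<Prod>i\<in>I. c i) * (possign j (I-{j}) * altprod schur x (I-{j})) =
      possign j (I-{j}) * (\<Sum>v\<in>D. g j v) * ((\<Prod>i\<in>I-{j}. c i) * altprod schur x (I-{j}))"
      by (simp only: ac_simps)
  qed
  finally show "(\<Prod>i\<in>I. c i) * altprod schur x I = (\<Sum>j\<in>I. possign j (I-{j}) * (\<Sum>v\<in>D. g j v) *
    ((\<Prod>i\<in>I-{j}. c i) * altprod schur x (I-{j})))" .
next
  fix I a assume I: "insert a I \<subseteq> N" "odd (card I)" "a \<notin> I"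
  then have fI: "finite I" "inj_on x (insert a I)"
     "\<And>i j. i \<in> insert a I \<Longrightarrow> j \<in> insert a I \<Longrightarrow> x i + x j \<noteq> 0"
    using fin inj nz by (meson finite_insert finite_subset inj_on_subset subsetD)+
  have "(\<Prod>i\<in>insert a I. c i) * altprod schur x (insert a I) =
    possign a I * (\<Sum>j\<in>I. (\<Prod>i\<in>insert a I. c i) * (possign j (I-{j}) * schur (x a) (x j) * altprod schur x (I-{j})))"
    by (subst altprod_schur_even[OF fI(1,2) I(3) fI(3) I(2)]) (simp_all only: sum_distrib_left ac_simps)
  also have "\<dots> = possign a I * (\<Sum>j\<in>I. possign j (I-{j}) *
      (\<Sum>u\<in>D. \<Sum>v\<in>D. g a u * g j v * of_real (sgn_diff u v)) * ((\<Prod>i\<in>I-{j}. c i) * altprod schur x (I-{j})))"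
  proof (rule arg_cong[where f = "(*) (possign a I)"], rule sum.cong[OF refl])
    fix j assume j: "j \<in> I"
    then have "(\<Prod>i\<in>insert a I. c i) = c a * (c j * (\<Prod>i\<in>I-{j}. c i))"
      using fI I by (simp add: prod.remove)
    moreover have "(\<Sum>u\<in>D. \<Sum>v\<in>D. g a u * g j v * of_real (sgn_diff u v)) = c a * c j * schur (x a) (x j)"
      using double j I by auto
    ultimately show "(\<Prod>i\<in>insert a I. c i) * (possign j (I-{j}) * schur (x a) (x j) * altprod schur x (I-{j})) =
      possign j (I-{j}) * (\<Sum>u\<in>D. \<Sum>v\<in>D. g a u * g j v * of_real (sgn_diff u v)) *
       ((\<Prod>i\<in>I-{j}. c i) * altprod schur x (I-{j}))"
      by (simp only: ac_simps)
  qed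
  finally show "(\<Prod>i\<in>insert a I. c i) * altprod schur x (insert a I) = possign a I * (\<Sum>j\<in>I. possign j (I-{j}) *
      (\<Sum>u\<in>D. \<Sum>v\<in>D. g a u * g j v * of_real (sgn_diff u v)) * ((\<Prod>i\<in>I-{j}. c i) * altprod schur x (I-{j})))" .
qed auto

text \<open>The constant called \<open>c\<close> in \<open>sympart\<close> is \<open>e\<close> here;
  the \<open>c i\<close> are row factors.\<close>

lemma sorted_sum_schur_sympart:
  assumes single: "\<And>j. j \<in> N \<Longrightarrow> (\<Sum>v\<in>D. g j v) = c j * x j"
    and double: "\<And>i j. i \<in> N \<Longrightarrow> j \<in> N \<Longrightarrow> i \<noteq> j \<Longrightarrow>
      (\<Sum>u\<in>D. \<Sum>v\<in>D. g i u * g j v * of_real (sgn_diff u v)) =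
      c i * c j * (schur (x i) (x j) * (e\<^sup>2 + x i * x j))"
    and e: "e \<noteq> 0" "\<And>i. i \<in> N \<Longrightarrow> x i \<noteq> e" "\<And>i. i \<in> N \<Longrightarrow> x i \<noteq> -e"
  shows "sorted_sum D g N = (\<Prod>i\<in>N. c i) * (altprod schur x N * sympart e (x ` N))"
proof (rule sorted_sum_eqI[OF fin])
  show "(\<Prod>i\<in>{}. c i) * (altprod schur x {} * sympart e (x ` {})) = 1" by (simp add: sympart_def)
next
  fix I assume I: "I \<subseteq> N" "odd (card I)"
  then have fI: "finite I" "inj_on x I" "\<And>i j. i \<in> I \<Longrightarrow> j \<in> I \<Longrightarrow> x i + x j \<noteq> 0"
    using fin inj nz by (auto intro: finite_subset inj_on_subset)
  have e': "e \<notin> x ` I" "-e \<notin> x ` I" using e(2,3) I(1) by (metis image_iff subsetD)+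
  let ?F = "\<lambda>I. altprod schur x I * sympart e (x ` I)"
  have "(\<Prod>i\<in>I. c i) * ?F I = (\<Sum>j\<in>I. (\<Prod>i\<in>I. c i) * (possign j (I-{j}) * x j * ?F (I-{j})))"
    by (subst altprod_schur_odd_sympart[OF fI I(2) e']) (auto simp: sum_distrib_left)
  also have "\<dots> = (\<Sum>j\<in>I. possign j (I-{j}) * (\<Sum>v\<in>D. g j v) * ((\<Prod>i\<in>I-{j}. c i) * ?F (I-{j})))"
  proof (rule sum.cong[OF refl])
    fix j assume j: "j \<in> I"
    then have "(\<Prod>i\<in>I. c i) = c j * (\<Prod>i\<in>I-{j}. c i)" using fI by (intro prod.remove)
    moreover have "(\<Sum>v\<in>D. g j v) = c j * x j" using single j I by auto
    ultimately show "(\<Prod>i\<in>I. c i) * (possign j (I-{j}) * x j * ?F (I-{j})) =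
      possign j (I-{j}) * (\<Sum>v\<in>D. g j v) * ((\<Prod>i\<in>I-{j}. c i) * ?F (I-{j}))"
      by (simp only: ac_simps)
  qed
  finally show "(\<Prod>i\<in>I. c i) * ?F I = (\<Sum>j\<in>I. possign j (I-{j}) * (\<Sum>v\<in>D. g j v) *
    ((\<Prod>i\<in>I-{j}. c i) * ?F (I-{j})))" .
next
  fix I a assume I: "insert a I \<subseteq> N" "odd (card I)" "a \<notin> I"
  then have fI: "finite I" "inj_on x (insert a I)"
     "\<And>i j. i \<in> insert a I \<Longrightarrow> j \<in> insert a I \<Longrightarrow> x i + x j \<noteq> 0"
    using fin inj nz by (meson finite_insert finite_subset inj_on_subset subsetD)+
  have e': "e \<notin> x ` insert a I" "-e \<notin> x ` insert a I" using e(2,3) I(1) by (metis image_iff subsetD)+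
  let ?F = "\<lambda>I. altprod schur x I * sympart e (x ` I)"
  have "(\<Prod>i\<in>insert a I. c i) * ?F (insert a I) = possign a I * (\<Sum>j\<in>I. (\<Prod>i\<in>insert a I. c i) *
      (possign j (I-{j}) * (schur (x a) (x j) * (e\<^sup>2 + x a * x j)) * ?F (I-{j})))"
    by (subst altprod_schur_even_sympart[OF fI(1,2) I(3) fI(3) I(2) e(1) e'])
       (simp_all only: sum_distrib_left ac_simps)
  also have "\<dots> = possign a I * (\<Sum>j\<in>I. possign j (I-{j}) *
      (\<Sum>u\<in>D. \<Sum>v\<in>D. g a u * g j v * of_real (sgn_diff u v)) * ((\<Prod>i\<in>I-{j}. c i) * ?F (I-{j})))"
  proof (rule arg_cong[where f = "(*) (possign a I)"], rule sum.cong[OF refl])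
    fix j assume j: "j \<in> I"
    then have "(\<Prod>i\<in>insert a I. c i) = c a * (c j * (\<Prod>i\<in>I-{j}. c i))"
      using fI I by (simp add: prod.remove)
    moreover have "(\<Sum>u\<in>D. \<Sum>v\<in>D. g a u * g j v * of_real (sgn_diff u v)) =
        c a * c j * (schur (x a) (x j) * (e\<^sup>2 + x a * x j))"
      using double j I by auto
    ultimately show "(\<Prod>i\<in>insert a I. c i) * (possign j (I-{j}) *
        (schur (x a) (x j) * (e\<^sup>2 + x a * x j)) * ?F (I-{j})) =
      possign j (I-{j}) * (\<Sum>u\<in>D. \<Sum>v\<in>D. g a u * g j v * of_real (sgn_diff u v)) *
       ((\<Prod>i\<in>I-{j}. c i) * ?F (I-{j}))"
      by (simp only: ac_simps)
  qed
  finally show "(\<Prod>i\<in>insert a I. c i) * ?F (insert a I) = possign a I * (\<Sum>j\<in>I. possign j (I-{j}) *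
      (\<Sum>u\<in>D. \<Sum>v\<in>D. g a u * g j v * of_real (sgn_diff u v)) * ((\<Prod>i\<in>I-{j}. c i) * ?F (I-{j})))" .
qed

end

subsection \<open>Alternants\<close>

definition ordered :: "nat \<Rightarrow> real set \<Rightarrow> (nat \<Rightarrow> real) set" where
  "ordered n D = {x \<in> tuples {1..n} D. \<forall>i j. 1 \<le> i \<and> i < j \<and> j \<le> n \<longrightarrow> x j < x i}"

text \<open>Position of \<open>x i\<close> when distinct coordinates are sorted in decreasing order;
  being the identity outside makes it a permutation, and composing \<open>x\<close> with its inverse
  sorts \<open>x\<close>.\<close>

definition rank_perm :: "nat \<Rightarrow> (nat \<Rightarrow> real) \<Rightarrow> nat \<Rightarrow> nat" where
  "rank_perm n x i = (if i \<in> {1..n} then card {j\<in>{1..n}. x i \<le> x j} else i)"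

lemma rank_perm_less:
  assumes "a \<in> {1..n}" "b \<in> {1..n}" "x b < x a"
  shows "rank_perm n x a < rank_perm n x b"
proof -
  have "{j\<in>{1..n}. x a \<le> x j} \<subset> {j\<in>{1..n}. x b \<le> x j}"
  proof (rule psubsetI)
    have "b \<in> {j\<in>{1..n}. x b \<le> x j}" "b \<notin> {j\<in>{1..n}. x a \<le> x j}" using assms by auto
    then show "{j\<in>{1..n}. x a \<le> x j} \<noteq> {j\<in>{1..n}. x b \<le> x j}" by blast
  qed (use assms in auto)
  then show ?thesis using assms by (simp add: rank_perm_def psubset_card_mono)
qed

lemma rank_perm_permutes:
  assumes "inj_on x {1..n}"
  shows "rank_perm n x permutes {1..n}"
proof (rule bij_imp_permutes)
  have "inj_on (rank_perm n x) {1..n}"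
  proof (rule inj_onI, rule ccontr)
    fix a b assume ab: "a \<in> {1..n}" "b \<in> {1..n}" "rank_perm n x a = rank_perm n x b" "a \<noteq> b"
    then have "x a < x b \<or> x b < x a" using assms by (metis inj_onD linorder_neqE)
    with ab rank_perm_less[of a n b x] rank_perm_less[of b n a x] show False by auto
  qed
  moreover have "rank_perm n x ` {1..n} \<subseteq> {1..n}"
  proof
    fix k assume "k \<in> rank_perm n x ` {1..n}"
    then obtain i where i: "i \<in> {1..n}" "k = card {j\<in>{1..n}. x i \<le> x j}"
      by (auto simp: rank_perm_def)
    have "card {j\<in>{1..n}. x i \<le> x j} \<le> card {1..n}" by (rule card_mono) auto
    moreover have "card {j\<in>{1..n}. x i \<le> x j} > 0" using i by (auto simp: card_gt_0_iff)
    ultimately show "k \<in> {1..n}" using i by simp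
  qed
  ultimately show "bij_betw (rank_perm n x) {1..n} {1..n}"
    by (simp add: bij_betw_def endo_inj_surj)
qed (auto simp: rank_perm_def)

lemma tuples_permutes:
  assumes "x \<in> tuples I D" "p permutes I"
  shows "x \<circ> p \<in> tuples I D"
  using assms by (auto simp: tuples_def permutes_in_image permutes_not_in)

lemma ordered_less_iff:
  assumes "y \<in> ordered n D" "i \<in> {1..n}" "j \<in> {1..n}"
  shows "y i \<le> y j \<longleftrightarrow> j \<le> i"
proof -
  have "y j < y i" if "i < j" using that assms by (auto simp: ordered_def)
  moreover have "y i < y j" if "j < i" using that assms by (auto simp: ordered_def)
  ultimately show ?thesis by (cases i j rule: linorder_cases) fastforce+
qed

lemma ordered_inj: "y \<in> ordered n D \<Longrightarrow> inj_on y {1..n}"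
  by (rule inj_onI) (metis order.antisym order_refl ordered_less_iff)

text \<open>The coordinates that are at least \<open>y (p i)\<close> are those with
  \<open>p j\<close> at most \<open>p i\<close>, and there are \<open>p i\<close> of them.\<close>

lemma rank_perm_ordered:
  assumes y: "y \<in> ordered n D" and p: "p permutes {1..n}"
  shows "rank_perm n (y \<circ> p) = p"
proof
  fix i
  show "rank_perm n (y \<circ> p) i = p i"
  proof (cases "i \<in> {1..n}")
    case True
    then have pi: "p i \<in> {1..n}" using p by (simp only: permutes_in_image)
    have "{j\<in>{1..n}. y (p i) \<le> y (p j)} = {j\<in>{1..n}. p j \<le> p i}"
      using ordered_less_iff[OF y pi] permutes_in_image[OF p] by blast
    also have "\<dots> = inv p ` {1..p i}"
    proof (intro equalityI subsetI)
      fix j assume "j \<in> {j\<in>{1..n}. p j \<le> p i}"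
      then have "p j \<in> {1..p i}" using permutes_in_image[OF p, of j] by auto
      then show "j \<in> inv p ` {1..p i}" using p by (metis image_eqI permutes_inverses(2))
    next
      fix j assume "j \<in> inv p ` {1..p i}"
      then obtain k where k: "k \<in> {1..p i}" "j = inv p k" by auto
      then have "p j = k" using p by (simp add: permutes_inverses)
      moreover have "k \<in> {1..n}" using k pi by auto
      ultimately show "j \<in> {j\<in>{1..n}. p j \<le> p i}" using k permutes_in_image[OF p, of j] by auto
    qed
    finally have "card {j\<in>{1..n}. y (p i) \<le> y (p j)} = card (inv p ` {1..p i})" by simp
    also have "\<dots> = p i"
      using permutes_inv[OF p, THEN permutes_inj, THEN inj_on_subset] by (subst card_image) auto
    finally show ?thesis using True by (simp add: rank_perm_def)
  next
    case False
    then have "p i = i" using p by (metis permutes_not_in)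
    with False show ?thesis by (auto simp: rank_perm_def)
  qed
qed

text \<open>A tuple with distinct coordinates is \<open>y \<circ> p\<close> for exactly one
  decreasing \<open>y\<close> and one permutation \<open>p\<close>, namely its
  \<open>rank_perm\<close>.\<close>

lemma sum_inj_tuples:
  "(\<Sum>x\<in>{x\<in>tuples {1..n} D. inj_on x {1..n}}. \<Phi> x) =
    (\<Sum>p\<in>{p. p permutes {1..n}}. \<Sum>y\<in>ordered n D. \<Phi> (y \<circ> p))"
proof -
  have "(\<Sum>x\<in>{x\<in>tuples {1..n} D. inj_on x {1..n}}. \<Phi> x) =
    (\<Sum>(p, y)\<in>{p. p permutes {1..n}} \<times> ordered n D. \<Phi> (y \<circ> p))"
  proof (rule sum.reindex_bij_witness[where
        i = "\<lambda>(p, y). y \<circ> p" and j = "\<lambda>x. (rank_perm n x, x \<circ> inv (rank_perm n x))"])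
    fix x assume x: "x \<in> {x\<in>tuples {1..n} D. inj_on x {1..n}}"
    define r where "r = rank_perm n x"
    have r: "r permutes {1..n}" using x rank_perm_permutes by (auto simp: r_def)
    have *: "x \<circ> inv r \<circ> r = x" using r by (simp add: o_assoc[symmetric] permutes_inv_o)
    then show "(case (rank_perm n x, x \<circ> inv (rank_perm n x)) of (p, y) \<Rightarrow> y \<circ> p) = x"
      by (simp add: r_def)
    show "(case (rank_perm n x, x \<circ> inv (rank_perm n x)) of (p, y) \<Rightarrow> \<Phi> (y \<circ> p)) = \<Phi> x"
      using * by (simp add: r_def)
    have "x (inv r j) < x (inv r i)" if "1 \<le> i" "i < j" "j \<le> n" for i j
    proof (rule ccontr)
      have ab: "inv r i \<in> {1..n}" "inv r j \<in> {1..n}"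
        using that permutes_in_image[OF permutes_inv[OF r]] by auto
      assume "\<not> x (inv r j) < x (inv r i)"
      moreover have "inv r j \<noteq> inv r i"
        using that r by (metis less_irrefl permutes_inverses(1))
      then have "x (inv r j) \<noteq> x (inv r i)" using x ab by (auto dest: inj_onD)
      ultimately have "r (inv r j) < r (inv r i)"
        using rank_perm_less[OF ab(2,1), of x] by (simp add: r_def)
      then show False using that r by (simp add: permutes_inverses)
    qed
    then have "x \<circ> inv r \<in> ordered n D"
      using x tuples_permutes[OF _ permutes_inv[OF r]] by (auto simp: ordered_def)
    with r show "(rank_perm n x, x \<circ> inv (rank_perm n x)) \<in> {p. p permutes {1..n}} \<times> ordered n D"
      by (simp add: r_def)
  next
    fix z assume z: "z \<in> {p. p permutes {1..n}} \<times> ordered n D"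
    obtain p y where py: "z = (p, y)" by force
    with z have p: "p permutes {1..n}" and y: "y \<in> ordered n D" by auto
    have "y \<circ> p \<circ> inv p = y" using p by (simp add: o_assoc[symmetric] permutes_inv_o)
    with rank_perm_ordered[OF y p] py
    show "(rank_perm n (case z of (p, y) \<Rightarrow> y \<circ> p),
        (case z of (p, y) \<Rightarrow> y \<circ> p) \<circ> inv (rank_perm n (case z of (p, y) \<Rightarrow> y \<circ> p))) = z"
      by simp
    have "inj_on (y \<circ> p) {1..n}"
      using p ordered_inj[OF y] by (intro comp_inj_on permutes_inj_on) (simp_all add: permutes_image)
    moreover have "y \<circ> p \<in> tuples {1..n} D"
      using y p by (intro tuples_permutes) (auto simp: ordered_def)
    ultimately show "(case z of (p, y) \<Rightarrow> y \<circ> p) \<in> {x\<in>tuples {1..n} D. inj_on x {1..n}}"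
      using py by simp
  qed
  then show ?thesis by (simp add: sum.cartesian_product)
qed

lemma sum_tuples_eq_sum_ordered:
  assumes "finite D" and "\<And>x. x \<in> tuples {1..n} D \<Longrightarrow> \<not> inj_on x {1..n} \<Longrightarrow> \<Phi> x = 0"
  shows "(\<Sum>x\<in>tuples {1..n} D. \<Phi> x) = (\<Sum>y\<in>ordered n D. \<Sum>p\<in>{p. p permutes {1..n}}. \<Phi> (y \<circ> p))"
proof -
  have "(\<Sum>x\<in>tuples {1..n} D. \<Phi> x) = (\<Sum>x\<in>{x\<in>tuples {1..n} D. inj_on x {1..n}}. \<Phi> x)"
    using assms by (intro sum.mono_neutral_right) (auto intro: finite_tuples)
  then show ?thesis by (simp only: sum_inj_tuples sum.swap[of _ "ordered n D"])
qed

text \<open>Leibniz expansion of the determinant of the matrix with entries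
  \<open>s j (x i)\<close>.\<close>

definition alternant :: "nat \<Rightarrow> (nat \<Rightarrow> real \<Rightarrow> real) \<Rightarrow> (nat \<Rightarrow> real) \<Rightarrow> real" where
  "alternant n s x = (\<Sum>p\<in>{p. p permutes {1..n}}. of_int (sign p) * (\<Prod>i=1..n. s (p i) (x i)))"

lemma permutation_of_permutes: "p permutes {1..n::nat} \<Longrightarrow> permutation p"
  using permutation_permutes by blast

lemma alternant_permutes:
  assumes q: "q permutes {1..n}"
  shows "alternant n s (x \<circ> q) = of_int (sign q) * alternant n s x"
proof -
  have "alternant n s (x \<circ> q) = (\<Sum>p\<in>{p. p permutes {1..n}}.
      of_int (sign (p \<circ> q)) * (\<Prod>i=1..n. s ((p \<circ> q) i) ((x \<circ> q) i)))"
    unfolding alternant_def by (rule sum_permutations_compose_right[OF q])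
  also have "\<dots> = (\<Sum>p\<in>{p. p permutes {1..n}}.
      of_int (sign q) * (of_int (sign p) * (\<Prod>i=1..n. s (p i) (x i))))"
  proof (rule sum.cong[OF refl], goal_cases)
    case (1 p)
    have "(\<Prod>i=1..n. s (p i) (x i)) = (\<Prod>i=1..n. s ((p \<circ> q) i) ((x \<circ> q) i))"
      using prod.permute[OF q, of "\<lambda>i. s (p i) (x i)"] by (simp add: o_def)
    then show ?case
      using 1 q by (simp add: sign_compose permutation_of_permutes)
  qed
  finally show ?thesis by (simp add: alternant_def sum_distrib_left)
qed

lemma alternant_eq_0:
  assumes "a \<in> {1..n}" "b \<in> {1..n}" "a \<noteq> b" "x a = x b"
  shows "alternant n s x = 0"
proof -
  have "x \<circ> transpose a b = x" using assms by (auto simp: transpose_def)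
  moreover have "transpose a b permutes {1..n}" using assms by (intro permutes_swap_id) auto
  ultimately have "alternant n s x = - alternant n s x"
    using alternant_permutes[of "transpose a b" n s x] assms by (simp add: sign_swap_id)
  then show ?thesis by simp
qed

lemma alternant_cong:
  assumes "\<And>i j. i \<in> {1..n} \<Longrightarrow> j \<in> {1..n} \<Longrightarrow> s j (x i) = t j (y i)"
  shows "alternant n s x = alternant n t y"
  unfolding alternant_def
proof (intro sum.cong arg_cong2[where f = "(*)"] prod.cong refl)
  fix p i assume "p \<in> {p. p permutes {1..n}}" and i: "i \<in> {1..n}"
  then have "p i \<in> {1..n}" by (metis mem_Collect_eq permutes_in_image)
  with i show "s (p i) (x i) = t (p i) (y i)" by (rule assms)
qed

text \<open>Discrete Cauchy-Binet formula. The summand is symmetric, so summing over all tuples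
  multiplies by \<open>fact n\<close>. There the square expands over pairs of permutations, the sum
  factors by coordinates, and orthogonality leaves only equal pairs.\<close>

lemma sum_ordered_alternant_square:
  assumes D: "finite D"
    and orth: "\<And>i j. i \<in> {1..n} \<Longrightarrow> j \<in> {1..n} \<Longrightarrow>
      (\<Sum>v\<in>D. w v * (s i v * s j v)) = (if i = j then h else 0)"
  shows "(\<Sum>y\<in>ordered n D. (\<Prod>i=1..n. w (y i)) * (alternant n s y)\<^sup>2) = h ^ n"
proof -
  let ?P = "{p. p permutes {1..n}}"
  let ?\<Phi> = "\<lambda>x. (\<Prod>i=1..n. w (x i)) * (alternant n s x)\<^sup>2"
  have "(\<Sum>x\<in>tuples {1..n} D. ?\<Phi> x) = (\<Sum>y\<in>ordered n D. \<Sum>p\<in>?P. ?\<Phi> (y \<circ> p))"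
    using D by (intro sum_tuples_eq_sum_ordered) (auto simp: inj_on_def intro: alternant_eq_0)
  also have "\<dots> = (\<Sum>y\<in>ordered n D. \<Sum>p\<in>?P. ?\<Phi> y)"
  proof (intro sum.cong refl)
    fix y p assume "p \<in> ?P"
    then have p: "p permutes {1..n}" by simp
    have "(\<Prod>i=1..n. w (y i)) = (\<Prod>i=1..n. w ((y \<circ> p) i))"
      using prod.permute[OF p, of "\<lambda>i. w (y i)"] by (simp add: o_def)
    moreover have "(real_of_int (sign p))\<^sup>2 = 1" by (simp add: sign_def)
    ultimately show "?\<Phi> (y \<circ> p) = ?\<Phi> y" by (simp add: alternant_permutes[OF p] power_mult_distrib)
  qed
  also have "\<dots> = fact n * (\<Sum>y\<in>ordered n D. ?\<Phi> y)"
    by (simp add: sum_distrib_left card_permutations)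
  finally have 1: "(\<Sum>x\<in>tuples {1..n} D. ?\<Phi> x) = fact n * (\<Sum>y\<in>ordered n D. ?\<Phi> y)" .
  have sq: "W * (sum f A)\<^sup>2 = (\<Sum>p\<in>A. \<Sum>q\<in>A. W * (f p * f q))"
    for W :: real and f :: "(nat \<Rightarrow> nat) \<Rightarrow> real" and A
    by (simp only: power2_eq_square sum_product) (simp only: sum_distrib_left)
  have "(\<Sum>x\<in>tuples {1..n} D. ?\<Phi> x) = (\<Sum>x\<in>tuples {1..n} D. \<Sum>p\<in>?P. \<Sum>q\<in>?P.
      of_int (sign p) * of_int (sign q) * (\<Prod>i=1..n. w (x i) * (s (p i) (x i) * s (q i) (x i))))"
    unfolding alternant_def sq by (intro sum.cong refl) (simp only: prod.distrib ac_simps)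
  also have "\<dots> = (\<Sum>p\<in>?P. \<Sum>q\<in>?P. \<Sum>x\<in>tuples {1..n} D.
      of_int (sign p) * of_int (sign q) * (\<Prod>i=1..n. w (x i) * (s (p i) (x i) * s (q i) (x i))))"
    by (subst sum.swap, intro sum.cong refl, rule sum.swap)
  also have "\<dots> = (\<Sum>p\<in>?P. \<Sum>q\<in>?P.
      of_int (sign p) * of_int (sign q) * (\<Prod>i=1..n. if p i = q i then h else 0))"
  proof (intro sum.cong refl)
    fix p q assume "p \<in> ?P" "q \<in> ?P"
    then have pq: "p i \<in> {1..n}" "q i \<in> {1..n}" if "i \<in> {1..n}" for i
      using that by (simp_all only: mem_Collect_eq permutes_in_image)
    have "(\<Sum>x\<in>tuples {1..n} D. \<Prod>i=1..n. w (x i) * (s (p i) (x i) * s (q i) (x i))) =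
      (\<Prod>i=1..n. \<Sum>v\<in>D. w v * (s (p i) v * s (q i) v))"
      by (rule sum_prod_tuples) simp
    also have "\<dots> = (\<Prod>i=1..n. if p i = q i then h else 0)"
      by (intro prod.cong refl orth pq) auto
    finally show "(\<Sum>x\<in>tuples {1..n} D. of_int (sign p) * of_int (sign q) *
        (\<Prod>i=1..n. w (x i) * (s (p i) (x i) * s (q i) (x i)))) =
      of_int (sign p) * of_int (sign q) * (\<Prod>i=1..n. if p i = q i then h else 0)"
      by (simp add: sum_distrib_left[symmetric])
  qed
  also have "\<dots> = (\<Sum>p\<in>?P. \<Sum>q\<in>?P. if q = p then h ^ n else 0)"
  proof (intro sum.cong refl)
    fix p q assume pq: "p \<in> ?P" "q \<in> ?P"
    show "of_int (sign p) * of_int (sign q) * (\<Prod>i=1..n. if p i = q i then h else 0) =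
      (if q = p then h ^ n else 0)"
    proof (cases "q = p")
      case True
      then show ?thesis by (simp add: sign_def)
    next
      case False
      then obtain i where i: "p i \<noteq> q i" by (metis ext)
      then have "i \<in> {1..n}" using pq by (metis mem_Collect_eq permutes_not_in)
      with i have "(\<Prod>i=1..n. if p i = q i then h else 0) = 0" by (intro prod_zero) auto
      with False show ?thesis by simp
    qed
  qed
  also have "\<dots> = fact n * h ^ n"
    by (simp add: finite_permutations card_permutations)
  finally show ?thesis using 1 by simp
qed

text \<open>De Bruijn's formula for sums of determinants over ordered tuples. The sign product of a
  decreasing tuple is 1, so the summand of \<open>sorted_sum\<close> at \<open>y \<circ> p\<close>
  has sign \<open>sign p\<close>; summing over \<open>p\<close> is the Leibniz expansion with
  \<open>inv p\<close> in place of \<open>p\<close>.\<close>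

lemma sum_ordered_alternant:
  assumes D: "finite D"
  shows "(\<Sum>y\<in>ordered n D. (\<Prod>i=1..n. w (y i)) * alternant n s y) = sorted_sum D (\<lambda>i v. w v * s i v) {1..n}"
proof -
  let ?P = "{p. p permutes {1..n}}"
  let ?\<Phi> = "\<lambda>x::nat \<Rightarrow> real. (\<Prod>i=1..n. w (x i) * s i (x i)) * altprod sgn_diff x {1..n}"
  have anti: "sgn_diff u v = - sgn_diff v u" for u v by (simp add: sgn_if)
  have perm: "altprod sgn_diff (x \<circ> p) {1..n} = of_int (sign p) * altprod sgn_diff x {1..n}"
    if "p permutes {1..n}" for x p
    by (rule altprod_permutes[OF anti _ that]) simp
  have "sorted_sum D (\<lambda>i v. w v * s i v) {1..n} = (\<Sum>x\<in>tuples {1..n} D. ?\<Phi> x)"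
    by (simp add: sorted_sum_def)
  also have "\<dots> = (\<Sum>y\<in>ordered n D. \<Sum>p\<in>?P. ?\<Phi> (y \<circ> p))"
  proof (rule sum_tuples_eq_sum_ordered[OF D])
    fix x :: "nat \<Rightarrow> real" assume "\<not> inj_on x {1..n}"
    then obtain a b where ab: "a \<in> {1..n}" "b \<in> {1..n}" "a \<noteq> b" "x a = x b" by (auto simp: inj_on_def)
    then have "x \<circ> transpose a b = x" "transpose a b permutes {1..n}"
      by (auto simp: transpose_def intro!: permutes_swap_id)
    then have "altprod sgn_diff x {1..n} = 0"
      using perm[of "transpose a b" x] ab(3) by (simp add: sign_swap_id)
    then show "?\<Phi> x = 0" by simp
  qed
  also have "\<dots> = (\<Sum>y\<in>ordered n D. (\<Prod>i=1..n. w (y i)) * alternant n s y)"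
  proof (rule sum.cong[OF refl])
    fix y assume y: "y \<in> ordered n D"
    have one: "altprod sgn_diff y {1..n} = 1"
      unfolding altprod_def using y by (intro prod.neutral ballI) (auto simp: ordered_def)
    have "(\<Sum>p\<in>?P. ?\<Phi> (y \<circ> p)) = (\<Sum>p\<in>?P. (\<Prod>i=1..n. w (y i)) *
        (of_int (sign (inv p)) * (\<Prod>i=1..n. s (inv p i) (y i))))"
    proof (rule sum.cong[OF refl])
      fix p assume "p \<in> ?P"
      then have p: "p permutes {1..n}" by simp
      have "(\<Prod>i=1..n. w ((y \<circ> p) i) * s i ((y \<circ> p) i)) =
        (\<Prod>i=1..n. ((\<lambda>k. w (y k) * s (inv p k) (y k)) \<circ> p) i)"
        using p by (intro prod.cong) (auto simp: permutes_inverses)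
      also have "\<dots> = (\<Prod>i=1..n. w (y i) * s (inv p i) (y i))"
        using prod.permute[OF p, of "\<lambda>k. w (y k) * s (inv p k) (y k)"] by simp
      finally show "?\<Phi> (y \<circ> p) = (\<Prod>i=1..n. w (y i)) *
        (of_int (sign (inv p)) * (\<Prod>i=1..n. s (inv p i) (y i)))"
        unfolding perm[OF p] one sign_inverse[OF permutation_of_permutes[OF p]]
        by (simp only: prod.distrib ac_simps mult_1)
    qed
    also have "\<dots> = (\<Prod>i=1..n. w (y i)) * alternant n s y"
      unfolding alternant_def sum_distrib_left by (rule sum_permutations_inverse[symmetric])
    finally show "(\<Sum>p\<in>?P. ?\<Phi> (y \<circ> p)) = (\<Prod>i=1..n. w (y i)) * alternant n s y" .
  qed
  finally show ?thesis by simp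
qed

section \<open>Laplace expansion and Vandermonde determinants\<close>

lemma alternant_transposed:
  "alternant n s x = (\<Sum>p\<in>{p. p permutes {1..n}}. of_int (sign p) * (\<Prod>i=1..n. s i (x (p i))))"
proof -
  have "(\<Sum>p\<in>{p. p permutes {1..n}}. of_int (sign p) * (\<Prod>i=1..n. s i (x (p i)))) =
    (\<Sum>p\<in>{p. p permutes {1..n}}. of_int (sign (inv p)) * (\<Prod>i=1..n. s i (x (inv p i))))"
    by (rule sum_permutations_inverse)
  also have "\<dots> = alternant n s x"
    unfolding alternant_def
  proof (rule sum.cong[OF refl])
    fix p assume "p \<in> {p. p permutes {1..n}}"
    then have p: "p permutes {1..n}" by simp
    have "(\<Prod>i=1..n. s i (x (inv p i))) = (\<Prod>i=1..n. ((\<lambda>i. s i (x (inv p i))) \<circ> p) i)"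
      by (rule prod.permute[OF p])
    also have "\<dots> = (\<Prod>i=1..n. s (p i) (x i))"
      using p by (simp add: permutes_inverses)
    finally show "of_int (sign (inv p)) * (\<Prod>i=1..n. s i (x (inv p i))) =
      of_int (sign p) * (\<Prod>i=1..n. s (p i) (x i))"
      unfolding sign_inverse[OF permutation_of_permutes[OF p]] by (simp only:)
  qed
  finally show ?thesis by simp
qed

text \<open>Laplace expansion along the last function. The minor without \<open>x b\<close> is
  obtained by transposing \<open>b\<close> with the last position, which accounts for the
  sign.\<close>

lemma alternant_Suc:
  "alternant (Suc n) s x = (\<Sum>b\<in>{1..Suc n}. of_int (sign (transpose (Suc n) b)) *
     s (Suc n) (x b) * alternant n s (x \<circ> transpose (Suc n) b))"
proof -
  have I: "{1..Suc n} = insert (Suc n) {1..n}" by auto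
  have "alternant (Suc n) s x = (\<Sum>b\<in>{1..Suc n}. \<Sum>q\<in>{p. p permutes {1..n}}.
     of_int (sign (transpose (Suc n) b \<circ> q)) * (\<Prod>i=1..Suc n. s i (x ((transpose (Suc n) b \<circ> q) i))))"
    unfolding alternant_transposed I by (rule sum_over_permutations_insert) auto
  also have "\<dots> = (\<Sum>b\<in>{1..Suc n}. \<Sum>q\<in>{p. p permutes {1..n}}.
     of_int (sign (transpose (Suc n) b)) * s (Suc n) (x b) *
     (of_int (sign q) * (\<Prod>i=1..n. s i ((x \<circ> transpose (Suc n) b) (q i)))))"
  proof (intro sum.cong refl)
    fix b q assume "q \<in> {p. p permutes {1..n}}"
    then have q: "q permutes {1..n}" by simp
    then have "q (Suc n) = Suc n" by (simp add: permutes_not_in)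
    moreover have "permutation (transpose (Suc n) b)" by (rule permutation_swap_id)
    ultimately show "of_int (sign (transpose (Suc n) b \<circ> q)) *
        (\<Prod>i=1..Suc n. s i (x ((transpose (Suc n) b \<circ> q) i))) =
      of_int (sign (transpose (Suc n) b)) * s (Suc n) (x b) *
      (of_int (sign q) * (\<Prod>i=1..n. s i ((x \<circ> transpose (Suc n) b) (q i))))"
      using q by (simp add: sign_compose permutation_of_permutes)
  qed
  finally show ?thesis by (simp only: sum_distrib_left alternant_transposed)
qed

text \<open>Vandermonde's determinant for monic polynomials. In the Laplace expansion every minor is
  the full product divided by the differences at \<open>y b\<close>, so the sum over
  \<open>b\<close> is a Lagrange sum, equal to the leading coefficient 1 of the last
  polynomial.\<close>

lemma alternant_poly:
  assumes "inj_on y {1..n}"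
    and "\<And>i. i \<in> {1..n} \<Longrightarrow> degree (q i) < i \<and> coeff (q i) (i - 1) = 1"
  shows "alternant n (\<lambda>i. poly (q i)) y = altprod (\<lambda>u v. v - u) y {1..n}"
  using assms
proof (induction n arbitrary: y)
  case 0
  show ?case by (simp add: alternant_def)
next
  case (Suc n)
  let ?r = "\<lambda>u v::real. v - u"
  let ?t = "\<lambda>b. transpose (Suc n) b"
  have I: "{1..Suc n} = insert (Suc n) {1..n}" by auto
  have anti: "?r u v = - ?r v u" for u v by simp
  have summand: "of_int (sign (?t b)) * poly (q (Suc n)) (y b) * alternant n (\<lambda>i. poly (q i)) (y \<circ> ?t b) =
     altprod ?r y {1..Suc n} * (poly (q (Suc n)) (y b) / (\<Prod>u\<in>y ` {1..Suc n} - {y b}. y b - u))"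
    if b: "b \<in> {1..Suc n}" for b
  proof -
    have p: "?t b permutes {1..Suc n}" using b by (intro permutes_swap_id) auto
    have inj: "inj_on (y \<circ> ?t b) {1..Suc n}"
      using Suc.prems(1) p by (intro comp_inj_on permutes_inj_on) (simp_all only: permutes_image)
    have 1: "alternant n (\<lambda>i. poly (q i)) (y \<circ> ?t b) = altprod ?r (y \<circ> ?t b) {1..n}"
      using Suc.prems by (intro Suc.IH inj_on_subset[OF inj]) auto
    have bij: "bij_betw (?t b) {1..n} ({1..Suc n} - {b})"
    proof -
      have "{1..n} = {1..Suc n} - {Suc n}" by auto
      then have "?t b ` {1..n} = ?t b ` ({1..Suc n} - {Suc n})" by (rule arg_cong)
      also have "\<dots> = ?t b ` {1..Suc n} - ?t b ` {Suc n}"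
        by (rule image_set_diff[OF permutes_inj[OF p]])
      also have "\<dots> = {1..Suc n} - {b}" using p by (simp only: permutes_image) simp
      finally show ?thesis by (simp add: bij_betw_def)
    qed
    have "of_int (sign (?t b)) * altprod ?r y {1..Suc n} = altprod ?r (y \<circ> ?t b) {1..Suc n}"
      by (rule altprod_permutes[OF anti _ p, symmetric]) simp
    also have "\<dots> = possign (Suc n) {1..n} * (\<Prod>k\<in>{1..n}. (y \<circ> ?t b) k - (y \<circ> ?t b) (Suc n)) *
        altprod ?r (y \<circ> ?t b) {1..n}"
      unfolding I by (rule altprod_insert[OF anti]) auto
    also have "possign (Suc n) {1..n} * (\<Prod>k\<in>{1..n}. (y \<circ> ?t b) k - (y \<circ> ?t b) (Suc n)) =
       (\<Prod>k\<in>{1..n}. y b - y (?t b k))"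
      unfolding possign_def prod.distrib[symmetric] by (intro prod.cong) auto
    also have "\<dots> = (\<Prod>k\<in>{1..Suc n} - {b}. y b - y k)"
      by (rule prod.reindex_bij_betw[OF bij])
    also have "\<dots> = (\<Prod>u\<in>y ` {1..Suc n} - {y b}. y b - u)"
      using b Suc.prems(1) by (simp only: prod_image_remove)
    finally have e: "of_int (sign (?t b)) * altprod ?r y {1..Suc n} =
      (\<Prod>u\<in>y ` {1..Suc n} - {y b}. y b - u) * altprod ?r (y \<circ> ?t b) {1..n}" .
    have nz: "(\<Prod>u\<in>y ` {1..Suc n} - {y b}. y b - u) \<noteq> 0" by simp
    have sg: "of_int (sign (?t b)) * (of_int (sign (?t b)) :: real) = 1" by (simp add: sign_def)
    have cancel: "s * p * z = A * (p / P)" if "s * A = P * z" "P \<noteq> 0" "s * s = 1" for s A P p z :: real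
    proof -
      have "s * (P * z) = A" using that by (metis mult.assoc mult_1)
      then have "A * (p / P) = s * p * z" using that(2) by (auto simp: field_simps)
      then show ?thesis ..
    qed
    show ?thesis unfolding 1 by (rule cancel[OF e nz sg])
  qed
  have card: "card (y ` {1..Suc n}) = Suc n"
    using Suc.prems(1) by (simp only: card_image card_atLeastAtMost)
  have "alternant (Suc n) (\<lambda>i. poly (q i)) y = altprod ?r y {1..Suc n} *
      (\<Sum>b\<in>{1..Suc n}. poly (q (Suc n)) (y b) / (\<Prod>u\<in>y ` {1..Suc n} - {y b}. y b - u))"
    unfolding alternant_Suc sum_distrib_left by (rule sum.cong[OF refl], rule summand)
  also have "(\<Sum>b\<in>{1..Suc n}. poly (q (Suc n)) (y b) / (\<Prod>u\<in>y ` {1..Suc n} - {y b}. y b - u)) =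
     (\<Sum>v\<in>y ` {1..Suc n}. poly (q (Suc n)) v / (\<Prod>u\<in>y ` {1..Suc n} - {v}. v - u))"
    unfolding sum.reindex[OF Suc.prems(1)] by (simp only: o_def)
  also have "\<dots> = coeff (q (Suc n)) (card (y ` {1..Suc n}) - 1)"
    using Suc.prems(2)[of "Suc n"] card by (intro sum_lagrange) auto
  also have "\<dots> = 1"
    using Suc.prems(2)[of "Suc n"] by (simp only: card) simp
  finally show ?case by simp
qed

text \<open>Chebyshev polynomials of the fourth kind, in twice the cosine as variable, which makes
  them monic.\<close>

fun sinpoly :: "nat \<Rightarrow> real poly" where
  "sinpoly 0 = 1"
| "sinpoly (Suc 0) = [:1, 1:]"
| "sinpoly (Suc (Suc k)) = [:0, 1:] * sinpoly (Suc k) - sinpoly k"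

lemma sinpoly_degree: "degree (sinpoly k) \<le> k \<and> coeff (sinpoly k) k = 1"
proof (induction k rule: sinpoly.induct)
  case (3 k)
  have "degree (pCons 0 (sinpoly (Suc k)) - sinpoly k) \<le> Suc (Suc k)"
    using 3 by (intro degree_diff_le) (auto intro: order_trans[OF degree_pCons_le])
  moreover have "coeff (sinpoly k) (Suc (Suc k)) = 0" using 3 by (intro coeff_eq_0) auto
  ultimately show ?case using 3 by simp
qed auto

text \<open>The recurrence is the identity
  \<open>sin (y + 2 * t) + sin (y - 2 * t) = 2 * cos (2 * t) * sin y\<close>.\<close>

lemma sin_odd_multiple: "sin ((2 * real k + 1) * t) = sin t * poly (sinpoly k) (2 * cos (2 * t))"
proof (induction k rule: sinpoly.induct)
  case 2
  have "sin (3 * t) = sin (2 * t + t)" by (simp add: algebra_simps)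
  also have "\<dots> = sin t + 2 * cos (2 * t) * sin t"
  proof -
    have d: "2 * t - t = t" by simp
    show ?thesis using sin_add[of "2 * t" t] sin_diff[of "2 * t" t, unfolded d] by linarith
  qed
  finally show ?case by (simp add: algebra_simps)
next
  case (3 k)
  let ?z = "(2 * real k + 3) * t"
  have "sin (?z + 2 * t) + sin (?z - 2 * t) = 2 * cos (2 * t) * sin ?z"
    by (simp add: sin_add sin_diff)
  moreover have "?z + 2 * t = (2 * real (Suc (Suc k)) + 1) * t" "?z - 2 * t = (2 * real k + 1) * t"
    "?z = (2 * real (Suc k) + 1) * t"
    by (simp_all add: algebra_simps)
  ultimately have "sin ((2 * real (Suc (Suc k)) + 1) * t) =
      2 * cos (2 * t) * sin ((2 * real (Suc k) + 1) * t) - sin ((2 * real k + 1) * t)"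
    by simp
  then show ?case by (simp only: 3) (simp add: algebra_simps)
qed auto

lemma cos_double_diff: "2 * cos (2 * t) - 2 * cos (2 * h) = 4 * (sin (h - t) * sin (h + t))" for h t :: real
proof -
  have "(h + t) - (h - t) = 2 * t" "(h + t) + (h - t) = 2 * h" by simp_all
  then show ?thesis using cos_diff[of "h + t" "h - t"] cos_add[of "h + t" "h - t"] by simp
qed

text \<open>Weyl's denominator formula of type \<open>B\<close>.\<close>

lemma alternant_sin:
  assumes "inj_on (\<lambda>j. 2 * cos (2 * t j)) {1..n}"
  shows "alternant n (\<lambda>i z. sin ((2 * real i - 1) * z)) t =
    (\<Prod>j=1..n. sin (t j)) * (\<Prod>j\<in>{1..n}. \<Prod>i\<in>{i\<in>{1..n}. i < j}. 4 * (sin (t i - t j) * sin (t i + t j)))"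
proof -
  \<comment> \<open>Each argument contributes a factor \<open>sin (t i)\<close>; what remains is a
    Vandermonde determinant in the variables \<open>2 * cos (2 * t i)\<close>.\<close>
  have "alternant n (\<lambda>i z. sin ((2 * real i - 1) * z)) t =
    (\<Sum>p\<in>{p. p permutes {1..n}}. of_int (sign p) *
      (\<Prod>i=1..n. sin (t i) * poly (sinpoly (p i - 1)) (2 * cos (2 * t i))))"
    unfolding alternant_def
  proof (intro sum.cong refl arg_cong2[where f = "(*)"] prod.cong)
    fix p i assume "p \<in> {p. p permutes {1..n}}" "i \<in> {1..n}"
    then have "p i \<in> {1..n}" by (metis mem_Collect_eq permutes_in_image)
    then have "2 * real (p i) - 1 = 2 * real (p i - 1) + 1" by auto
    then show "sin ((2 * real (p i) - 1) * t i) = sin (t i) * poly (sinpoly (p i - 1)) (2 * cos (2 * t i))"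
      by (simp only: sin_odd_multiple)
  qed
  also have "\<dots> = (\<Prod>j=1..n. sin (t j)) *
      alternant n (\<lambda>i. poly (sinpoly (i - 1))) (\<lambda>j. 2 * cos (2 * t j))"
    unfolding alternant_def sum_distrib_left prod.distrib by (intro sum.cong refl) (simp only: ac_simps)
  also have "alternant n (\<lambda>i. poly (sinpoly (i - 1))) (\<lambda>j. 2 * cos (2 * t j)) =
      altprod (\<lambda>u v. v - u) (\<lambda>j. 2 * cos (2 * t j)) {1..n}"
  proof (intro alternant_poly assms)
    fix i :: nat assume "i \<in> {1..n}"
    then show "degree (sinpoly (i - 1)) < i \<and> coeff (sinpoly (i - 1)) (i - 1) = 1"
      using sinpoly_degree[of "i - 1"] by auto
  qed
  finally show ?thesis
    by (simp add: altprod_def cos_double_diff)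
qed

subsection \<open>Trigonometric sums on a half-weighted grid\<close>

definition grid :: "real \<Rightarrow> nat \<Rightarrow> real set" where
  "grid d N = (\<lambda>k. d + real k) ` {..<N}"

text \<open>A point on the wall of the reflection \<open>x\<^sub>1 \<mapsto> 2m - x\<^sub>1\<close> counts half.\<close>
definition wall_weight :: "real \<Rightarrow> real \<Rightarrow> real" where
  "wall_weight m v = (if v = m then 1/2 else 1)"

lemma sum_grid: "(\<Sum>v\<in>grid d N. f v) = (\<Sum>k<N. f (d + real k))"
  unfolding grid_def by (subst sum.reindex) (auto simp: inj_on_def)

lemma finite_grid [simp]: "finite (grid d N)"
  by (simp add: grid_def)

text \<open>Multiplied by \<open>2 * sin (t/2)\<close> the terms telescope.\<close>

lemma sum_sin_grid:
  "2 * sin (t/2) * (\<Sum>k<N. sin (t * (d + real k))) = cos (t * (d - 1/2)) - cos (t * (d + real N - 1/2))"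
proof (induction N)
  case (Suc N)
  have "2 * sin (t/2) * sin (t * (d + real N)) =
    cos (t * (d + real N) - t/2) - cos (t * (d + real N) + t/2)"
    by (simp add: cos_add cos_diff)
  also have "t * (d + real N) - t/2 = t * (d + real N - 1/2)" by (simp add: algebra_simps)
  also have "t * (d + real N) + t/2 = t * (d + real (Suc N) - 1/2)" by (simp add: algebra_simps)
  finally show ?case using Suc by (simp add: distrib_left)
qed simp

text \<open>The last grid point is \<open>m\<close> or \<open>m - 1/2\<close>, so \<open>e\<close> below is \<open>1/2\<close> or \<open>0\<close>.\<close>

locale wall_grid =
  fixes m d e :: real and N :: nat
  assumes N: "N > 0" and top: "d + real N - 1 = m - 1/2 + e" and e: "e = 0 \<or> e = 1/2"
begin

abbreviation "D \<equiv> grid d N"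
abbreviation "w \<equiv> wall_weight m"

lemma weight_eq_1: "k < N - 1 \<Longrightarrow> w (d + real k) = 1"
  using top e by (auto simp: wall_weight_def)

lemma weight_top: "w (d + real (N - 1)) = 1 - e"
  using top e N by (auto simp: wall_weight_def of_nat_diff)

lemma sum_weight:
  "(\<Sum>v\<in>D. w v * f v) = (\<Sum>k<N. f (d + real k)) - e * f (m - 1/2 + e)"
proof -
  have N': "N = Suc (N - 1)" using N by simp
  have "(\<Sum>v\<in>D. w v * f v) = (\<Sum>k<Suc (N - 1). w (d + real k) * f (d + real k))"
    using N' by (simp add: sum_grid)
  also have "\<dots> = (\<Sum>k<N - 1. f (d + real k)) + (1 - e) * f (d + real (N - 1))"
    unfolding sum.lessThan_Suc weight_top by (simp add: weight_eq_1)
  also have "\<dots> = (\<Sum>k<Suc (N - 1). f (d + real k)) - e * f (d + real (N - 1))"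
    by (simp add: algebra_simps)
  also have "d + real (N - 1) = m - 1/2 + e" using top N by (simp add: of_nat_diff)
  finally show ?thesis using N' by simp
qed

text \<open>With full weights the upper boundary term would be \<open>cos (t * (m + e))\<close>.
  Taking off half of a wall point turns it, for \<open>e = 1/2\<close>, into
  \<open>cos (t/2) * cos (t * m)\<close>. One formula thus covers both positions of the wall, and
  the term vanishes for frequencies with \<open>cos (t * m) = 0\<close>.\<close>

lemma sum_weight_sin:
  assumes "sin (t/2) \<noteq> 0"
  shows "(\<Sum>v\<in>D. w v * sin (t * v)) = (cos (t * (d - 1/2)) - cos (t * e) * cos (t * m)) / (2 * sin (t/2))"
proof -
  have "2 * sin (t/2) * (\<Sum>v\<in>D. w v * sin (t * v)) =
    cos (t * (d - 1/2)) - cos (t * (m + e)) - 2 * sin (t/2) * (e * sin (t * (m - 1/2 + e)))"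
  proof -
    have "d + real N - 1/2 = m + e" using top by simp
    then show ?thesis
      unfolding sum_weight using sum_sin_grid[of t d N]
      by (simp add: right_diff_distrib[of "2 * sin (t/2)"])
  qed
  also have "\<dots> = cos (t * (d - 1/2)) - cos (t * e) * cos (t * m)"
    using e
  proof
    assume eh: "e = 1/2"
    have "m - 1/2 + e = m" "t * (m + e) = t * m + t/2" "t * e = t/2"
      unfolding eh by (simp_all add: algebra_simps)
    then show ?thesis by (simp only: cos_add) (simp add: eh)
  qed simp
  finally show ?thesis using assms by (simp add: field_simps)
qed

text \<open>The signed sum is twice the part below \<open>a\<close> plus the term at
  \<open>a\<close> minus the total. The last term on the right can be nonzero only if
  \<open>a\<close> is the wall.\<close>

lemma sum_weight_sgn_sin:
  assumes "sin (t/2) \<noteq> 0" "cos (t * m) = 0" "a \<in> D"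
  shows "(\<Sum>v\<in>D. w v * sin (t * v) * sgn_diff a v) =
    cos (t * (d - 1/2)) / (2 * sin (t/2)) - cot (t/2) * cos (t * a) - (1 - w a) * sin (t * a)"
proof -
  obtain K where K: "K < N" "a = d + real K" using assms(3) by (auto simp: grid_def)
  let ?g = "\<lambda>k. w (d + real k) * sin (t * (d + real k))"
  have split: "(\<Sum>k<N. F k) = (\<Sum>k<K. F k) + F K + (\<Sum>k=Suc K..<N. F k)" for F :: "nat \<Rightarrow> real"
  proof -
    have "{..<N} = insert K {..<K} \<union> {Suc K..<N}" using K by auto
    moreover have "sum F ({..<K} \<union> {Suc K..<N}) = sum F {..<K} + sum F {Suc K..<N}"
      by (rule sum.union_disjoint) auto
    ultimately show ?thesis by simp
  qed
  have "(\<Sum>v\<in>D. w v * sin (t * v) * sgn_diff a v) = (\<Sum>k<N. ?g k * sgn (real K - real k))"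
    by (simp add: sum_grid K)
  also have "\<dots> = (\<Sum>k<K. ?g k) - (\<Sum>k=Suc K..<N. ?g k)"
    unfolding split[of "\<lambda>k. ?g k * sgn (real K - real k)"]
    by (simp add: sum_negf[symmetric])
  also have "\<dots> = 2 * (\<Sum>k<K. ?g k) + ?g K - (\<Sum>k<N. ?g k)"
    unfolding split[of ?g] by simp
  also have "(\<Sum>k<K. ?g k) = (\<Sum>k<K. sin (t * (d + real k)))"
    using K by (intro sum.cong) (simp_all add: weight_eq_1)
  also have "2 * (\<Sum>k<K. sin (t * (d + real k))) = (cos (t * (d - 1/2)) - cos (t * (a - 1/2))) / sin (t/2)"
    using sum_sin_grid[of t d K] assms(1) K by (simp add: field_simps)
  also have "cos (t * (a - 1/2)) = cos (t * a) * cos (t/2) + sin (t * a) * sin (t/2)"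
    by (simp add: right_diff_distrib cos_diff)
  also have "(\<Sum>k<N. ?g k) = cos (t * (d - 1/2)) / (2 * sin (t/2))"
    using sum_weight_sin[OF assms(1)] assms(2) by (simp add: sum_grid)
  also have "?g K = w a * sin (t * a)" by (simp only: K)
  also have "(X - (p * c + q * s)) / s + wa * q - X / (2 * s) = X / (2 * s) - c / s * p - (1 - wa) * q"
    if "s \<noteq> 0" for X p q c s wa :: real
    using that by (simp add: field_simps)
  note this[OF assms(1)]
  finally show ?thesis by (simp only: cot_def)
qed

text \<open>Product-to-sum formula; the assumptions on \<open>C\<close> record that the two angles
  have opposite cosines at the wall.\<close>

lemma sum_weight_sin_cos:
  assumes "sin (A + B) \<noteq> 0" "sin (A - B) \<noteq> 0"
    and "cos (2 * (A + B) * m) = C" "cos (2 * (A - B) * m) = -C"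
  shows "(\<Sum>v\<in>D. w v * (sin (2 * A * v) * cos (2 * B * v))) =
    (cos (2 * (A + B) * (d - 1/2)) - cos (2 * (A + B) * e) * C) / (4 * sin (A + B)) +
    (cos (2 * (A - B) * (d - 1/2)) + cos (2 * (A - B) * e) * C) / (4 * sin (A - B))"
proof -
  have double: "(\<Sum>v\<in>D. w v * sin (2 * x * v)) =
      (cos (2 * x * (d - 1/2)) - cos (2 * x * e) * cos (2 * x * m)) / (2 * sin x)"
    if "sin x \<noteq> 0" for x
    using sum_weight_sin[of "2 * x"] that by simp
  have "(\<Sum>v\<in>D. w v * (sin (2 * A * v) * cos (2 * B * v))) =
    ((\<Sum>v\<in>D. w v * sin (2 * (A + B) * v)) + (\<Sum>v\<in>D. w v * sin (2 * (A - B) * v))) / 2"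
    unfolding sum.distrib[symmetric] sum_divide_distrib
    by (intro sum.cong refl) (simp add: algebra_simps sin_add sin_diff)
  also have "(\<Sum>v\<in>D. w v * sin (2 * (A + B) * v)) =
    (cos (2 * (A + B) * (d - 1/2)) - cos (2 * (A + B) * e) * C) / (2 * sin (A + B))"
    using double[OF assms(1)] by (simp only: assms)
  also have "(\<Sum>v\<in>D. w v * sin (2 * (A - B) * v)) =
    (cos (2 * (A - B) * (d - 1/2)) + cos (2 * (A - B) * e) * C) / (2 * sin (A - B))"
    using double[OF assms(2)] by (simp only: assms) simp
  also have "(x / (2 * y) + z / (2 * u)) / 2 = x / (4 * y) + z / (4 * u)" for x y z u :: real
    by (simp add: add_divide_distrib)
  finally show ?thesis .
qed

text \<open>The double sum is antisymmetric in \<open>A\<close> and \<open>B\<close>. Half the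
  difference of the two evaluations removes everything symmetric, in particular the correction at
  the wall, and leaves two sums of a sine times a cosine.\<close>

lemma sum_weight_sin_sin_sgn:
  assumes "sin A \<noteq> 0" "sin B \<noteq> 0" "sin (A + B) \<noteq> 0" "sin (A - B) \<noteq> 0"
    and cos0: "cos (2 * A * m) = 0" "cos (2 * B * m) = 0"
    and C: "C = - sin (2 * A * m) * sin (2 * B * m)"
  shows "(\<Sum>u\<in>D. \<Sum>v\<in>D. (w u * sin (2 * A * u)) * (w v * sin (2 * B * v)) * sgn_diff u v) =
    - (sin (A - B) / sin (A + B) * (cos (2 * (A + B) * (d - 1/2)) - cos (2 * (A + B) * e) * C) +
       sin (A + B) / sin (A - B) * (cos (2 * (A - B) * (d - 1/2)) + cos (2 * (A - B) * e) * C)) /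
     (8 * sin A * sin B)"
proof -
  define Q where "Q A B = (\<Sum>u\<in>D. \<Sum>v\<in>D. (w u * sin (2 * A * u)) * (w v * sin (2 * B * v)) * sgn_diff u v)"
    for A B
  define k where "k A = cos (2 * A * (d - 1/2)) / (2 * sin A)" for A
  define R where "R A B = (\<Sum>v\<in>D. w v * (sin (2 * A * v) * cos (2 * B * v)))" for A B
  have single: "(\<Sum>u\<in>D. w u * sin (2 * A * u)) = k A" if "sin A \<noteq> 0" "cos (2 * A * m) = 0" for A
    using sum_weight_sin[of "2 * A"] that by (simp add: k_def)
  have Q: "Q A B = k A * k B - cot B * R A B - (\<Sum>u\<in>D. w u * (1 - w u) * (sin (2 * A * u) * sin (2 * B * u)))"
    if "sin A \<noteq> 0" "cos (2 * A * m) = 0" "sin B \<noteq> 0" "cos (2 * B * m) = 0" for A B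
  proof -
    have "Q A B = (\<Sum>u\<in>D. w u * sin (2 * A * u) *
        (k B - cot B * cos (2 * B * u) - (1 - w u) * sin (2 * B * u)))"
      unfolding Q_def
    proof (rule sum.cong[OF refl])
      fix u assume u: "u \<in> D"
      show "(\<Sum>v\<in>D. (w u * sin (2 * A * u)) * (w v * sin (2 * B * v)) * sgn_diff u v) =
        w u * sin (2 * A * u) * (k B - cot B * cos (2 * B * u) - (1 - w u) * sin (2 * B * u))"
        using sum_weight_sgn_sin[of "2 * B" u] that u
        by (simp add: k_def sum_distrib_left[symmetric] mult.assoc)
    qed
    also have "\<dots> = (\<Sum>u\<in>D. w u * sin (2 * A * u)) * k B - cot B * R A B -
        (\<Sum>u\<in>D. w u * (1 - w u) * (sin (2 * A * u) * sin (2 * B * u)))"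
      unfolding R_def sum_distrib_left sum_distrib_right sum_subtractf[symmetric]
      by (intro sum.cong refl) (simp add: algebra_simps)
    finally show ?thesis using single[OF that(1,2)] by simp
  qed
  have anti: "Q B A = - Q A B"
  proof -
    have "Q B A = (\<Sum>v\<in>D. \<Sum>u\<in>D. - ((w v * sin (2 * A * v)) * (w u * sin (2 * B * u)) * sgn_diff v u))"
      unfolding Q_def by (subst sum.swap) (intro sum.cong refl, simp add: sgn_if)
    then show ?thesis by (simp add: Q_def sum_negf)
  qed
  have QR: "2 * Q A B = cot A * R B A - cot B * R A B"
    using anti Q[of A B] Q[of B A] assms by (simp add: mult.commute[of "sin _" "sin _"])
  define X where "X = (cos (2 * (A + B) * (d - 1/2)) - cos (2 * (A + B) * e) * C)"
  define Y where "Y = (cos (2 * (A - B) * (d - 1/2)) + cos (2 * (A - B) * e) * C)"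
  have C': "cos (2 * (A + B) * m) = C" "cos (2 * (A - B) * m) = -C"
    using cos0 C by (simp_all add: distrib_left distrib_right left_diff_distrib right_diff_distrib cos_add cos_diff)
  have RAB: "R A B = X / (4 * sin (A + B)) + Y / (4 * sin (A - B))"
    unfolding R_def X_def Y_def by (rule sum_weight_sin_cos) (use assms C' in auto)
  have RBA: "R B A = X / (4 * sin (A + B)) - Y / (4 * sin (A - B))"
  proof -
    have neg: "sin (B - A) = - sin (A - B)" by (metis minus_diff_eq sin_minus)
    have neg': "cos (2 * (B - A) * z) = cos (2 * (A - B) * z)" for z
    proof -
      have "2 * (B - A) * z = - (2 * (A - B) * z)" by (simp add: algebra_simps)
      then show ?thesis by (simp only: cos_minus)
    qed
    have "R B A = (cos (2 * (B + A) * (d - 1/2)) - cos (2 * (B + A) * e) * C) / (4 * sin (B + A)) +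
      (cos (2 * (B - A) * (d - 1/2)) + cos (2 * (B - A) * e) * C) / (4 * sin (B - A))"
      unfolding R_def
      by (rule sum_weight_sin_cos) (use assms C' neg neg' in \<open>auto simp: add.commute\<close>)
    then show ?thesis
      unfolding X_def Y_def neg neg' by (simp add: add.commute)
  qed
  have "a * (p - q) - b * (p + q) = (a - b) * p - (a + b) * q" for a b p q :: real
    by (simp add: algebra_simps)
  then have "2 * Q A B = (cot A - cot B) * (X / (4 * sin (A + B))) - (cot A + cot B) * (Y / (4 * sin (A - B)))"
    unfolding QR RAB RBA by blast
  also have "cot A - cot B = - sin (A - B) / (sin A * sin B)"
    using assms by (simp add: cot_def sin_diff field_simps)
  also have "cot A + cot B = sin (A + B) / (sin A * sin B)"
    using assms by (simp add: cot_def sin_add field_simps)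
  also have "- sin (A - B) / (sin A * sin B) * (X / (4 * sin (A + B))) -
      sin (A + B) / (sin A * sin B) * (Y / (4 * sin (A - B))) =
    - (sin (A - B) / sin (A + B) * X + sin (A + B) / sin (A - B) * Y) / (4 * sin A * sin B)"
  proof -
    have "- s / (p * q) * (x / (4 * t)) - t / (p * q) * (y / (4 * s)) = - (s / t * x + t / s * y) / (4 * p * q)"
      if "s \<noteq> 0" "t \<noteq> 0" "p \<noteq> 0" "q \<noteq> 0" for s t p q x y :: real
      using that by (simp add: field_simps)
    then show ?thesis using assms(1-4) by blast
  qed
  finally have "Q A B = - (sin (A - B) / sin (A + B) * X + sin (A + B) / sin (A - B) * Y) / (8 * sin A * sin B)"
    using assms(1,2) by (simp add: field_simps)
  then show ?thesis by (simp only: Q_def X_def Y_def)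
qed

text \<open>Attaching the sign \<open>sin (2 A m)\<close> to the angle \<open>A\<close> removes the case distinction on \<open>C\<close>.\<close>

lemma sum_weight_sin_sin_sgn_signed:
  assumes "sin A \<noteq> 0" "sin B \<noteq> 0" "sin (A + B) \<noteq> 0" "sin (A - B) \<noteq> 0"
    and cos0: "cos (2 * A * m) = 0" "cos (2 * B * m) = 0"
    and S: "S = sin (2 * A * m)" "T = sin (2 * B * m)" and ab: "a = S * A" "b = T * B"
  shows "(\<Sum>u\<in>D. \<Sum>v\<in>D. (w u * sin (2 * A * u)) * (w v * sin (2 * B * v)) * sgn_diff u v) =
    - S * T * (sin (a - b) / sin (a + b) * (cos (2 * (a + b) * (d - 1/2)) + cos (2 * (a + b) * e)) +
       sin (a + b) / sin (a - b) * (cos (2 * (a - b) * (d - 1/2)) - cos (2 * (a - b) * e))) /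
     (8 * sin a * sin b)"
proof -
  have pm: "s = 1 \<or> s = -1" if "s = sin x" "cos x = 0" for s x :: real
    using that sin_cos_squared_add[of x] by (simp add: power2_eq_1_iff)
  have S1: "S = 1 \<or> S = -1" and T1: "T = 1 \<or> T = -1"
    using pm cos0 S by blast+
  have c2: "cos (2 * (- x) * z) = cos (2 * x * z)" for x z :: real by simp
  note sum_eq = sum_weight_sin_sin_sgn[OF assms(1-6) refl, folded S]
  consider "S = 1" "T = 1" | "S = -1" "T = -1" | "S = 1" "T = -1" | "S = -1" "T = 1"
    using S1 T1 by blast
  then show ?thesis
  proof cases
    case 1
    then show ?thesis unfolding sum_eq by (simp add: ab)
  next
    case 2
    then have *: "a + b = - (A + B)" "a - b = - (A - B)" "sin a = - sin A" "sin b = - sin B"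
      by (simp_all add: ab)
    show ?thesis unfolding sum_eq * sin_minus c2 using 2 by simp
  next
    case 3
    \<comment> \<open>For opposite signs the sum and the difference of the angles exchange roles,
      hence also the two fractions.\<close>
    then have *: "a + b = A - B" "a - b = A + B" "sin a = sin A" "sin b = - sin B"
      by (simp_all add: ab)
    show ?thesis unfolding sum_eq * using 3 by (simp add: add.commute add_divide_distrib diff_divide_distrib)
  next
    case 4
    then have *: "a + b = - (A - B)" "a - b = - (A + B)" "sin a = - sin A" "sin b = sin B"
      by (simp_all add: ab)
    show ?thesis unfolding sum_eq * sin_minus c2 using 4 by (simp add: add.commute add_divide_distrib diff_divide_distrib)
  qed
qed

end

subsection \<open>Eigenfunction frequencies\<close>

text \<open>The value at the wall of the \<open>i\<close>-th mode, that is the sine of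
  \<open>(2 * i - 1) * (pi / 2)\<close>.\<close>

definition alt_sign :: "nat \<Rightarrow> real" where
  "alt_sign i = (if odd i then 1 else -1)"

lemma alt_sign_cases: "alt_sign i = 1 \<or> alt_sign i = -1"
  by (simp add: alt_sign_def)

lemma prod_two_steps:
  fixes f :: "nat \<Rightarrow> 'a::comm_monoid_mult"
  shows "(\<Prod>v=1..2*k. f v) = (\<Prod>l=1..k. f (2*l - 1) * f (2*l))"
proof (induction k)
  case (Suc k)
  have "(\<Prod>v=1..2 * Suc k. f v) = (\<Prod>v=1..2*k. f v) * (f (2*k+1) * f (2*k+2))"
    by (simp add: ac_simps)
  with Suc show ?case by (simp add: ac_simps)
qed simp

text \<open>For \<open>i < j\<close> put \<open>p = 2 * (j - i) * z\<close> and
  \<open>q = 2 * (j + i - 1) * z\<close>. Equal signs give \<open>h p / h q\<close>, different signs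
  \<open>h q / h p\<close>; either way the even multiple of \<open>2 * z\<close> is in the
  numerator. For fixed \<open>j\<close> the numbers \<open>j - i\<close> and
  \<open>j + i - 1\<close> together run once through \<open>1..2 * (j - 1)\<close>, so the factors
  can be regrouped by these multiples.\<close>

lemma prod_schur_alt_sign:
  fixes h :: "real \<Rightarrow> real" and z :: real
  assumes odd_h: "\<And>t. h (- t) = - h t"
  shows "(\<Prod>j\<in>{1..n}. \<Prod>i\<in>{i\<in>{1..n}. i < j}.
      h (alt_sign j * ((2 * real j - 1) * z) - alt_sign i * ((2 * real i - 1) * z)) /
      h (alt_sign i * ((2 * real i - 1) * z) + alt_sign j * ((2 * real j - 1) * z))) =
    (\<Prod>j=1..n. \<Prod>l=1..j-1. h (4 * real l * z) / h ((4 * real l - 2) * z))"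
proof (rule prod.cong[OF refl])
  fix j assume j: "j \<in> {1..n}"
  define r where "r v = (if even v then h (2 * real v * z) else inverse (h (2 * real v * z)))" for v :: nat
  have "(\<Prod>i\<in>{i\<in>{1..n}. i < j}.
      h (alt_sign j * ((2 * real j - 1) * z) - alt_sign i * ((2 * real i - 1) * z)) /
      h (alt_sign i * ((2 * real i - 1) * z) + alt_sign j * ((2 * real j - 1) * z))) =
    (\<Prod>i\<in>{i\<in>{1..n}. i < j}. r (j - i) * r (j + i - 1))"
  proof (rule prod.cong[OF refl])
    fix i assume i: "i \<in> {i\<in>{1..n}. i < j}"
    have ji: "real (j - i) = real j - real i" "real (j + i - 1) = real j + real i - 1"
      using i by (auto simp: of_nat_diff)
    have pq: "even (j - i) \<longleftrightarrow> even j = even i" "even (j + i - 1) \<longleftrightarrow> even j \<noteq> even i"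
      using i by auto
    define p q where "p = 2 * (real j - real i) * z" and "q = 2 * (real j + real i - 1) * z"
    have ng: "h (- p) = - h p" "h (- q) = - h q" by (rule odd_h)+
    have r: "r (j - i) = (if even j = even i then h p else inverse (h p))"
      "r (j + i - 1) = (if even j = even i then inverse (h q) else h q)"
      unfolding r_def pq ji p_def q_def by auto
    have *: "(2 * real j - 1) * z - (2 * real i - 1) * z = p"
      "(2 * real i - 1) * z + (2 * real j - 1) * z = q"
      "- ((2 * real j - 1) * z) - - ((2 * real i - 1) * z) = - p"
      "- ((2 * real i - 1) * z) + - ((2 * real j - 1) * z) = - q"
      "- ((2 * real j - 1) * z) - (2 * real i - 1) * z = - q"
      "(2 * real i - 1) * z + - ((2 * real j - 1) * z) = - p"
      "(2 * real j - 1) * z - - ((2 * real i - 1) * z) = q"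
      "- ((2 * real i - 1) * z) + (2 * real j - 1) * z = p"
      by (simp_all add: p_def q_def algebra_simps)
    consider "alt_sign j = 1" "alt_sign i = 1" "even j = even i"
      | "alt_sign j = -1" "alt_sign i = -1" "even j = even i"
      | "alt_sign j = 1" "alt_sign i = -1" "even j \<noteq> even i"
      | "alt_sign j = -1" "alt_sign i = 1" "even j \<noteq> even i"
      unfolding alt_sign_def by (cases "even i"; cases "even j") auto
    then show "h (alt_sign j * ((2 * real j - 1) * z) - alt_sign i * ((2 * real i - 1) * z)) /
        h (alt_sign i * ((2 * real i - 1) * z) + alt_sign j * ((2 * real j - 1) * z)) =
      r (j - i) * r (j + i - 1)"
      by cases (simp_all only: mult_1_left mult_minus1 * ng r simp_thms if_True if_False,
          simp_all add: divide_inverse)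
  qed
  also have "\<dots> = (\<Prod>i=1..j-1. r (j - i)) * (\<Prod>i=1..j-1. r (j + i - 1))"
    unfolding prod.distrib[symmetric] using j by (intro prod.cong) auto
  also have "(\<Prod>i=1..j-1. r (j - i)) = (\<Prod>v=1..j-1. r v)"
    by (rule prod.reindex_bij_witness[where i = "\<lambda>v. j - v" and j = "\<lambda>i. j - i"]) auto
  also have "(\<Prod>i=1..j-1. r (j + i - 1)) = (\<Prod>v=j..2*(j-1). r v)"
    using j by (intro prod.reindex_bij_witness[where i = "\<lambda>v. v + 1 - j" and j = "\<lambda>i. j + i - 1"]) auto
  also have "(\<Prod>v=1..j-1. r v) * (\<Prod>v=j..2*(j-1). r v) = (\<Prod>v=1..2*(j-1). r v)"
  proof -
    have "{1..2*(j-1)} = {1..j-1} \<union> {j..2*(j-1)}" using j by auto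
    moreover have "{1..j-1} \<inter> {j..2*(j-1)} = {}" using j by auto
    ultimately show ?thesis by (simp add: prod.union_disjoint)
  qed
  also have "\<dots> = (\<Prod>l=1..j-1. r (2*l - 1) * r (2*l))"
    by (rule prod_two_steps)
  also have "\<dots> = (\<Prod>l=1..j-1. h (4 * real l * z) / h ((4 * real l - 2) * z))"
  proof (rule prod.cong[OF refl])
    fix l assume "l \<in> {1..j-1}"
    then have "odd (2*l - 1)" "2 * real (2*l - 1) = 4 * real l - 2" "2 * real (2*l) = 4 * real l"
      by auto
    then show "r (2*l - 1) * r (2*l) = h (4 * real l * z) / h ((4 * real l - 2) * z)"
      unfolding r_def by (simp add: divide_inverse)
  qed
  finally show "(\<Prod>i\<in>{i\<in>{1..n}. i < j}.
      h (alt_sign j * ((2 * real j - 1) * z) - alt_sign i * ((2 * real i - 1) * z)) /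
      h (alt_sign i * ((2 * real i - 1) * z) + alt_sign j * ((2 * real j - 1) * z))) =
    (\<Prod>l=1..j-1. h (4 * real l * z) / h ((4 * real l - 2) * z))" .
qed

lemma cot_add_diff:
  fixes a b :: real
  assumes "sin a \<noteq> 0" "sin b \<noteq> 0"
  shows "cot a - cot b = sin (b - a) / (sin a * sin b)" "cot a + cot b = sin (a + b) / (sin a * sin b)"
  using assms by (simp_all add: cot_def sin_diff sin_add field_simps)

lemma schur_cot:
  fixes a b :: real
  assumes "sin a \<noteq> 0" "sin b \<noteq> 0"
  shows "schur (cot a) (cot b) = sin (b - a) / sin (a + b)"
  unfolding cot_add_diff[OF assms] using assms by simp

lemma sin_diff_sum:
  fixes a b :: real
  shows "sin b - sin a = 2 * (sin ((b - a)/2) * cos ((a + b)/2))"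
    and "sin a + sin b = 2 * (sin ((a + b)/2) * cos ((b - a)/2))"
proof -
  have "(a + b)/2 + (b - a)/2 = b" "(a + b)/2 - (b - a)/2 = a" by (simp_all add: field_simps)
  then have "sin b = sin ((a + b)/2) * cos ((b - a)/2) + cos ((a + b)/2) * sin ((b - a)/2)"
     "sin a = sin ((a + b)/2) * cos ((b - a)/2) - cos ((a + b)/2) * sin ((b - a)/2)"
    using sin_add[of "(a + b)/2" "(b - a)/2"] sin_diff[of "(a + b)/2" "(b - a)/2"] by simp_all
  then show "sin b - sin a = 2 * (sin ((b - a)/2) * cos ((a + b)/2))"
    "sin a + sin b = 2 * (sin ((a + b)/2) * cos ((b - a)/2))" by simp_all
qed

lemma schur_csc:
  fixes a b :: real
  assumes "sin a \<noteq> 0" "sin b \<noteq> 0"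
  shows "schur (1 / sin a) (1 / sin b) = tan ((b - a)/2) / tan ((a + b)/2)"
proof -
  have "1 / sin a - 1 / sin b = (sin b - sin a) / (sin a * sin b)"
    "1 / sin a + 1 / sin b = (sin a + sin b) / (sin a * sin b)"
    using assms by (simp_all add: field_simps)
  then have "schur (1 / sin a) (1 / sin b) = (sin b - sin a) / (sin a + sin b)"
    using assms by simp
  also have "\<dots> = tan ((b - a)/2) / tan ((a + b)/2)"
    unfolding sin_diff_sum by (simp add: tan_def)
  finally show ?thesis .
qed

text \<open>\<open>2 freq i = (2i - 1)\<pi> / (2m)\<close> are the frequencies of the dominant eigenfunction.\<close>

locale frequencies = wall_grid m d e N for m d e :: real and N +
  fixes n :: nat
  assumes nm: "2 * real n - 1 < 2 * m" and n: "n \<ge> 1"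
begin

definition freq :: "nat \<Rightarrow> real" where "freq i = (2 * real i - 1) * (pi / (4 * m))"
definition sfreq :: "nat \<Rightarrow> real" where "sfreq i = alt_sign i * ((2 * real i - 1) * (pi / (4 * m)))"

lemma m_pos: "m > 0"
proof -
  have "real n \<ge> 1" using n by simp
  then show ?thesis using nm by linarith
qed

lemma sfreq_freq: "sfreq i = alt_sign i * freq i"
  by (simp add: sfreq_def freq_def)

text \<open>The locale assumption \<open>2 * n - 1 < 2 * m\<close> keeps all angles in the first
  quadrant, which gives positive cosines and nonzero sines of sums and differences.\<close>

lemma freq_bounds:
  assumes "i \<in> {1..n}"
  shows "0 < freq i" "freq i < pi/2"
proof -
  have *: "2 * real i - 1 > 0" "2 * real i - 1 < 2 * m" using assms nm by auto
  then show "0 < freq i" using m_pos by (simp add: freq_def)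
  have "freq i = (2 * real i - 1) / (2 * m) * (pi / 2)" by (simp add: freq_def)
  also have "\<dots> < 1 * (pi / 2)" using * m_pos by (intro mult_strict_right_mono) auto
  finally show "freq i < pi/2" by simp
qed

lemma freq_less: "i < j \<Longrightarrow> freq i < freq j"
  unfolding freq_def using m_pos by (intro mult_strict_right_mono) auto

lemma freq_eq_iff: "freq i = freq j \<longleftrightarrow> i = j"
  using freq_less by (metis less_irrefl linorder_neqE_nat)

lemma sin_freq_pos: "i \<in> {1..n} \<Longrightarrow> sin (freq i) > 0"
  using freq_bounds[of i] by (intro sin_gt_zero) auto

lemma cos_freq_pos: "i \<in> {1..n} \<Longrightarrow> cos (freq i) > 0"
  using freq_bounds[of i] by (intro cos_gt_zero_pi) auto

lemma sin_nonzero: "t \<noteq> 0 \<Longrightarrow> \<bar>t\<bar> < pi \<Longrightarrow> sin t \<noteq> 0" for t :: real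
  using sin_gt_zero[of t] sin_gt_zero[of "-t"] by (cases "t > 0") auto

lemma sin_freq_add_diff:
  assumes "i \<in> {1..n}" "j \<in> {1..n}"
  shows "sin (freq i + freq j) \<noteq> 0" "i \<noteq> j \<Longrightarrow> sin (freq i - freq j) \<noteq> 0"
  by (rule sin_nonzero; use freq_bounds[OF assms(1)] freq_bounds[OF assms(2)] freq_eq_iff[of i j] in auto)+

lemma two_freq_m: "2 * freq i * m = (2 * real i - 1) * (pi / 2)"
  using m_pos by (simp add: freq_def)

text \<open>\<open>2 * freq i * m\<close> is an odd multiple of \<open>pi/2\<close>, so mode
  \<open>i\<close> is even about the wall.\<close>

lemma freq_wall: "cos (2 * freq i * m) = 0" "sin (2 * freq i * m) = alt_sign i"
proof -
  have *: "2 * freq i * m = real i * pi - pi/2"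
    unfolding two_freq_m by (simp add: algebra_simps)
  show "cos (2 * freq i * m) = 0"
    unfolding * by (simp add: cos_diff)
  show "sin (2 * freq i * m) = alt_sign i"
    unfolding * by (simp add: sin_diff alt_sign_def)
qed

lemma sin_sfreq: "sin (sfreq i) = alt_sign i * sin (freq i)" "cos (sfreq i) = cos (freq i)"
  using alt_sign_cases[of i] by (auto simp: sfreq_freq)

lemma sin_sfreq_nonzero: "i \<in> {1..n} \<Longrightarrow> sin (sfreq i) \<noteq> 0"
  using sin_freq_pos[of i] alt_sign_cases[of i] by (auto simp: sin_sfreq)

lemma sfreq_add_diff:
  assumes "i \<in> {1..n}" "j \<in> {1..n}" "i \<noteq> j"
  shows "sin (sfreq i + sfreq j) \<noteq> 0" "sin (sfreq i - sfreq j) \<noteq> 0"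
proof -
  have "sfreq i + sfreq j \<noteq> 0" "sfreq i - sfreq j \<noteq> 0"
    "\<bar>sfreq i + sfreq j\<bar> < pi" "\<bar>sfreq i - sfreq j\<bar> < pi"
    using alt_sign_cases[of i] alt_sign_cases[of j] freq_bounds[OF assms(1)] freq_bounds[OF assms(2)]
      freq_eq_iff[of i j] assms(3) by (auto simp: sfreq_freq)
  then show "sin (sfreq i + sfreq j) \<noteq> 0" "sin (sfreq i - sfreq j) \<noteq> 0"
    using sin_nonzero by blast+
qed

abbreviation "mode i v \<equiv> w v * sin (2 * freq i * v)"

text \<open>Border entry of the Pfaffian. The wall contributes nothing, and the sign of the angle is
  balanced by \<open>alt_sign i\<close>.\<close>

lemma mode_single:
  assumes "i \<in> {1..n}"
  shows "(\<Sum>v\<in>D. mode i v) = alt_sign i * cos (2 * sfreq i * (d - 1/2)) / (2 * sin (sfreq i))"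
proof -
  have "cos (2 * sfreq i * (d - 1/2)) = cos (2 * freq i * (d - 1/2))"
    using alt_sign_cases[of i] cos_minus[of "2 * freq i * (d - 1/2)"] by (auto simp: sfreq_freq)
  moreover have "(\<Sum>v\<in>D. mode i v) = cos (2 * freq i * (d - 1/2)) / (2 * sin (freq i))"
    using sum_weight_sin[of "2 * freq i"] sin_freq_pos[OF assms] freq_wall(1)[of i] by simp
  ultimately show ?thesis
    using alt_sign_cases[of i] unfolding sin_sfreq by auto
qed

text \<open>Pair entry of the Pfaffian, in signed angles. The cosines involve \<open>d\<close> and
  \<open>e\<close> and simplify differently in each of the four cases.\<close>

lemma mode_double:
  assumes "i \<in> {1..n}" "j \<in> {1..n}" "i \<noteq> j"
  shows "(\<Sum>u\<in>D. \<Sum>v\<in>D. mode i u * mode j v * sgn_diff u v) =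
    - alt_sign i * alt_sign j * (sin (sfreq i - sfreq j) / sin (sfreq i + sfreq j) *
        (cos (2 * (sfreq i + sfreq j) * (d - 1/2)) + cos (2 * (sfreq i + sfreq j) * e)) +
       sin (sfreq i + sfreq j) / sin (sfreq i - sfreq j) *
        (cos (2 * (sfreq i - sfreq j) * (d - 1/2)) - cos (2 * (sfreq i - sfreq j) * e))) /
     (8 * sin (sfreq i) * sin (sfreq j))"
  by (rule sum_weight_sin_sin_sgn_signed[OF _ _ _ _ freq_wall(1) freq_wall(1)
        freq_wall(2)[symmetric] freq_wall(2)[symmetric] sfreq_freq sfreq_freq])
     (use assms sin_freq_pos[OF assms(1)] sin_freq_pos[OF assms(2)] sin_freq_add_diff[OF assms(1,2)] in auto)

text \<open>The Schur expansions require the nodes to be distinct from each other and from all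
  negatives. Both reduce to nonzero sines of sums and differences of signed angles, and for
  \<open>i = j\<close> to a positive cosine.\<close>

lemma cot_sfreq:
  "inj_on (\<lambda>i. cot (sfreq i)) {1..n}"
  "i \<in> {1..n} \<Longrightarrow> j \<in> {1..n} \<Longrightarrow> cot (sfreq i) + cot (sfreq j) \<noteq> 0"
proof -
  show "inj_on (\<lambda>i. cot (sfreq i)) {1..n}"
  proof (rule inj_onI, rule ccontr)
    fix i j assume ij: "i \<in> {1..n}" "j \<in> {1..n}" "cot (sfreq i) = cot (sfreq j)" "i \<noteq> j"
    then have "sin (sfreq j - sfreq i) = 0"
      using cot_add_diff(1)[of "sfreq i" "sfreq j"] sin_sfreq_nonzero[OF ij(1)] sin_sfreq_nonzero[OF ij(2)] by auto
    with sfreq_add_diff(2)[of j i] ij show False by auto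
  qed
  assume ij: "i \<in> {1..n}" "j \<in> {1..n}"
  show "cot (sfreq i) + cot (sfreq j) \<noteq> 0"
  proof (cases "i = j")
    case True
    then show ?thesis using sin_sfreq_nonzero[OF ij(1)] cos_freq_pos[OF ij(1)]
      by (auto simp: cot_def sin_sfreq(2))
  next
    case False
    then show ?thesis
      using cot_add_diff(2)[of "sfreq i" "sfreq j"] sin_sfreq_nonzero[OF ij(1)] sin_sfreq_nonzero[OF ij(2)]
        sfreq_add_diff(1)[OF ij] by auto
  qed
qed

lemma sin_freq_inj:
  assumes "i \<in> {1..n}" "j \<in> {1..n}" "sin (freq i) = sin (freq j)"
  shows "i = j"
  using sin_inj_pi[of "freq i" "freq j"] freq_bounds[OF assms(1)] freq_bounds[OF assms(2)]
    freq_eq_iff[of i j] assms(3) by auto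

lemma csc_sfreq:
  "inj_on (\<lambda>i. 1 / sin (sfreq i)) {1..n}"
  "i \<in> {1..n} \<Longrightarrow> j \<in> {1..n} \<Longrightarrow> 1 / sin (sfreq i) + 1 / sin (sfreq j) \<noteq> 0"
proof -
  show "inj_on (\<lambda>i. 1 / sin (sfreq i)) {1..n}"
  proof (rule inj_onI)
    fix i j assume ij: "i \<in> {1..n}" "j \<in> {1..n}" "1 / sin (sfreq i) = 1 / sin (sfreq j)"
    then have "sin (sfreq i) = sin (sfreq j)" by simp
    then have "sin (freq i) = sin (freq j)"
      using alt_sign_cases[of i] alt_sign_cases[of j] sin_freq_pos[OF ij(1)] sin_freq_pos[OF ij(2)]
      by (auto simp: sin_sfreq)
    with ij show "i = j" by (intro sin_freq_inj)
  qed
  assume ij: "i \<in> {1..n}" "j \<in> {1..n}"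
  show "1 / sin (sfreq i) + 1 / sin (sfreq j) \<noteq> 0"
  proof
    assume "1 / sin (sfreq i) + 1 / sin (sfreq j) = 0"
    then have "sin (sfreq i) = - sin (sfreq j)"
      using sin_sfreq_nonzero[OF ij(1)] sin_sfreq_nonzero[OF ij(2)] by (simp add: field_simps)
    then have *: "alt_sign i * sin (freq i) = - (alt_sign j * sin (freq j))" by (simp add: sin_sfreq)
    then have "sin (freq i) = sin (freq j)"
      using alt_sign_cases[of i] alt_sign_cases[of j] sin_freq_pos[OF ij(1)] sin_freq_pos[OF ij(2)]
      by auto
    with ij have "i = j" by (intro sin_freq_inj)
    with * sin_freq_pos[OF ij(1)] alt_sign_cases[of i] show False by auto
  qed
qed

lemma altprod_cot:
  "altprod schur (\<lambda>i. cot (sfreq i)) {1..n} =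
    (\<Prod>j=1..n. \<Prod>l=1..j-1. sin (4 * real l * (pi / (4 * m))) / sin ((4 * real l - 2) * (pi / (4 * m))))"
proof -
  have "altprod schur (\<lambda>i. cot (sfreq i)) {1..n} = (\<Prod>j\<in>{1..n}. \<Prod>i\<in>{i\<in>{1..n}. i < j}.
      sin (sfreq j - sfreq i) / sin (sfreq i + sfreq j))"
    unfolding altprod_def by (intro prod.cong refl schur_cot sin_sfreq_nonzero) auto
  also have "\<dots> = (\<Prod>j=1..n. \<Prod>l=1..j-1. sin (4 * real l * (pi / (4 * m))) / sin ((4 * real l - 2) * (pi / (4 * m))))"
    unfolding sfreq_def by (rule prod_schur_alt_sign) (rule sin_minus)
  finally show ?thesis .
qed

text \<open>The odd function is \<open>tan (t/2)\<close>, which by \<open>schur_csc\<close> governs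
  the Schur quotients of cosecants.\<close>

lemma altprod_csc:
  "altprod schur (\<lambda>i. 1 / sin (sfreq i)) {1..n} =
    (\<Prod>j=1..n. \<Prod>l=1..j-1. tan (2 * real l * (pi / (4 * m))) / tan ((2 * real l - 1) * (pi / (4 * m))))"
proof -
  have "altprod schur (\<lambda>i. 1 / sin (sfreq i)) {1..n} = (\<Prod>j\<in>{1..n}. \<Prod>i\<in>{i\<in>{1..n}. i < j}.
      (\<lambda>t. tan (t/2)) (sfreq j - sfreq i) / (\<lambda>t. tan (t/2)) (sfreq i + sfreq j))"
    unfolding altprod_def by (intro prod.cong refl schur_csc sin_sfreq_nonzero) auto
  also have "\<dots> = (\<Prod>j=1..n. \<Prod>l=1..j-1. (\<lambda>t. tan (t/2)) (4 * real l * (pi / (4 * m))) / (\<lambda>t. tan (t/2)) ((4 * real l - 2) * (pi / (4 * m))))"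
    unfolding sfreq_def by (rule prod_schur_alt_sign) simp
  also have "\<dots> = (\<Prod>j=1..n. \<Prod>l=1..j-1. tan (2 * real l * (pi / (4 * m))) / tan ((2 * real l - 1) * (pi / (4 * m))))"
  proof -
    have "4 * x * y / 2 = 2 * x * y" "(4 * x - 2) * y / 2 = (2 * x - 1) * y" for x y :: real
      by (simp_all add: field_simps)
    then show ?thesis by (simp only:)
  qed
  finally show ?thesis .
qed

end

text \<open>In the half angles \<open>u = (a + b)/2\<close> and \<open>w = (a - b)/2\<close> each
  bracket factors: \<open>cos a * cos b\<close> is \<open>(cos w)\<^sup>2 - (sin u)\<^sup>2\<close>
  and \<open>1 + sin a * sin b\<close> is \<open>(cos w)\<^sup>2 + (sin u)\<^sup>2\<close>. The
  first identity treats the pair entry for \<open>d = 1\<close> and \<open>e = 0\<close>, the second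
  that for \<open>d = e = 1/2\<close>.\<close>

lemma half_angle_products:
  fixes a b :: real
  assumes "sin (a + b) \<noteq> 0" "sin (a - b) \<noteq> 0"
  shows "- (sin (a - b) / sin (a + b) * (cos (a + b) + 1) + sin (a + b) / sin (a - b) * (cos (a - b) - 1)) =
      2 * cos a * cos b * (tan ((b - a)/2) / tan ((a + b)/2))" (is ?cos)
    and "- (sin (a - b) / sin (a + b) * (1 + cos (a + b)) + sin (a + b) / sin (a - b) * (1 - cos (a - b))) =
      2 * (1 + sin a * sin b) * (tan ((b - a)/2) / tan ((a + b)/2))" (is ?sin)
proof -
  define u w where "u = (a + b)/2" and "w = (a - b)/2"
  have ab: "a + b = 2 * u" "a - b = 2 * w" "(b - a)/2 = - w" "(a + b)/2 = u" "a = u + w" "b = u - w"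
    by (simp_all add: u_def w_def field_simps)
  have nz: "sin u \<noteq> 0" "cos u \<noteq> 0" "sin w \<noteq> 0" "cos w \<noteq> 0"
    using assms unfolding ab(1,2) sin_double by auto
  have 1: "cos (2 * u) + 1 = 2 * (cos u)\<^sup>2" "cos (2 * w) - 1 = - 2 * (sin w)\<^sup>2"
    "1 + cos (2 * u) = 2 * (cos u)\<^sup>2" "1 - cos (2 * w) = 2 * (sin w)\<^sup>2"
    by (simp_all add: cos_double_cos[of u] cos_double_sin[of w])
  have 2: "cos a * cos b = (cos w)\<^sup>2 - (sin u)\<^sup>2" "1 + sin a * sin b = (cos w)\<^sup>2 + (sin u)\<^sup>2"
  proof -
    have "(cos u * cos w) * (cos u * cos w) - (sin u * sin w) * (sin u * sin w) = (cos w)\<^sup>2 - (sin u)\<^sup>2"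
      "1 + ((sin u * cos w) * (sin u * cos w) - (cos u * sin w) * (cos u * sin w)) = (cos w)\<^sup>2 + (sin u)\<^sup>2"
      using sin_cos_squared_add[of u] sin_cos_squared_add[of w] by algebra+
    then show "cos a * cos b = (cos w)\<^sup>2 - (sin u)\<^sup>2" "1 + sin a * sin b = (cos w)\<^sup>2 + (sin u)\<^sup>2"
      unfolding ab(5,6) cos_add cos_diff sin_add sin_diff by (simp_all add: algebra_simps)
  qed
  have t: "tan (- w) / tan u = - (sin w * cos u) / (sin u * cos w)"
    using nz by (simp add: tan_def)
  have "- (sw * cw / (su * cu) * (2 * cu\<^sup>2) + su * cu / (sw * cw) * (- 2 * sw\<^sup>2)) =
      2 * (cw\<^sup>2 - su\<^sup>2) * (- (sw * cu) / (su * cw))"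
    "- (sw * cw / (su * cu) * (2 * cu\<^sup>2) + su * cu / (sw * cw) * (2 * sw\<^sup>2)) =
      2 * (cw\<^sup>2 + su\<^sup>2) * (- (sw * cu) / (su * cw))"
    if "su \<noteq> 0" "cu \<noteq> 0" "sw \<noteq> 0" "cw \<noteq> 0" for su cu sw cw :: real
    using that by (simp_all add: field_simps power2_eq_square)
  note alg = this[OF nz]
  have r: "sin (2 * w) / sin (2 * u) = sin w * cos w / (sin u * cos u)"
    "sin (2 * u) / sin (2 * w) = sin u * cos u / (sin w * cos w)"
    unfolding sin_double by simp_all
  show ?cos
    unfolding mult.assoc[of 2 "cos a"] 2 unfolding ab(3,4) unfolding ab(1,2) r 1 t by (rule alg)
  show ?sin
    unfolding 2 unfolding ab(3,4) unfolding ab(1,2) r 1 t by (rule alg)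
qed

section \<open>The four Pfaffians\<close>

context frequencies
begin

lemma mode_single_half: "d = 1/2 \<Longrightarrow> i \<in> {1..n} \<Longrightarrow> (\<Sum>v\<in>D. mode i v) = alt_sign i / (2 * sin (sfreq i))"
  using mode_single[of i] by (simp only: diff_self mult_zero_right cos_zero mult_1_right)

lemma mode_single_one:
  assumes "d = 1" "i \<in> {1..n}"
  shows "(\<Sum>v\<in>D. mode i v) = alt_sign i * cos (sfreq i) / (2 * sin (sfreq i))"
proof -
  have "2 * sfreq i * (d - 1/2) = sfreq i" using assms(1) by simp
  then show ?thesis using mode_single[OF assms(2)] by (simp only:)
qed

lemma mode_factor: "alt_sign i / sin (sfreq i) = 1 / sin (freq i)"
  using alt_sign_cases[of i] by (auto simp: sin_sfreq)

lemma tan_quotient: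
  assumes "i \<in> {1..n}" "j \<in> {1..n}"
  shows "tan ((sfreq j - sfreq i)/2) / tan ((sfreq i + sfreq j)/2) = schur (1 / sin (sfreq i)) (1 / sin (sfreq j))"
  by (rule schur_csc[symmetric]) (use assms sin_sfreq_nonzero in auto)

lemma sin_quotient:
  assumes "i \<in> {1..n}" "j \<in> {1..n}"
  shows "sin (sfreq i - sfreq j) / sin (sfreq i + sfreq j) = - schur (cot (sfreq i)) (cot (sfreq j))"
  using schur_cot[OF sin_sfreq_nonzero[OF assms(1)] sin_sfreq_nonzero[OF assms(2)]]
    sin_minus[of "sfreq j - sfreq i"] by simp

text \<open>All four cosines in the pair entry are 1, so the second bracket vanishes and the first
  leaves a Schur quotient of cotangents.\<close>

lemma sorted_sum_mode_csc_csc: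
  assumes "d = 1/2" "e = 0"
  shows "sorted_sum D mode {1..n} = (\<Prod>i=1..n. 1 / (2 * sin (freq i))) *
    (\<Prod>j=1..n. \<Prod>l=1..j-1. sin (4 * real l * (pi / (4 * m))) / sin ((4 * real l - 2) * (pi / (4 * m))))"
proof -
  have "sorted_sum D mode {1..n} = (\<Prod>i=1..n. alt_sign i / (2 * sin (sfreq i))) *
      altprod schur (\<lambda>i. cot (sfreq i)) {1..n}"
  proof (rule sorted_sum_schur)
    fix i j assume ij: "i \<in> {1..n}" "j \<in> {1..n}" "i \<noteq> j"
    show "(\<Sum>u\<in>D. \<Sum>v\<in>D. mode i u * mode j v * of_real (sgn_diff u v)) =
      alt_sign i / (2 * sin (sfreq i)) * (alt_sign j / (2 * sin (sfreq j))) * schur (cot (sfreq i)) (cot (sfreq j))"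
    proof -
      have zero: "2 * x * (d - 1/2) = 0" "2 * x * e = 0" for x :: real using assms by simp_all
      have "- S * T * (- R * (1 + 1) + q * (1 - 1)) / (8 * x * y) = S / (2 * x) * (T / (2 * y)) * R"
        for S T R q x y :: real by simp
      then show ?thesis
        unfolding of_real_eq_id id_apply mode_double[OF ij] sin_quotient[OF ij(1,2)] zero cos_zero .
    qed
  next
    fix j assume "j \<in> {1..n}"
    then show "(\<Sum>v\<in>D. mode j v) = alt_sign j / (2 * sin (sfreq j))"
      by (rule mode_single_half[OF assms(1)])
  qed (use cot_sfreq in auto)
  also have "(\<lambda>i. alt_sign i / (2 * sin (sfreq i))) = (\<lambda>i. 1 / (2 * sin (freq i)))"
    using mode_factor by (metis (no_types) divide_divide_eq_left mult.commute)
  finally show ?thesis unfolding altprod_cot .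
qed

text \<open>By the first half-angle identity the pair entry is a Schur quotient of cosecants times
  \<open>cos (sfreq i) * cos (sfreq j)\<close>, which joins the row factors.\<close>

lemma sorted_sum_mode_cot_csc:
  assumes "d = 1" "e = 0"
  shows "sorted_sum D mode {1..n} = (\<Prod>i=1..n. cos (freq i) / (2 * sin (freq i))) *
    (\<Prod>j=1..n. \<Prod>l=1..j-1. tan (2 * real l * (pi / (4 * m))) / tan ((2 * real l - 1) * (pi / (4 * m))))"
proof -
  have "sorted_sum D mode {1..n} = (\<Prod>i=1..n. alt_sign i * cos (sfreq i) / (2 * sin (sfreq i))) *
      altprod schur (\<lambda>i. 1 / sin (sfreq i)) {1..n}"
  proof (rule sorted_sum_schur)
    fix i j assume ij: "i \<in> {1..n}" "j \<in> {1..n}" "i \<noteq> j"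
    have half: "2 * x * (d - 1/2) = x" for x :: real using assms by simp
    have "- (sin (sfreq i - sfreq j) / sin (sfreq i + sfreq j) * (cos (sfreq i + sfreq j) + 1) +
        sin (sfreq i + sfreq j) / sin (sfreq i - sfreq j) * (cos (sfreq i - sfreq j) - 1)) =
      2 * cos (sfreq i) * cos (sfreq j) * schur (1 / sin (sfreq i)) (1 / sin (sfreq j))" (is "- ?L = ?R")
      unfolding tan_quotient[OF ij(1,2), symmetric] by (rule half_angle_products sfreq_add_diff ij)+
    then have L: "?L = - ?R" by simp
    have abs: "- S * T * L / (8 * x * y) = S * c / (2 * x) * (T * c' / (2 * y)) * R"
      if "L = - (2 * c * c' * R)" for S T L R c c' x y :: real
      unfolding that by (simp add: ac_simps)
    show "(\<Sum>u\<in>D. \<Sum>v\<in>D. mode i u * mode j v * of_real (sgn_diff u v)) =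
      alt_sign i * cos (sfreq i) / (2 * sin (sfreq i)) * (alt_sign j * cos (sfreq j) / (2 * sin (sfreq j))) *
       schur (1 / sin (sfreq i)) (1 / sin (sfreq j))"
      unfolding of_real_eq_id id_apply mode_double[OF ij] half assms(2) mult_zero_right cos_zero
      by (rule abs[OF L])
  next
    fix j assume "j \<in> {1..n}"
    then show "(\<Sum>v\<in>D. mode j v) = alt_sign j * cos (sfreq j) / (2 * sin (sfreq j))"
      by (rule mode_single_one[OF assms(1)])
  qed (use csc_sfreq in auto)
  also have "(\<lambda>i. alt_sign i * cos (sfreq i) / (2 * sin (sfreq i))) = (\<lambda>i. cos (freq i) / (2 * sin (freq i)))"
  proof
    fix i show "alt_sign i * cos (sfreq i) / (2 * sin (sfreq i)) = cos (freq i) / (2 * sin (freq i))"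
      using alt_sign_cases[of i] by (auto simp: sin_sfreq)
  qed
  finally show ?thesis unfolding altprod_csc .
qed

text \<open>Makes the sum of the signed angles a plain multiple of \<open>k\<close>, up to sign,
  although the angles themselves grow.\<close>

lemma sum_alt_sign: "(\<Sum>i=1..k. alt_sign i * (2 * real i - 1)) = - (real k * alt_sign (Suc k))"
  by (induction k) (auto simp: alt_sign_def)

text \<open>\<open>cot a + \<i>\<close> times \<open>sin a\<close> is \<open>cis a\<close>, so the
  angles add up.\<close>

lemma prod_complex_of_real_cot:
  "(\<Prod>i=1..k. complex_of_real (cot (sfreq i)) + \<i>) * (\<Prod>i=1..k. complex_of_real (sin (sfreq i))) =
     cis (- (real k * alt_sign (Suc k)) * (pi / (4 * m)))"
  if "k \<le> n"
proof -
  have *: "(complex_of_real (cot (sfreq i)) + \<i>) * complex_of_real (sin (sfreq i)) = cis (sfreq i)"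
    if "i \<in> {1..k}" for i
  proof -
    have "sin (sfreq i) \<noteq> 0" using that \<open>k \<le> n\<close> by (intro sin_sfreq_nonzero) auto
    then show ?thesis by (simp add: complex_eq_iff cot_def)
  qed
  have "(\<Prod>i=1..k. complex_of_real (cot (sfreq i)) + \<i>) * (\<Prod>i=1..k. complex_of_real (sin (sfreq i))) =
     (\<Prod>i=1..k. cis (sfreq i))"
    unfolding prod.distrib[symmetric] by (intro prod.cong refl *)
  also have "\<dots> = cis (\<Sum>i=1..k. sfreq i)"
    by (induction k) (simp_all add: cis_mult)
  also have "(\<Sum>i=1..k. sfreq i) = (\<Sum>i=1..k. alt_sign i * (2 * real i - 1)) * (pi / (4 * m))"
    unfolding sfreq_def sum_distrib_right by (simp only: mult.assoc)
  finally show ?thesis by (simp only: sum_alt_sign)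
qed

lemma inj_complex_cot: "inj_on (\<lambda>i. complex_of_real (cot (sfreq i))) {1..n}"
  by (rule inj_onI, rule inj_onD[OF cot_sfreq(1)]) (simp_all only: of_real_eq_iff)

text \<open>The two halves of \<open>sympart\<close> are complex conjugates, so their mean is a real
  part: the cosine of the sum of the angles over the product of the sines.\<close>

lemma sympart_cot:
  "sympart \<i> ((\<lambda>i. complex_of_real (cot (sfreq i))) ` {1..n}) =
    complex_of_real (cos (real n * (pi / (4 * m))) / (\<Prod>i=1..n. sin (sfreq i)))"
proof -
  let ?x = "\<lambda>i. complex_of_real (cot (sfreq i))"
  let ?t = "- (real n * alt_sign (Suc n)) * (pi / (4 * m))"
  note inj = inj_complex_cot
  have S: "(\<Prod>i=1..n. complex_of_real (sin (sfreq i))) \<noteq> 0"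
    using sin_sfreq_nonzero by auto
  have P: "(\<Prod>i=1..n. ?x i + \<i>) = cis ?t / (\<Prod>i=1..n. complex_of_real (sin (sfreq i)))"
    unfolding nonzero_eq_divide_eq[OF S] by (rule prod_complex_of_real_cot) simp
  have "(\<Prod>i=1..n. ?x i - \<i>) = cnj (\<Prod>i=1..n. ?x i + \<i>)"
    unfolding cnj_prod by (intro prod.cong refl) simp
  also have "\<dots> = cis (- ?t) / (\<Prod>i=1..n. complex_of_real (sin (sfreq i)))"
    unfolding P complex_cnj_divide cnj_prod cis_cnj complex_cnj_complex_of_real ..
  finally have M: "(\<Prod>i=1..n. ?x i - \<i>) = cis (- ?t) / (\<Prod>i=1..n. complex_of_real (sin (sfreq i)))" .
  have c: "(cis t + cis (- t)) / 2 = complex_of_real (cos t)" for t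
    by (simp add: complex_eq_iff)
  have ct: "cos ?t = cos (real n * (pi / (4 * m)))"
    using alt_sign_cases[of "Suc n"] cos_minus[of "real n * (pi / (4 * m))"] by auto
  have "sympart \<i> (?x ` {1..n}) = ((\<Prod>i=1..n. ?x i + \<i>) + (\<Prod>i=1..n. ?x i - \<i>)) / 2"
    unfolding sympart_def prod.reindex[OF inj] by (simp only: o_def)
  also have "\<dots> = (cis ?t + cis (- ?t)) / 2 / (\<Prod>i=1..n. complex_of_real (sin (sfreq i)))"
    unfolding P M by (simp only: add_divide_distrib[symmetric] divide_divide_eq_left mult.commute)
  also have "\<dots> = complex_of_real (cos (real n * (pi / (4 * m)))) / (\<Prod>i=1..n. complex_of_real (sin (sfreq i)))"
    unfolding c ct ..
  finally show ?thesis by simp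
qed

lemma sorted_sum_of_real:
  "sorted_sum D (\<lambda>i v. of_real (g i v)) I = of_real (sorted_sum D g I)"
  by (simp add: sorted_sum_def)

text \<open>The second bracket vanishes and the first is \<open>2 * cos (a + b)\<close>. Since
  \<open>cos (a + b) / (sin a * sin b) = cot a * cot b - 1\<close>, the entry has the factor
  \<open>c\<^sup>2 + x i * x j\<close> with \<open>c = \<i>\<close>, which is why this case is
  computed over the complex numbers.\<close>

lemma sorted_sum_mode_cot_cot:
  assumes "d = 1" "e = 1/2"
  shows "sorted_sum D mode {1..n} = (\<Prod>i=1..n. 1 / (2 * sin (freq i))) * cos (real n * (pi / (4 * m))) *
    (\<Prod>j=1..n. \<Prod>l=1..j-1. sin (4 * real l * (pi / (4 * m))) / sin ((4 * real l - 2) * (pi / (4 * m))))"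
proof -
  let ?x = "\<lambda>i. complex_of_real (cot (sfreq i))"
  have "complex_of_real (sorted_sum D mode {1..n}) = sorted_sum D (\<lambda>i v. complex_of_real (mode i v)) {1..n}"
    by (simp only: sorted_sum_of_real)
  also have "\<dots> = (\<Prod>i=1..n. complex_of_real (alt_sign i / 2)) *
      (altprod schur ?x {1..n} * sympart \<i> (?x ` {1..n}))"
  proof (rule sorted_sum_schur_sympart)
    show "inj_on ?x {1..n}" by (rule inj_complex_cot)
  next
    fix i j assume "i \<in> {1..n}" "j \<in> {1..n}"
    then have "cot (sfreq i) + cot (sfreq j) \<noteq> 0" by (rule cot_sfreq(2))
    then show "?x i + ?x j \<noteq> 0" by (metis of_real_add of_real_eq_0_iff)
  next
    fix j assume "j \<in> {1..n}"
    then have "(\<Sum>v\<in>D. mode j v) = alt_sign j / 2 * cot (sfreq j)"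
      using mode_single_one[OF assms(1), of j] by (simp add: cot_def)
    then show "(\<Sum>v\<in>D. complex_of_real (mode j v)) = complex_of_real (alt_sign j / 2) * ?x j"
      by (metis of_real_mult of_real_sum)
  next
    fix i j assume ij: "i \<in> {1..n}" "j \<in> {1..n}" "i \<noteq> j"
    have half: "2 * x * (d - 1/2) = x" "2 * x * e = x" for x :: real using assms by simp_all
    have cc: "cos (sfreq i + sfreq j) / (sin (sfreq i) * sin (sfreq j)) = cot (sfreq i) * cot (sfreq j) - 1"
      using sin_sfreq_nonzero[OF ij(1)] sin_sfreq_nonzero[OF ij(2)]
      by (simp add: cot_def cos_add field_simps)
    have "(\<Sum>u\<in>D. \<Sum>v\<in>D. mode i u * mode j v * sgn_diff u v) =
      alt_sign i / 2 * (alt_sign j / 2) * (schur (cot (sfreq i)) (cot (sfreq j)) *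
       (cos (sfreq i + sfreq j) / (sin (sfreq i) * sin (sfreq j))))"
    proof -
      have "- S * T * (- R * (k + k) + q * (l - l)) / (8 * x * y) = S / 2 * (T / 2) * (R * (k / (x * y)))"
        for S T R q k l x y :: real by simp
      then show ?thesis
        unfolding mode_double[OF ij] half sin_quotient[OF ij(1,2)] .
    qed
    then have "(\<Sum>u\<in>D. \<Sum>v\<in>D. mode i u * mode j v * sgn_diff u v) =
      alt_sign i / 2 * (alt_sign j / 2) * (schur (cot (sfreq i)) (cot (sfreq j)) *
       (cot (sfreq i) * cot (sfreq j) - 1))" unfolding cc .
    then have "complex_of_real (\<Sum>u\<in>D. \<Sum>v\<in>D. mode i u * mode j v * sgn_diff u v) =
      complex_of_real (alt_sign i / 2 * (alt_sign j / 2) * (schur (cot (sfreq i)) (cot (sfreq j)) *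
       (cot (sfreq i) * cot (sfreq j) - 1)))" by (rule arg_cong)
    then show "(\<Sum>u\<in>D. \<Sum>v\<in>D. complex_of_real (mode i u) * complex_of_real (mode j v) * of_real (sgn_diff u v)) =
      complex_of_real (alt_sign i / 2) * complex_of_real (alt_sign j / 2) *
       (schur (?x i) (?x j) * (\<i>\<^sup>2 + ?x i * ?x j))"
      by simp
  next
    fix i
    show "?x i \<noteq> \<i>" "?x i \<noteq> - \<i>" by (auto simp: complex_eq_iff)
  qed auto
  also have "altprod schur ?x {1..n} = complex_of_real (altprod schur (\<lambda>i. cot (sfreq i)) {1..n})"
    by (simp add: altprod_def)
  also have "(\<Prod>i=1..n. complex_of_real (alt_sign i / 2)) *
      (complex_of_real (altprod schur (\<lambda>i. cot (sfreq i)) {1..n}) * sympart \<i> (?x ` {1..n})) =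
    complex_of_real ((\<Prod>i=1..n. alt_sign i / 2) * (altprod schur (\<lambda>i. cot (sfreq i)) {1..n} *
      (cos (real n * (pi / (4 * m))) / (\<Prod>i=1..n. sin (sfreq i)))))"
    unfolding sympart_cot by simp
  finally have "sorted_sum D mode {1..n} = (\<Prod>i=1..n. alt_sign i / 2) *
     (altprod schur (\<lambda>i. cot (sfreq i)) {1..n} *
      (cos (real n * (pi / (4 * m))) / (\<Prod>i=1..n. sin (sfreq i))))"
    by (simp only: of_real_eq_iff)
  also have "\<dots> = (\<Prod>i=1..n. alt_sign i / 2 / sin (sfreq i)) * cos (real n * (pi / (4 * m))) *
     altprod schur (\<lambda>i. cot (sfreq i)) {1..n}"
    unfolding prod_dividef[of "\<lambda>i. alt_sign i / 2"] by simp
  also have "(\<Prod>i=1..n. alt_sign i / 2 / sin (sfreq i)) = (\<Prod>i=1..n. 1 / (2 * sin (freq i)))"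
    using mode_factor by (intro prod.cong refl) (metis divide_divide_eq_left mult.commute)
  finally show ?thesis unfolding altprod_cot .
qed

text \<open>The second half-angle identity gives the factor \<open>1 + sin a * sin b\<close>;
  divided by \<open>sin a * sin b\<close> it is \<open>c\<^sup>2 + x i * x j\<close> with
  \<open>c = 1\<close> and cosecants as nodes.\<close>

lemma sorted_sum_mode_csc_cot:
  assumes "d = 1/2" "e = 1/2"
  shows "sorted_sum D mode {1..n} = (\<Prod>i=1..n. 1 / (2 * sin (freq i))) *
    (((\<Prod>i=1..n. 1 + sin (sfreq i)) + (\<Prod>i=1..n. 1 - sin (sfreq i))) / 2) *
    (\<Prod>j=1..n. \<Prod>l=1..j-1. tan (2 * real l * (pi / (4 * m))) / tan ((2 * real l - 1) * (pi / (4 * m))))"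
proof -
  let ?x = "\<lambda>i. 1 / sin (sfreq i)"
  \<comment> \<open>Strictly below 1, so that no cosecant equals \<open>c\<close> or
    \<open>- c\<close>.\<close>
  have abs_less: "\<bar>sin (sfreq i)\<bar> < 1" if "i \<in> {1..n}" for i
  proof -
    have "sin (freq i) < 1"
      using sin_monotone_2pi[of "freq i" "pi/2"] freq_bounds[OF that] by simp
    then show ?thesis using alt_sign_cases[of i] sin_freq_pos[OF that] by (auto simp: sin_sfreq)
  qed
  have "sorted_sum D mode {1..n} = (\<Prod>i=1..n. alt_sign i / 2) *
      (altprod schur ?x {1..n} * sympart 1 (?x ` {1..n}))"
  proof (rule sorted_sum_schur_sympart)
    fix j assume "j \<in> {1..n}"
    then show "(\<Sum>v\<in>D. mode j v) = alt_sign j / 2 * ?x j"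
      using mode_single_half[OF assms(1), of j] by simp
  next
    fix i j assume ij: "i \<in> {1..n}" "j \<in> {1..n}" "i \<noteq> j"
    have half: "2 * x * (d - 1/2) = 0" "2 * x * e = x" for x :: real using assms by simp_all
    have "- (sin (sfreq i - sfreq j) / sin (sfreq i + sfreq j) * (1 + cos (sfreq i + sfreq j)) +
        sin (sfreq i + sfreq j) / sin (sfreq i - sfreq j) * (1 - cos (sfreq i - sfreq j))) =
      2 * (1 + sin (sfreq i) * sin (sfreq j)) * schur (?x i) (?x j)" (is "- ?L = 2 * ?c * ?R")
      unfolding tan_quotient[OF ij(1,2), symmetric] by (rule half_angle_products sfreq_add_diff ij)+
    then have L: "?L = - (2 * ?c * ?R)" by simp
    have "(\<Sum>u\<in>D. \<Sum>v\<in>D. mode i u * mode j v * of_real (sgn_diff u v)) =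
      - alt_sign i * alt_sign j * ?L / (8 * sin (sfreq i) * sin (sfreq j))"
      unfolding of_real_eq_id id_apply mode_double[OF ij] half cos_zero ..
    also have "\<dots> = alt_sign i / 2 * (alt_sign j / 2) * (?R * (?c / (sin (sfreq i) * sin (sfreq j))))"
    proof -
      have "- S * T * (- (2 * c * R)) / (8 * x * y) = S / 2 * (T / 2) * (R * (c / (x * y)))"
        for S T c R x y :: real by (simp add: ac_simps)
      then show ?thesis unfolding L .
    qed
    also have "?c / (sin (sfreq i) * sin (sfreq j)) = 1\<^sup>2 + ?x i * ?x j"
      using sin_sfreq_nonzero[OF ij(1)] sin_sfreq_nonzero[OF ij(2)] by (simp add: field_simps)
    finally show "(\<Sum>u\<in>D. \<Sum>v\<in>D. mode i u * mode j v * of_real (sgn_diff u v)) =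
      alt_sign i / 2 * (alt_sign j / 2) * (?R * (1\<^sup>2 + ?x i * ?x j))" .
  next
    fix i assume "i \<in> {1..n}"
    then have "\<bar>sin (sfreq i)\<bar> < 1" by (rule abs_less)
    then have "s \<noteq> 1 \<and> s \<noteq> -1" if "s = sin (sfreq i)" for s using that by auto
    then show "?x i \<noteq> 1" "?x i \<noteq> - 1" by (auto simp: divide_eq_eq eq_divide_eq)
  qed (use csc_sfreq in auto)
  also have "sympart 1 (?x ` {1..n}) = ((\<Prod>i=1..n. ?x i + 1) + (\<Prod>i=1..n. ?x i - 1)) / 2"
    unfolding sympart_def prod.reindex[OF csc_sfreq(1)] by (simp only: o_def)
  also have "(\<Prod>i=1..n. ?x i + 1) = (\<Prod>i=1..n. 1 + sin (sfreq i)) / (\<Prod>i=1..n. sin (sfreq i))"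
    unfolding prod_dividef[symmetric] using sin_sfreq_nonzero by (intro prod.cong refl) (simp add: field_simps)
  also have "(\<Prod>i=1..n. ?x i - 1) = (\<Prod>i=1..n. 1 - sin (sfreq i)) / (\<Prod>i=1..n. sin (sfreq i))"
    unfolding prod_dividef[symmetric] using sin_sfreq_nonzero by (intro prod.cong refl) (simp add: field_simps)
  also have "(\<Prod>i=1..n. alt_sign i / 2) * (altprod schur ?x {1..n} *
      (((\<Prod>i=1..n. 1 + sin (sfreq i)) / (\<Prod>i=1..n. sin (sfreq i)) +
        (\<Prod>i=1..n. 1 - sin (sfreq i)) / (\<Prod>i=1..n. sin (sfreq i))) / 2)) =
    (\<Prod>i=1..n. alt_sign i / 2 / sin (sfreq i)) *
    (((\<Prod>i=1..n. 1 + sin (sfreq i)) + (\<Prod>i=1..n. 1 - sin (sfreq i))) / 2) * altprod schur ?x {1..n}"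
    unfolding prod_dividef[of "\<lambda>i. alt_sign i / 2"] add_divide_distrib[symmetric] by simp
  also have "(\<Prod>i=1..n. alt_sign i / 2 / sin (sfreq i)) = (\<Prod>i=1..n. 1 / (2 * sin (freq i)))"
    using mode_factor by (intro prod.cong refl) (metis divide_divide_eq_left mult.commute)
  finally show ?thesis unfolding altprod_csc .
qed

end

subsection \<open>Principal specializations\<close>

lemma prod_square_Suc:
  fixes f :: "nat \<Rightarrow> nat \<Rightarrow> 'a::comm_monoid_mult"
  shows "(\<Prod>h=1..Suc n. \<Prod>t=1..Suc n. f h t) =
    (\<Prod>h=1..n. \<Prod>t=1..n. f h t) * ((\<Prod>h=1..n. f h (Suc n)) * (\<Prod>t=1..n. f (Suc n) t) * f (Suc n) (Suc n))"
  by (simp add: prod.distrib ac_simps)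

lemma prod_reverse: "(\<Prod>h=1..n::nat. f h) = (\<Prod>h=1..n. f (Suc n - h))"
  by (rule prod.reindex_bij_witness[where i = "\<lambda>h. Suc n - h" and j = "\<lambda>h. Suc n - h"]) auto

lemma prod_shift_split: "(\<Prod>v=1..2*n. f v) = (\<Prod>v=1..n. f v) * (\<Prod>v=1..n. f (n + v :: nat) :: 'a::comm_monoid_mult)"
proof -
  have "{1..2*n} = {1..n} \<union> {n+1..2*n}" "{1..n} \<inter> {n+1..2*n} = {}" by auto
  then have "(\<Prod>v=1..2*n. f v) = (\<Prod>v=1..n. f v) * (\<Prod>v=n+1..2*n. f v)"
    by (simp add: prod.union_disjoint)
  also have "(\<Prod>v=n+1..2*n. f v) = (\<Prod>v=1..n. f (n + v))"
    by (rule prod.reindex_bij_witness[where i = "\<lambda>v. n + v" and j = "\<lambda>v. v - n"]) auto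
  finally show ?thesis .
qed

text \<open>\<open>4 ^ (n * (n - 1) div 2)\<close>: the factors 4 in Weyl's denominator formula, one
  for each pair of indices.\<close>

definition c4 :: "nat \<Rightarrow> real" where "c4 n = (\<Prod>j=1..n. 4 ^ (j - 1))"

text \<open>The factors of \<open>E_even\<close> that do not involve \<eta>, sorted by the larger
  index, with \<open>z = pi / (4 * m)\<close>; \<open>e1\<close> plays the same part for
  \<open>E_odd\<close>.\<close>

definition e0 :: "real \<Rightarrow> nat \<Rightarrow> real" where
  "e0 z n = (\<Prod>j=1..n. \<Prod>v=1..2*j-1. sin (2 * real v * z))"

definition e1 :: "real \<Rightarrow> nat \<Rightarrow> real" where
  "e1 z n = (\<Prod>j=1..n. (\<Prod>v=1..2*j-2. sin (2 * real v * z)) * sin ((2 * real j - 1) * z))"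

text \<open>The \<open>n\<close> by \<open>n\<close> product in \<open>U_factor\<close>, for a
  general numerator.\<close>

definition square_quot :: "real \<Rightarrow> (real \<Rightarrow> real) \<Rightarrow> nat \<Rightarrow> real" where
  "square_quot z g n = (\<Prod>h=1..n. \<Prod>t=1..n. g (real t - real h) / sin (2 * (real n + real t - real h) * z))"

lemma c4_square: "4 ^ n * (c4 n)\<^sup>2 = 4 ^ (n\<^sup>2)"
proof (induction n)
  case (Suc n)
  have "4 ^ Suc n * (c4 (Suc n))\<^sup>2 = 4 ^ n * (c4 n)\<^sup>2 * (4 * (4 ^ n * 4 ^ n))"
    by (simp add: c4_def power2_eq_square)
  also have "\<dots> = 4 ^ (n\<^sup>2 + (1 + (n + n)))" unfolding Suc power_add by simp
  also have "n\<^sup>2 + (1 + (n + n)) = (Suc n)\<^sup>2" by (simp add: power2_eq_square)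
  finally show ?case .
qed (simp add: c4_def)

text \<open>Reversing \<open>h\<close> makes the denominators free of \<open>n\<close>, so that
  passing from \<open>n\<close> to \<open>n + 1\<close> adds one row and one column; the inductions
  below rest on this.\<close>

lemma square_quot_eq:
  "square_quot z g n = (\<Prod>h=1..n. \<Prod>t=1..n. g (real t - real h)) / (\<Prod>h=1..n. \<Prod>t=1..n. sin (2 * (real t + real h - 1) * z))"
proof -
  have "(\<Prod>h=1..n. \<Prod>t=1..n. sin (2 * (real n + real t - real h) * z)) =
    (\<Prod>h=1..n. \<Prod>t=1..n. sin (2 * (real n + real t - real (Suc n - h)) * z))"
    by (rule prod_reverse)
  also have "\<dots> = (\<Prod>h=1..n. \<Prod>t=1..n. sin (2 * (real t + real h - 1) * z))"
    by (intro prod.cong refl arg_cong[where f = sin]) (auto simp: of_nat_diff)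
  finally show ?thesis by (simp add: square_quot_def prod_dividef)
qed

text \<open>Exchanging \<open>h\<close> and \<open>t\<close> negates the argument of
  \<open>g\<close> and fixes the denominator.\<close>

lemma square_quot_reflect: "square_quot z (\<lambda>x. g (- x)) n = square_quot z g n"
proof -
  have "(\<Prod>h=1..n. \<Prod>t=1..n. g (- (real t - real h))) = (\<Prod>h=1..n. \<Prod>t=1..n. g (real t - real h))"
    by (subst prod.swap) simp
  then show ?thesis by (simp add: square_quot_eq)
qed

text \<open>The new row and column pair up to \<open>g k * g (- k)\<close> over equal denominators;
  the corner supplies \<open>g 0\<close> and the last sine.\<close>

lemma square_quot_Suc:
  "square_quot z g (Suc n) = square_quot z g n *
    (g 0 * (\<Prod>k=1..n. g (real k) * g (- real k)) /
     ((\<Prod>v=1..n. sin (2 * real (n + v) * z))\<^sup>2 * sin (2 * real (2 * n + 1) * z)))"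
proof -
  have 1: "(\<Prod>h=1..n. g (real (Suc n) - real h)) = (\<Prod>k=1..n. g (real k))"
    by (subst prod_reverse) (intro prod.cong refl arg_cong[where f = g], auto simp: of_nat_diff)
  have 2: "(\<Prod>t=1..n. g (real t - real (Suc n))) = (\<Prod>k=1..n. g (- real k))"
    by (subst prod_reverse) (intro prod.cong refl arg_cong[where f = g], auto simp: of_nat_diff)
  have 3: "(\<Prod>h=1..n. sin (2 * (real (Suc n) + real h - 1) * z)) = (\<Prod>v=1..n. sin (2 * real (n + v) * z))"
    "(\<Prod>t=1..n. sin (2 * (real t + real (Suc n) - 1) * z)) = (\<Prod>v=1..n. sin (2 * real (n + v) * z))"
    "sin (2 * (real (Suc n) + real (Suc n) - 1) * z) = sin (2 * real (2 * n + 1) * z)"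
    by (simp_all add: algebra_simps)
  show ?thesis
    unfolding square_quot_eq prod_square_Suc 1 2 3 by (simp add: prod.distrib power2_eq_square ac_simps)
qed

lemma sin_double_mult: "sin (2 * x) = 2 * sin x * cos x" for x :: real
  by (simp add: sin_double)

text \<open>Induction on \<open>n\<close>. The new factors on both sides are compared through the
  product of \<open>sin (2 * v * z)\<close> for \<open>v = 1..2 * n\<close>, read once as lower half
  \<open>X\<close> times upper half \<open>Y\<close> and once by parity of \<open>v\<close>, where
  the double angle formula rewrites the even part as \<open>2 ^ n * X * C\<close>.\<close>

lemma prod_sin_quot_eq:
  assumes "\<And>v. 1 \<le> v \<Longrightarrow> v \<le> 2 * n - 1 \<Longrightarrow> sin (2 * real v * z) \<noteq> 0"
  shows "(\<Prod>j=1..n. \<Prod>l=1..j-1. sin (4 * real l * z) / sin ((4 * real l - 2) * z)) =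
    c4 n * e0 z n * square_quot z (\<lambda>x. cos (2 * x * z)) n"
  using assms
proof (induction n)
  case 0
  show ?case by (simp add: c4_def e0_def square_quot_def)
next
  case (Suc n)
  let ?s = "\<lambda>v. sin (2 * real v * z)" and ?c = "\<lambda>v. cos (2 * real v * z)"
  have nz: "?s v \<noteq> 0" if "1 \<le> v" "v \<le> 2 * n + 1" for v using Suc.prems[of v] that by simp
  define X Y C T where "X = (\<Prod>v=1..n. ?s v)" and "Y = (\<Prod>v=1..n. ?s (n + v))"
    and "C = (\<Prod>v=1..n. ?c v)" and "T = ?s (2 * n + 1)"
  have shift: "(\<Prod>v=1..2*n. ?s v) = X * Y" unfolding X_def Y_def by (rule prod_shift_split)
  have nz': "X \<noteq> 0" "Y \<noteq> 0" "T \<noteq> 0" unfolding X_def Y_def T_def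
    by (simp_all add: nz del: of_nat_add of_nat_mult of_nat_Suc of_nat_numeral)
  have E: "(\<Prod>l=1..n. sin (4 * real l * z)) = 2 ^ n * X * C"
  proof -
    have "(\<Prod>l=1..n. sin (4 * real l * z)) = (\<Prod>l=1..n. 2 * ?s l * ?c l)"
    proof (rule prod.cong[OF refl])
      fix l show "sin (4 * real l * z) = 2 * ?s l * ?c l"
        using sin_double_mult[of "2 * real l * z"] by (simp add: mult.assoc)
    qed
    then show ?thesis by (simp add: X_def C_def prod.distrib)
  qed
  have XY: "X * Y = (\<Prod>l=1..n. sin ((4 * real l - 2) * z)) * (\<Prod>l=1..n. sin (4 * real l * z))"
  proof -
    have "X * Y = (\<Prod>l=1..n. ?s (2 * l - 1) * ?s (2 * l))"
      unfolding shift[symmetric] by (rule prod_two_steps)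
    also have "\<dots> = (\<Prod>l=1..n. sin ((4 * real l - 2) * z) * sin (4 * real l * z))"
    proof (rule prod.cong[OF refl])
      fix l assume "l \<in> {1..n}"
      then have "2 * real (2 * l - 1) = 4 * real l - 2" "2 * real (2 * l) = 4 * real l" by auto
      then show "?s (2 * l - 1) * ?s (2 * l) = sin ((4 * real l - 2) * z) * sin (4 * real l * z)"
        by (simp only:)
    qed
    finally show ?thesis by (simp only: prod.distrib)
  qed
  define R where "R = (\<Prod>l=1..n. sin ((4 * real l - 2) * z))"
  have XY': "X * Y = R * (2 ^ n * X * C)" unfolding R_def using XY E by simp
  have R0: "R \<noteq> 0" and C0: "C \<noteq> 0" using XY' nz' by auto
  have P: "(\<Prod>l=1..n. sin (4 * real l * z) / sin ((4 * real l - 2) * z)) = 2 ^ n * X * C / R"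
    by (simp only: prod_dividef E R_def)
  have e: "e0 z (Suc n) = e0 z n * (X * Y * T)"
  proof -
    have "2 * Suc n - 1 = Suc (2 * n)" by simp
    then have "(\<Prod>v=1..2 * Suc n - 1. ?s v) = X * Y * T"
      by (simp only: prod.cl_ivl_Suc shift) (simp add: T_def)
    then show ?thesis unfolding e0_def by (subst prod.cl_ivl_Suc) (simp only:, simp)
  qed
  have q: "square_quot z (\<lambda>x. cos (2 * x * z)) (Suc n) =
      square_quot z (\<lambda>x. cos (2 * x * z)) n * (C\<^sup>2 / (Y\<^sup>2 * T))"
    unfolding square_quot_Suc by (simp add: C_def Y_def T_def power2_eq_square prod.distrib)
  have c: "c4 (Suc n) = c4 n * 4 ^ n" by (simp add: c4_def)
  have IH: "(\<Prod>j=1..n. \<Prod>l=1..j-1. sin (4 * real l * z) / sin ((4 * real l - 2) * z)) =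
    c4 n * e0 z n * square_quot z (\<lambda>x. cos (2 * x * z)) n"
    using Suc.prems by (intro Suc.IH) auto
  have "(4::real) ^ n = 2 ^ n * 2 ^ n" by (simp flip: power_mult_distrib)
  have key: "2 ^ n * X * C / R = 4 ^ n * (X * Y * T) * (C\<^sup>2 / (Y\<^sup>2 * T))"
  proof -
    have "Y = R * (2 ^ n * C)" using XY' nz' by (simp add: ac_simps)
    then show ?thesis using nz' R0 C0 \<open>(4::real) ^ n = 2 ^ n * 2 ^ n\<close>
      by (simp add: field_simps power2_eq_square)
  qed
  have "(\<Prod>j=1..Suc n. \<Prod>l=1..j-1. sin (4 * real l * z) / sin ((4 * real l - 2) * z)) =
      c4 n * e0 z n * square_quot z (\<lambda>x. cos (2 * x * z)) n * (2 ^ n * X * C / R)"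
    using IH P by simp
  also have "\<dots> = c4 (Suc n) * e0 z (Suc n) * square_quot z (\<lambda>x. cos (2 * x * z)) (Suc n)"
    unfolding key e q c by (simp only: ac_simps)
  finally show ?case .
qed

text \<open>As for the sines, but every factor \<open>sin (2 * v * z)\<close> is itself split by the
  double angle formula, because the left side contains odd multiples of \<open>z\<close>. Sorting by
  parity of \<open>v\<close> then gives \<open>X\<close>, \<open>Ce\<close>, \<open>So\<close> and
  \<open>Co\<close>.\<close>

lemma prod_tan_quot_eq:
  assumes "\<And>v. 1 \<le> v \<Longrightarrow> v \<le> 2 * n - 1 \<Longrightarrow> sin (2 * real v * z) \<noteq> 0"
  shows "(\<Prod>j=1..n. \<Prod>l=1..j-1. tan (2 * real l * z) / tan ((2 * real l - 1) * z)) =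
    2 ^ n * c4 n * e1 z n * square_quot z (\<lambda>x. cos ((2 * x - 1) * z)) n"
  using assms
proof (induction n)
  case 0
  show ?case by (simp add: c4_def e1_def square_quot_def)
next
  case (Suc n)
  let ?s = "\<lambda>v. sin (2 * real v * z)"
  have nz: "?s v \<noteq> 0" if "1 \<le> v" "v \<le> 2 * n + 1" for v using Suc.prems[of v] that by simp
  define X Y where "X = (\<Prod>v=1..n. ?s v)" and "Y = (\<Prod>v=1..n. ?s (n + v))"
  define Ce So Co where "Ce = (\<Prod>l=1..n. cos (2 * real l * z))"
    and "So = (\<Prod>l=1..n. sin ((2 * real l - 1) * z))" and "Co = (\<Prod>l=1..n. cos ((2 * real l - 1) * z))"
  define s' c' where "s' = sin ((2 * real n + 1) * z)" and "c' = cos ((2 * real n + 1) * z)"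
  have T: "?s (2 * n + 1) = 2 * s' * c'"
    unfolding s'_def c'_def by (subst sin_double_mult[symmetric]) (simp add: algebra_simps)
  have shift: "(\<Prod>v=1..2*n. ?s v) = X * Y" unfolding X_def Y_def by (rule prod_shift_split)
  have nz': "X \<noteq> 0" "Y \<noteq> 0" "s' \<noteq> 0" "c' \<noteq> 0"
  proof -
    show "X \<noteq> 0" "Y \<noteq> 0" unfolding X_def Y_def
      by (simp_all add: nz del: of_nat_add of_nat_mult of_nat_Suc of_nat_numeral)
    show "s' \<noteq> 0" "c' \<noteq> 0" using nz[of "2 * n + 1"] unfolding T by simp_all
  qed
  have XY: "X * Y = 4 ^ n * (X * Ce * So * Co)"
  proof -
    have "X * Y = (\<Prod>v=1..2*n. ?s v)" by (rule shift[symmetric])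
    also have "\<dots> = (\<Prod>v=1..2*n. 2 * sin (real v * z) * cos (real v * z))"
      using sin_double_mult by (intro prod.cong refl) (metis mult.assoc)
    also have "\<dots> = (\<Prod>l=1..n. 4 * (?s l * cos (2 * real l * z) * sin ((2 * real l - 1) * z) * cos ((2 * real l - 1) * z)))"
      unfolding prod_two_steps by (intro prod.cong refl) (simp add: of_nat_diff ac_simps)
    finally show ?thesis by (simp add: prod.distrib X_def Ce_def So_def Co_def)
  qed
  then have Y: "Y = 4 ^ n * (Ce * So * Co)" using nz' by (simp add: ac_simps)
  with nz' have nz2: "Ce \<noteq> 0" "So \<noteq> 0" "Co \<noteq> 0" by auto
  have P: "(\<Prod>l=1..n. tan (2 * real l * z) / tan ((2 * real l - 1) * z)) = (X * Co) / (Ce * So)"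
    unfolding tan_def prod_dividef X_def Co_def Ce_def So_def by simp
  have e: "e1 z (Suc n) = e1 z n * (X * Y * s')"
  proof -
    have "(\<Prod>v=1..2 * Suc n - 2. ?s v) = X * Y"
      using shift by simp
    then show ?thesis by (simp add: e1_def s'_def algebra_simps)
  qed
  have g: "cos ((2 * 0 - 1) * z) * (\<Prod>k=1..n. cos ((2 * real k - 1) * z) * cos ((2 * - real k - 1) * z)) = Co\<^sup>2 * c'"
    unfolding Co_def c'_def
  proof (induction n)
    case (Suc n)
    have "cos ((2 * - real (Suc n) - 1) * z) = cos ((2 * real (Suc n) + 1) * z)"
      using cos_minus[of "(2 * real (Suc n) + 1) * z"] by (simp add: algebra_simps)
    with Suc show ?case by (simp add: power2_eq_square algebra_simps)
  qed simp
  have q: "square_quot z (\<lambda>x. cos ((2 * x - 1) * z)) (Suc n) =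
      square_quot z (\<lambda>x. cos ((2 * x - 1) * z)) n * (Co\<^sup>2 * c' / (Y\<^sup>2 * (2 * s' * c')))"
    unfolding square_quot_Suc g T Y_def ..
  have c: "c4 (Suc n) = c4 n * 4 ^ n" by (simp add: c4_def)
  have IH: "(\<Prod>j=1..n. \<Prod>l=1..j-1. tan (2 * real l * z) / tan ((2 * real l - 1) * z)) =
    2 ^ n * c4 n * e1 z n * square_quot z (\<lambda>x. cos ((2 * x - 1) * z)) n"
    using Suc.prems by (intro Suc.IH) auto
  have key: "(X * Co) / (Ce * So) = 2 * 4 ^ n * (X * Y * s') * (Co\<^sup>2 * c' / (Y\<^sup>2 * (2 * s' * c')))"
    using nz' nz2 by (simp add: Y field_simps power2_eq_square)
  have "(\<Prod>j=1..Suc n. \<Prod>l=1..j-1. tan (2 * real l * z) / tan ((2 * real l - 1) * z)) =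
      2 ^ n * c4 n * e1 z n * square_quot z (\<lambda>x. cos ((2 * x - 1) * z)) n * ((X * Co) / (Ce * So))"
    using IH P by simp
  also have "\<dots> = 2 ^ Suc n * c4 (Suc n) * e1 z (Suc n) * square_quot z (\<lambda>x. cos ((2 * x - 1) * z)) (Suc n)"
    unfolding key e q c power_Suc by (simp only: ac_simps)
  finally show ?case .
qed

text \<open>For each \<open>j\<close> the two products differ only in the last factor,
  \<open>sin (2 * y)\<close> against \<open>sin y\<close> with
  \<open>y = (2 * j - 1) * z\<close>.\<close>

lemma e0_e1: "e0 z n = e1 z n * (\<Prod>j=1..n. 2 * cos ((2 * real j - 1) * z))"
  unfolding e0_def e1_def prod.distrib[symmetric]
proof (rule prod.cong[OF refl])
  fix j assume "j \<in> {1..n}"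
  then have j: "2 * j - 1 = Suc (2 * j - 2)" "real (Suc (2 * j - 2)) = 2 * real j - 1" by auto
  have "sin (2 * (2 * real j - 1) * z) = 2 * sin ((2 * real j - 1) * z) * cos ((2 * real j - 1) * z)"
    using sin_double_mult[of "(2 * real j - 1) * z"] by (simp only: mult.assoc)
  then show "(\<Prod>v=1..2*j-1. sin (2 * real v * z)) =
    (\<Prod>v=1..2*j-2. sin (2 * real v * z)) * sin ((2 * real j - 1) * z) * (2 * cos ((2 * real j - 1) * z))"
    unfolding j(1) by (simp only: prod.nat_ivl_Suc' j(2)) simp
qed

lemma prod_centered:
  fixes f :: "real \<Rightarrow> 'a::comm_monoid_mult"
  shows "(\<Prod>h=1..2*n. f (real h - real n)) = (\<Prod>j=1..n. f (real j) * f (1 - real j))"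
proof -
  have "(\<Prod>h=1..n. f (real h - real n)) = (\<Prod>j=1..n. f (1 - real j))"
    by (subst prod_reverse) (intro prod.cong refl arg_cong[where f = f], auto simp: of_nat_diff)
  moreover have "(\<Prod>h=1..2*n. f (real h - real n)) = (\<Prod>h=1..n. f (real h - real n)) * (\<Prod>j=1..n. f (real j))"
    unfolding prod_shift_split by simp
  ultimately show ?thesis by (simp add: prod.distrib ac_simps)
qed

text \<open>The numbers \<open>4 * l - 1 - 2 * n\<close> are the odd numbers up to
  \<open>2 * n - 1\<close> in absolute value, each once, with alternating signs. Reversing
  \<open>l\<close> and negating leads from \<open>n\<close> to \<open>n + 1\<close>.\<close>

lemma prod_alternating:
  fixes f :: "real \<Rightarrow> 'a::comm_monoid_mult"
  shows "(\<Prod>l=1..n. f (4 * real l - 1 - 2 * real n)) = (\<Prod>j=1..n. f (alt_sign n * alt_sign j * (2 * real j - 1)))"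
proof (induction n arbitrary: f)
  case (Suc n)
  have "(\<Prod>l=1..n. f (4 * real l - 1 - 2 * real (Suc n))) =
      (\<Prod>l=1..n. (\<lambda>x. f (- x)) (4 * real l - 1 - 2 * real n))"
    by (subst prod_reverse) (intro prod.cong refl arg_cong[where f = f], auto simp: of_nat_diff)
  also have "\<dots> = (\<Prod>j=1..n. f (- (alt_sign n * alt_sign j * (2 * real j - 1))))"
    by (rule Suc.IH)
  also have "\<dots> = (\<Prod>j=1..n. f (alt_sign (Suc n) * alt_sign j * (2 * real j - 1)))"
    by (intro prod.cong refl arg_cong[where f = f]) (simp add: alt_sign_def)
  finally show ?case
    using alt_sign_cases[of "Suc n"] by (auto simp: algebra_simps)
qed simp

lemma tan_quarter_plus: "tan (pi/4 + y) = (1 + sin (2 * y)) / cos (2 * y)"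
proof -
  have q: "sin (pi/4) = cos (pi/4)" "cos (pi/4) \<noteq> 0" by (simp_all add: sin_45 cos_45)
  have "tan (pi/4 + y) = (cos (pi/4) * (cos y + sin y)) / (cos (pi/4) * (cos y - sin y))"
    unfolding tan_def sin_add cos_add q(1) by (simp add: algebra_simps)
  also have "\<dots> = (cos y + sin y) / (cos y - sin y)"
    using q(2) by simp
  also have "\<dots> = ((cos y + sin y) * (cos y + sin y)) / ((cos y - sin y) * (cos y + sin y))"
    \<comment> \<open>If \<open>cos y + sin y\<close> is 0, both fractions have the value 0.\<close>
    by (cases "cos y + sin y = 0") simp_all
  also have "(cos y + sin y) * (cos y + sin y) = 1 + sin (2 * y)"
    unfolding sin_double using sin_cos_squared_add[of y] by (simp add: power2_eq_square algebra_simps)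
  also have "(cos y - sin y) * (cos y + sin y) = cos (2 * y)"
    unfolding cos_double by (simp add: power2_eq_square algebra_simps)
  finally show ?thesis .
qed

lemma sin_quarter_mult: "sin (pi/4 + y) * sin (pi/4 - y) = cos (2 * y) / 2"
  using cos_diff[of "pi/4 + y" "pi/4 - y"] cos_add[of "pi/4 + y" "pi/4 - y"] by simp

lemma sin_quarter_add: "sin (pi/4) * (sin (pi/4 + y) + sin (pi/4 - y)) = cos y"
  unfolding sin_add sin_diff sin_45 cos_45 by (simp add: field_simps)

section \<open>The Pfaffians in terms of A and U\<close>

context frequencies
begin

definition "z = pi / (4 * m)"

lemma z_pos: "z > 0"
  using m_pos by (simp add: z_def)

lemma freq_z: "freq i = (2 * real i - 1) * z" and sfreq_z: "sfreq i = alt_sign i * ((2 * real i - 1) * z)"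
  by (simp_all add: freq_def sfreq_def z_def)

text \<open>The double product of \<open>A_factor\<close>, that is \<open>square_quot\<close>
  without its last row \<open>h = n\<close>.\<close>

definition rect_quot :: "(real \<Rightarrow> real) \<Rightarrow> real" where
  "rect_quot g = (\<Prod>h=1..n-1. \<Prod>t=1..n. g (real t - real h) / sin (2 * (real n + real t - real h) * z))"

definition sin_odd where "sin_odd = (\<Prod>l=1..n. sin ((2 * real l - 1) * z))"
definition sin_even where "sin_even = (\<Prod>l=1..n. sin (2 * real l * z))"
definition cos_odd where "cos_odd = (\<Prod>l=1..n. cos ((2 * real l - 1) * z))"

lemma angle_eqs: "pi * x / (4 * m) = x * z" "pi * x / (2 * m) = 2 * x * z"
  using m_pos by (simp_all add: z_def field_simps)

lemma sin_z_pos: "0 < x \<Longrightarrow> x < 4 * m \<Longrightarrow> sin (x * z) > 0"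
proof -
  assume x: "0 < x" "x < 4 * m"
  have "x * z = x / (4 * m) * pi" by (simp add: z_def)
  also have "\<dots> < 1 * pi" using x m_pos by (intro mult_strict_right_mono) auto
  finally show ?thesis using x z_pos by (intro sin_gt_zero) auto
qed

lemma sin_2z_nonzero: "1 \<le> v \<Longrightarrow> v \<le> 2 * n - 1 \<Longrightarrow> sin (2 * real v * z) \<noteq> 0"
proof -
  assume v: "1 \<le> v" "v \<le> 2 * n - 1"
  then have "real v \<le> 2 * real n - 1" by linarith
  then show ?thesis using v nm sin_z_pos[of "2 * real v"] by simp
qed

lemma products_pos: "sin_odd > 0" "sin_even > 0" "cos_odd > 0"
proof -
  show "sin_odd > 0"
    unfolding sin_odd_def using nm m_pos by (intro prod_pos sin_z_pos ballI) auto
  show "sin_even > 0"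
    unfolding sin_even_def using nm m_pos n by (intro prod_pos sin_z_pos ballI) auto
  show "cos_odd > 0"
    unfolding cos_odd_def using cos_freq_pos by (intro prod_pos) (auto simp: freq_z)
qed

lemma prod_sin_all: "(\<Prod>h=1..2*n. sin (real h * z)) = sin_odd * sin_even"
  unfolding prod_two_steps sin_odd_def sin_even_def prod.distrib[symmetric]
  by (intro prod.cong refl) (auto simp: of_nat_diff)

lemma square_rect_quot:
  "square_quot z g n = rect_quot g * ((\<Prod>t=1..n. g (real t - real n)) / sin_even)"
proof -
  have "{1..n} = insert n {1..n-1}" using n by auto
  then have "square_quot z g n = (\<Prod>t=1..n. g (real t - real n) / sin (2 * (real n + real t - real n) * z)) * rect_quot g"
    unfolding square_quot_def rect_quot_def using n by (subst (2) \<open>{1..n} = _\<close>) (subst prod.insert, auto)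
  then show ?thesis by (simp add: sin_even_def prod_dividef)
qed

lemma A_factor_eq:
  "A_factor n m c = (\<Prod>h=1..2*n. sin ((c + (real h - real n)) * z)) / (sin_odd * sin_even) *
    rect_quot (\<lambda>x. sin (2 * (c + x) * z))"
proof -
  have 1: "(\<Prod>h=1..2*n. sin (pi * (c - real n + real h) / (4 * m)) / sin (pi * real h / (4 * m))) =
    (\<Prod>h=1..2*n. sin ((c + (real h - real n)) * z)) / (sin_odd * sin_even)"
    unfolding prod_dividef angle_eqs prod_sin_all by (simp add: algebra_simps)
  have 2: "(\<Prod>h=1..n-1. \<Prod>t=1..n. sin (pi * (c + real t - real h) / (2 * m)) /
        sin (pi * (real n + real t - real h) / (2 * m))) = rect_quot (\<lambda>x. sin (2 * (c + x) * z))"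
    unfolding rect_quot_def angle_eqs by (simp only: add_diff_eq)
  show ?thesis unfolding A_factor_def 1 2 ..
qed

text \<open>Of the \<open>2 * n\<close> sines those with even \<open>h\<close> cancel against the
  denominators of the third product; those with odd \<open>h\<close> and the cosines there form
  tangents. The bounds on \<open>c\<close> keep the cancelled sines positive.\<close>

lemma U_factor_eq:
  assumes c: "real n - 1 \<le> c" "c + real n < 4 * m"
  shows "U_factor n m c = square_quot z (\<lambda>x. sin (2 * (c + x) * z)) n * (cos_odd / sin_odd) *
    (\<Prod>l=1..n. tan ((c + (2 * real l - 1 - real n)) * z))"
proof -
  define X Y C where "X = (\<Prod>l=1..n. sin ((c + (2 * real l - 1 - real n)) * z))"
    and "Y = (\<Prod>l=1..n. sin ((c + (2 * real l - real n)) * z))"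
    and "C = (\<Prod>l=1..n. cos ((c + (2 * real l - 1 - real n)) * z))"
  have 1: "(\<Prod>h=1..2*n. sin (pi * (c - real n + real h) / (4 * m)) / sin (pi * real h / (4 * m))) =
    X * Y / (sin_odd * sin_even)"
  proof -
    have "(\<Prod>h=1..2*n. sin ((c - real n + real h) * z)) = X * Y"
      unfolding prod_two_steps X_def Y_def prod.distrib[symmetric]
      by (intro prod.cong refl arg_cong2[where f = "(*)"] arg_cong[where f = sin]) (auto simp: of_nat_diff algebra_simps)
    then show ?thesis unfolding prod_dividef angle_eqs prod_sin_all by simp
  qed
  have 2: "(\<Prod>h=1..n. \<Prod>t=1..n. sin (pi * (c + real t - real h) / (2 * m)) /
        sin (pi * (real n + real t - real h) / (2 * m))) = square_quot z (\<lambda>x. sin (2 * (c + x) * z)) n"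
    unfolding square_quot_def angle_eqs by (simp only: add_diff_eq)
  have 3: "(\<Prod>h=1..n. sin (pi * real h / (2 * m)) / sin (pi * (c - real n + 2 * real h) / (4 * m)) *
        (cos (pi * (2 * real h - 1) / (4 * m)) / cos (pi * (c - real n + 2 * real h - 1) / (4 * m)))) =
      sin_even / Y * (cos_odd / C)"
    unfolding prod.distrib prod_dividef angle_eqs Y_def C_def sin_even_def cos_odd_def
    by (simp add: algebra_simps)
  have "Y > 0" unfolding Y_def
    using c by (intro prod_pos sin_z_pos ballI) auto
  have T: "(\<Prod>l=1..n. tan ((c + (2 * real l - 1 - real n)) * z)) = X / C"
    by (simp only: tan_def prod_dividef X_def C_def)
  show ?thesis
    unfolding U_factor_def 1 2 3 T using products_pos \<open>Y > 0\<close> by simp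
qed

lemma mz: "m * z = pi / 4"
  using m_pos by (simp add: z_def)

text \<open>As \<open>m * z = pi/4\<close>, the sines become \<open>f x\<close> with
  \<open>f x * f (- x) = cos (2 * x * z) / 2\<close>. Their arguments run through
  \<open>1 - n..n\<close> for \<open>A_factor n m m\<close> and through \<open>- n..n - 1\<close>
  for the other factor. Everything but \<open>f n\<close> and \<open>f (- n)\<close> is common, and
  the sum of these two is \<open>cos (n * z)\<close> divided by \<open>f 0\<close>.\<close>

lemma A_factor_sum:
  "A_factor n m m + A_factor n m (m - 1) =
    cos (real n * z) * (\<Prod>j=1..n-1. cos (2 * real j * z) / 2) / (sin_odd * sin_even) *
    rect_quot (\<lambda>x. cos (2 * x * z))"
proof -
  define f where "f x = sin (pi/4 + x * z)" for x
  have fm: "f x * f (- x) = cos (2 * x * z) / 2" for x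
    using sin_quarter_mult[of "x * z"] by (simp add: f_def ac_simps)
  have 1: "(\<Prod>h=1..2*n. sin ((m + (real h - real n)) * z)) = (\<Prod>j=1..n. f (real j) * f (1 - real j))"
  proof -
    have "sin ((m + x) * z) = f x" for x by (simp add: f_def distrib_right mz)
    then show ?thesis using prod_centered[of f n] by simp
  qed
  have 2: "(\<Prod>h=1..2*n. sin ((m - 1 + (real h - real n)) * z)) = (\<Prod>j=1..n. f (real j - 1) * f (- real j))"
  proof -
    have "sin ((m - 1 + x) * z) = f (x - 1)" for x
    proof -
      have "(m - 1 + x) * z = m * z + (x - 1) * z" by (simp only: distrib_right[symmetric]) (simp add: algebra_simps)
      then show ?thesis by (simp only: f_def mz)
    qed
    then show ?thesis using prod_centered[of "\<lambda>x. f (x - 1)" n] by simp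
  qed
  have N: "n = Suc (n - 1)" using n by simp
  have sh: "(\<Prod>j=1..n. g (real j - 1)) = g 0 * (\<Prod>j=1..n-1. g (real j))" for g :: "real \<Rightarrow> real"
  proof -
    have "(\<Prod>j=1..Suc k. g (real j - 1)) = g 0 * (\<Prod>j=1..k. g (real j))" for k
      by (induction k) (simp_all add: ac_simps)
    then show ?thesis by (metis N)
  qed
  have la: "(\<Prod>j=1..n. g (real j)) = (\<Prod>j=1..n-1. g (real j)) * g (real n)" for g :: "real \<Rightarrow> real"
  proof -
    have "(\<Prod>j=1..Suc k. g (real j)) = (\<Prod>j=1..k. g (real j)) * g (real (Suc k))" for k
      by simp
    then show ?thesis by (metis N)
  qed
  define V where "V = (\<Prod>j=1..n-1. f (real j)) * (\<Prod>j=1..n-1. f (- real j))"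
  have V: "V = (\<Prod>j=1..n-1. cos (2 * real j * z) / 2)"
    unfolding V_def prod.distrib[symmetric] fm ..
  have p1: "(\<Prod>j=1..n. f (real j) * f (1 - real j)) = f 0 * f (real n) * V"
    using sh[of "\<lambda>x. f (- x)"] la[of f] by (simp add: prod.distrib V_def ac_simps)
  have p2: "(\<Prod>j=1..n. f (real j - 1) * f (- real j)) = f 0 * f (- real n) * V"
    using sh[of f] la[of "\<lambda>x. f (- x)"] by (simp add: prod.distrib V_def ac_simps)
  have r1: "rect_quot (\<lambda>x. sin (2 * (m + x) * z)) = rect_quot (\<lambda>x. cos (2 * x * z))"
  proof -
    have "sin (2 * (m + x) * z) = cos (2 * x * z)" for x
    proof -
      have "2 * (m + x) * z = 2 * (m * z) + 2 * x * z" by (simp add: algebra_simps)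
      then show ?thesis unfolding mz by (simp add: sin_add)
    qed
    then show ?thesis by (simp only:)
  qed
  have r2: "rect_quot (\<lambda>x. sin (2 * (m - 1 + x) * z)) = rect_quot (\<lambda>x. cos (2 * x * z))"
  proof -
    have *: "sin (2 * (m - 1 + x) * z) = cos (2 * (x - 1) * z)" for x
    proof -
      have "2 * (m - 1 + x) * z = 2 * (m * z) + 2 * (x - 1) * z"
        by (simp add: algebra_simps)
      then show ?thesis unfolding mz by (simp add: sin_add)
    qed
    \<comment> \<open>Reversing both index ranges, of lengths \<open>n - 1\<close> and
      \<open>n\<close>, turns \<open>t - h - 1\<close> into \<open>h - t\<close>, and the cosine is
      even.\<close>
    have "(\<Prod>h=1..n-1. \<Prod>t=1..n. cos (2 * (real t - real h - 1) * z)) =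
      (\<Prod>h=1..n-1. \<Prod>t=1..n. cos (2 * (real (Suc n - t) - real (Suc (n - 1) - h) - 1) * z))"
      by (subst prod_reverse, subst (2) prod_reverse) (rule refl)
    also have "\<dots> = (\<Prod>h=1..n-1. \<Prod>t=1..n. cos (2 * (real t - real h) * z))"
    proof (intro prod.cong refl)
      fix h t assume "h \<in> {1..n-1}" "t \<in> {1..n}"
      then have "real (Suc n - t) - real (Suc (n - 1) - h) - 1 = - (real t - real h)"
        using N by (auto simp: of_nat_diff)
      then have "2 * (real (Suc n - t) - real (Suc (n - 1) - h) - 1) * z = - (2 * (real t - real h) * z)"
        by (simp only: mult_minus_left mult_minus_right)
      then show "cos (2 * (real (Suc n - t) - real (Suc (n - 1) - h) - 1) * z) = cos (2 * (real t - real h) * z)"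
        by (simp only: cos_minus)
    qed
    finally show ?thesis by (simp only: rect_quot_def * prod_dividef)
  qed
  have "f 0 * (f (real n) + f (- real n)) = cos (real n * z)"
    using sin_quarter_add[of "real n * z"] by (simp add: f_def)
  then have "f 0 * f (real n) * V + f 0 * f (- real n) * V = cos (real n * z) * V"
    by (simp only: distrib_right[symmetric] distrib_left[symmetric])
  then show ?thesis
    unfolding A_factor_eq 1 2 r1 r2 p1 p2 V[symmetric]
    by (simp only: distrib_right[symmetric] add_divide_distrib[symmetric])
qed

lemma prod_cot_eq: "(\<Prod>j=1..n. \<Prod>l=1..j-1. sin (4 * real l * z) / sin ((4 * real l - 2) * z)) =
    c4 n * e0 z n * square_quot z (\<lambda>x. cos (2 * x * z)) n"
  by (rule prod_sin_quot_eq) (rule sin_2z_nonzero)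

lemma prod_csc_eq: "(\<Prod>j=1..n. \<Prod>l=1..j-1. tan (2 * real l * z) / tan ((2 * real l - 1) * z)) =
    2 ^ n * c4 n * e1 z n * square_quot z (\<lambda>x. cos ((2 * x - 1) * z)) n"
  by (rule prod_tan_quot_eq) (rule sin_2z_nonzero)

lemma prod_half_csc: "(\<Prod>i=1..n. 1 / (2 * sin (freq i))) = 1 / (2 ^ n * sin_odd)"
  by (simp add: prod_dividef prod.distrib sin_odd_def freq_z)

text \<open>In this name and the three like it the first word is the type of the points, the second
  that of \<open>m\<close>. The row \<open>h = n\<close> by which \<open>square_quot\<close> and
  \<open>rect_quot\<close> differ supplies the cosines in \<open>A_factor_sum\<close>.\<close>

lemma sorted_sum_int_int:
  assumes "d = 1" "e = 1/2"
  shows "sorted_sum D mode {1..n} = c4 n * e0 z n * (A_factor n m m + A_factor n m (m - 1)) / 2"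
proof -
  have N: "n = Suc (n - 1)" using n by simp
  have p: "(\<Prod>t=1..n. cos (2 * (real t - real n) * z)) = (\<Prod>j=1..n-1. cos (2 * real j * z))"
  proof -
    have "(\<Prod>t=1..n. cos (2 * (real t - real n) * z)) = (\<Prod>t=1..n. cos (2 * (real t - 1) * z))"
    proof (subst prod_reverse, intro prod.cong refl)
      fix t assume "t \<in> {1..n}"
      then have "real (Suc n - t) - real n = - (real t - 1)" by (auto simp: of_nat_diff)
      then have "2 * (real (Suc n - t) - real n) * z = - (2 * (real t - 1) * z)"
        by (simp only: mult_minus_left mult_minus_right)
      then show "cos (2 * (real (Suc n - t) - real n) * z) = cos (2 * (real t - 1) * z)" by (simp only: cos_minus)
    qed
    also have "(\<Prod>t=1..Suc k. cos (2 * (real t - 1) * z)) = (\<Prod>j=1..k. cos (2 * real j * z))" for k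
      by (induction k) simp_all
    from this[of "n - 1"] N have "(\<Prod>t=1..n. cos (2 * (real t - 1) * z)) = (\<Prod>j=1..n-1. cos (2 * real j * z))"
      by metis
    finally show ?thesis .
  qed
  have "(\<Prod>j=1..n-1. cos (2 * real j * z) / 2) = (\<Prod>j=1..n-1. cos (2 * real j * z)) / 2 ^ (n - 1)"
    by (simp add: prod_dividef)
  moreover have "(2::real) ^ n = 2 * 2 ^ (n - 1)" by (subst N) simp
  ultimately show ?thesis
    unfolding sorted_sum_mode_cot_cot[OF assms, folded z_def] prod_cot_eq prod_half_csc A_factor_sum square_rect_quot p
    by (simp add: ac_simps)
qed

text \<open>For \<open>c = m - 1/2\<close> the sines pair up to
  \<open>cos ((2 * j - 1) * z) / 2\<close>, which gives one factor \<open>cos_odd\<close>; the ratio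
  of \<open>e0\<close> to \<open>e1\<close> gives a second one, and the left side has the same
  two.\<close>

lemma sorted_sum_int_half:
  assumes "d = 1" "e = 0"
  shows "sorted_sum D mode {1..n} = c4 n * e0 z n * A_factor n m (m - 1/2)"
proof -
  have p: "(\<Prod>t=1..n. cos ((2 * (real t - real n) - 1) * z)) = cos_odd"
    unfolding cos_odd_def
  proof (subst prod_reverse, intro prod.cong refl)
    fix t assume "t \<in> {1..n}"
    then have "2 * (real (Suc n - t) - real n) - 1 = - (2 * real t - 1)" by (auto simp: of_nat_diff)
    then have "(2 * (real (Suc n - t) - real n) - 1) * z = - ((2 * real t - 1) * z)"
      by (simp only: mult_minus_left)
    then show "cos ((2 * (real (Suc n - t) - real n) - 1) * z) = cos ((2 * real t - 1) * z)"
      by (simp only: cos_minus)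
  qed
  have 1: "(\<Prod>h=1..2*n. sin ((m - 1/2 + (real h - real n)) * z)) = cos_odd / 2 ^ n"
  proof -
    have f: "sin ((m - 1/2 + x) * z) = sin (pi/4 + (x - 1/2) * z)" for x
    proof -
      have "(m - 1/2 + x) * z = m * z + (x - 1/2) * z"
        by (simp only: distrib_right[symmetric]) (simp add: algebra_simps)
      then show ?thesis by (simp only: mz)
    qed
    have "(\<Prod>h=1..2*n. sin ((m - 1/2 + (real h - real n)) * z)) =
        (\<Prod>j=1..n. sin (pi/4 + (real j - 1/2) * z) * sin (pi/4 + (1 - real j - 1/2) * z))"
      unfolding f using prod_centered[of "\<lambda>x. sin (pi/4 + (x - 1/2) * z)" n] .
    also have "\<dots> = (\<Prod>j=1..n. cos ((2 * real j - 1) * z) / 2)"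
    proof (rule prod.cong[OF refl])
      fix j
      have "pi/4 + (1 - real j - 1/2) * z = pi/4 - (real j - 1/2) * z"
        "2 * ((real j - 1/2) * z) = (2 * real j - 1) * z"
        by (simp_all add: algebra_simps)
      then show "sin (pi/4 + (real j - 1/2) * z) * sin (pi/4 + (1 - real j - 1/2) * z) =
          cos ((2 * real j - 1) * z) / 2"
        using sin_quarter_mult[of "(real j - 1/2) * z"] by (simp only:)
    qed
    finally show ?thesis by (simp add: prod_dividef cos_odd_def)
  qed
  have g: "sin (2 * (m - 1/2 + x) * z) = cos ((2 * x - 1) * z)" for x
  proof -
    have "2 * (m - 1/2 + x) = 2 * m + (2 * x - 1)" by simp
    then have "2 * (m - 1/2 + x) * z = 2 * (m * z) + (2 * x - 1) * z"
      by (simp only: distrib_right mult.assoc)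
    then show ?thesis unfolding mz by (simp add: sin_add)
  qed
  have c: "(\<Prod>i=1..n. cos (freq i) / (2 * sin (freq i))) = cos_odd / (2 ^ n * sin_odd)"
    by (simp add: prod_dividef prod.distrib sin_odd_def cos_odd_def freq_z)
  have e: "e0 z n = e1 z n * (2 ^ n * cos_odd)"
    unfolding e0_e1 by (simp add: prod.distrib cos_odd_def)
  show ?thesis
    unfolding sorted_sum_mode_cot_csc[OF assms, folded z_def] prod_csc_eq c A_factor_eq 1 g square_rect_quot p e
    by simp
qed

lemma sin_square_quot: "square_quot z (\<lambda>x. sin (2 * (m + y + x) * z)) n = square_quot z (\<lambda>x. cos (2 * (x + y) * z)) n"
proof -
  have "sin (2 * (m + y + x) * z) = cos (2 * (x + y) * z)" for x
  proof -
    have "2 * (m + y + x) * z = 2 * (m * z) + 2 * (x + y) * z"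
      by (simp add: algebra_simps)
    then show ?thesis unfolding mz by (simp add: sin_add)
  qed
  then show ?thesis by (simp only:)
qed

lemma n_less: "real n < m + 1/2"
  using nm by simp

text \<open>The product of tangents in \<open>U_factor_eq\<close> is 1: reversing \<open>l\<close>
  negates the offset from \<open>pi/4\<close> and inverts every tangent, so the product equals its
  inverse, and it is positive.\<close>

lemma sorted_sum_half_int:
  assumes "d = 1/2" "e = 0"
  shows "sorted_sum D mode {1..n} = c4 n * e1 z n * U_factor n m m"
proof -
  let ?p = "\<Prod>l=1..n. tan ((m + (2 * real l - 1 - real n)) * z)"
  have t: "(m + x) * z = pi/4 + x * z" for x by (simp add: distrib_right mz)
  have inv: "tan (pi/4 + - y) = inverse (tan (pi/4 + y))" if "\<bar>y\<bar> < pi/4" for y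
  proof -
    have "tan (pi/4 + y) = inverse (tan (pi/2 - (pi/4 + y)))"
      unfolding tan_cot[of "pi/4 + y"] by simp
    then show ?thesis by simp
  qed
  have small: "\<bar>(2 * real l - 1 - real n) * z\<bar> < pi/4" if "l \<in> {1..n}" for l
  proof -
    have "\<bar>2 * real l - 1 - real n\<bar> < m" using that n_less by auto
    then have "\<bar>2 * real l - 1 - real n\<bar> * z < m * z" using z_pos by (intro mult_strict_right_mono) auto
    then show ?thesis unfolding mz using z_pos by (simp add: abs_mult)
  qed
  have "?p = (\<Prod>l=1..n. tan ((m + (2 * real (Suc n - l) - 1 - real n)) * z))" by (rule prod_reverse)
  also have "\<dots> = (\<Prod>l=1..n. inverse (tan ((m + (2 * real l - 1 - real n)) * z)))"
  proof (rule prod.cong[OF refl])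
    fix l assume l: "l \<in> {1..n}"
    then have "2 * real (Suc n - l) - 1 - real n = - (2 * real l - 1 - real n)" by (auto simp: of_nat_diff)
    then show "tan ((m + (2 * real (Suc n - l) - 1 - real n)) * z) = inverse (tan ((m + (2 * real l - 1 - real n)) * z))"
      unfolding t using inv[OF small[OF l]] by (simp only: mult_minus_left)
  qed
  finally have "?p = inverse ?p" unfolding prod_inversef[symmetric] by (simp add: o_def)
  moreover have "?p > 0"
  proof (rule prod_pos)
    fix l assume "l \<in> {1..n}"
    from small[OF this] show "tan ((m + (2 * real l - 1 - real n)) * z) > 0"
      unfolding t by (intro tan_gt_zero) auto
  qed
  moreover have "p = 1" if "p = inverse p" "p > 0" for p :: real
  proof -
    have "p * p = 1" using that by (metis less_irrefl right_inverse)
    then have "(p - 1) * (p + 1) = 0" by (simp add: algebra_simps)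
    then show ?thesis using that(2) by auto
  qed
  ultimately have p1: "?p = 1" by blast
  have "e0 z n = e1 z n * (2 ^ n * cos_odd)"
    unfolding e0_e1 by (simp add: prod.distrib cos_odd_def)
  moreover have "square_quot z (\<lambda>x. sin (2 * (m + x) * z)) n = square_quot z (\<lambda>x. cos (2 * x * z)) n"
    using sin_square_quot[of 0] by simp
  moreover have "U_factor n m m = square_quot z (\<lambda>x. sin (2 * (m + x) * z)) n * (cos_odd / sin_odd) * ?p"
    by (rule U_factor_eq) (use n_less m_pos n in auto)
  ultimately show ?thesis
    unfolding sorted_sum_mode_csc_csc[OF assms, folded z_def] prod_cot_eq prod_half_csc p1 by simp
qed

text \<open>The tangents become \<open>(1 + sin y) / cos y\<close>, after reversing \<open>l\<close>
  for \<open>m - 1/2\<close> with a minus sign, and by \<open>prod_alternating\<close> the angles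
  \<open>y\<close> are the \<open>sfreq j\<close> up to a common sign. So the two values of
  \<open>U_factor\<close> are the two products in the symmetrized sum; which is which depends on the
  parity of \<open>n\<close>.\<close>

lemma sorted_sum_half_half:
  assumes "d = 1/2" "e = 1/2"
  shows "sorted_sum D mode {1..n} = c4 n * e1 z n * (U_factor n m (m + 1/2) + U_factor n m (m - 1/2)) / 2"
proof -
  let ?P = "\<Prod>i=1..n. 1 + sin (sfreq i)" and ?M = "\<Prod>i=1..n. 1 - sin (sfreq i)"
  let ?SQ = "square_quot z (\<lambda>x. cos ((2 * x - 1) * z)) n"
  have sq1: "square_quot z (\<lambda>x. sin (2 * (m - 1/2 + x) * z)) n = ?SQ"
  proof -
    have "2 * (x - 1/2) = 2 * x - 1" for x :: real by simp
    then show ?thesis using sin_square_quot[of "-1/2"] by simp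
  qed
  \<comment> \<open>The shift in the opposite direction leads to the same quotient by
    \<open>square_quot_reflect\<close>.\<close>
  have sq2: "square_quot z (\<lambda>x. sin (2 * (m + 1/2 + x) * z)) n = ?SQ"
  proof -
    have "cos (2 * (x + 1/2) * z) = cos ((2 * - x - 1) * z)" for x
    proof -
      have "(2 * - x - 1) * z = - (2 * (x + 1/2) * z)" by (simp add: algebra_simps)
      then show ?thesis by (simp only: cos_minus)
    qed
    then show ?thesis
      using sin_square_quot[of "1/2"] square_quot_reflect[of z "\<lambda>x. cos ((2 * x - 1) * z)" n] by simp
  qed
  define Q where "Q s = (\<Prod>j=1..n. 1 + s * sin (sfreq j))" for s
  have t: "(m + x) * z = pi/4 + x * z" for x by (simp add: distrib_right mz)
  have gen: "(\<Prod>l=1..n. (1 + s * sin ((4 * real l - 1 - 2 * real n) * z)) / cos ((4 * real l - 1 - 2 * real n) * z)) =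
      Q (s * alt_sign n) / cos_odd" for s
  proof -
    have "(\<Prod>l=1..n. (1 + s * sin ((4 * real l - 1 - 2 * real n) * z)) / cos ((4 * real l - 1 - 2 * real n) * z)) =
      (\<Prod>j=1..n. (1 + s * sin (alt_sign n * alt_sign j * (2 * real j - 1) * z)) / cos (alt_sign n * alt_sign j * (2 * real j - 1) * z))"
      by (rule prod_alternating[of "\<lambda>x. (1 + s * sin (x * z)) / cos (x * z)"])
    also have "\<dots> = (\<Prod>j=1..n. (1 + s * alt_sign n * sin (sfreq j)) / cos ((2 * real j - 1) * z))"
    proof (rule prod.cong[OF refl])
      fix j
      have e: "alt_sign n * alt_sign j * (2 * real j - 1) * z = alt_sign n * sfreq j"
        by (simp only: sfreq_z mult.assoc)
      have sc: "sin (alt_sign n * sfreq j) = alt_sign n * sin (sfreq j)" "cos (alt_sign n * sfreq j) = cos (sfreq j)"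
        using alt_sign_cases[of n] by auto
      show "(1 + s * sin (alt_sign n * alt_sign j * (2 * real j - 1) * z)) / cos (alt_sign n * alt_sign j * (2 * real j - 1) * z)
         = (1 + s * alt_sign n * sin (sfreq j)) / cos ((2 * real j - 1) * z)"
        unfolding e sc sin_sfreq(2) freq_z by (simp only: mult.assoc)
    qed
    finally show ?thesis by (simp only: Q_def prod_dividef cos_odd_def)
  qed
  have plus: "(\<Prod>l=1..n. tan ((m + 1/2 + (2 * real l - 1 - real n)) * z)) = Q (alt_sign n) / cos_odd"
  proof -
    have "(\<Prod>l=1..n. tan ((m + 1/2 + (2 * real l - 1 - real n)) * z)) =
      (\<Prod>l=1..n. (1 + 1 * sin ((4 * real l - 1 - 2 * real n) * z)) / cos ((4 * real l - 1 - 2 * real n) * z))"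
    proof (rule prod.cong[OF refl])
      fix l
      have "(m + 1/2 + (2 * real l - 1 - real n)) = m + (2 * real l - 1/2 - real n)" by simp
      moreover have "2 * ((2 * real l - 1/2 - real n) * z) = (4 * real l - 1 - 2 * real n) * z"
        by (simp add: algebra_simps)
      ultimately show "tan ((m + 1/2 + (2 * real l - 1 - real n)) * z) =
        (1 + 1 * sin ((4 * real l - 1 - 2 * real n) * z)) / cos ((4 * real l - 1 - 2 * real n) * z)"
        by (simp only: t tan_quarter_plus mult_1)
    qed
    then show ?thesis unfolding gen by simp
  qed
  have minus: "(\<Prod>l=1..n. tan ((m - 1/2 + (2 * real l - 1 - real n)) * z)) = Q (- alt_sign n) / cos_odd"
  proof -
    have "(\<Prod>l=1..n. tan ((m - 1/2 + (2 * real l - 1 - real n)) * z)) =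
      (\<Prod>l=1..n. tan ((m - 1/2 + (2 * real (Suc n - l) - 1 - real n)) * z))"
      by (rule prod_reverse)
    also have "\<dots> =
      (\<Prod>l=1..n. (1 + (-1) * sin ((4 * real l - 1 - 2 * real n) * z)) / cos ((4 * real l - 1 - 2 * real n) * z))"
    proof (rule prod.cong[OF refl])
      fix l assume "l \<in> {1..n}"
      then have "(m - 1/2 + (2 * real (Suc n - l) - 1 - real n)) = m + - (2 * real l - 1/2 - real n)"
        by (auto simp: of_nat_diff)
      moreover have "2 * (- (2 * real l - 1/2 - real n) * z) = - ((4 * real l - 1 - 2 * real n) * z)"
        by (simp add: algebra_simps)
      ultimately show "tan ((m - 1/2 + (2 * real (Suc n - l) - 1 - real n)) * z) =
        (1 + (-1) * sin ((4 * real l - 1 - 2 * real n) * z)) / cos ((4 * real l - 1 - 2 * real n) * z)"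
        by (simp only: t tan_quarter_plus sin_minus cos_minus mult_minus1)
    qed
    finally show ?thesis unfolding gen by simp
  qed
  have Q: "Q (alt_sign n) + Q (- alt_sign n) = ?P + ?M"
    using alt_sign_cases[of n] by (auto simp: Q_def)
  have u1: "U_factor n m (m + 1/2) = ?SQ * (cos_odd / sin_odd) * (Q (alt_sign n) / cos_odd)"
    unfolding plus[symmetric] sq2[symmetric] by (rule U_factor_eq) (use n_less m_pos n in auto)
  have u2: "U_factor n m (m - 1/2) = ?SQ * (cos_odd / sin_odd) * (Q (- alt_sign n) / cos_odd)"
    unfolding minus[symmetric] sq1[symmetric] by (rule U_factor_eq) (use n_less m_pos n in auto)
  have "U_factor n m (m + 1/2) + U_factor n m (m - 1/2) = ?SQ / sin_odd * (?P + ?M)"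
    unfolding u1 u2 Q[symmetric] using products_pos by (simp add: distrib_left)
  then show ?thesis
    unfolding sorted_sum_mode_csc_cot[OF assms, folded z_def] prod_csc_eq prod_half_csc by simp
qed

end

subsection \<open>The dominant eigenfunction on the alcove\<close>

lemma alcove_decreasing:
  assumes "x \<in> alcove_B n m" "1 \<le> i" "i < j" "j \<le> n"
  shows "x j < x i"
proof -
  have "i + k \<le> n \<Longrightarrow> 0 < k \<Longrightarrow> x (i + k) < x i" for k
  proof (induction k)
    case (Suc k)
    have step: "x (Suc (i + k)) < x (i + k)" using assms(1,2) Suc.prems by (auto simp: alcove_B_def)
    show ?case
    proof (cases "k = 0")
      case False
      then have "x (i + k) < x i" using Suc by auto
      with step show ?thesis by simp
    qed (use step in auto)
  qed simp
  from this[of "j - i"] show ?thesis using assms by simp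
qed

lemma alcove_bounds:
  assumes x: "x \<in> alcove_B n m" and n: "n \<ge> 1" and i: "i \<in> {1..n}"
  shows "0 < x i" "x i \<le> x 1" "x i < 2 * m"
proof -
  have "x n > 0" using x by (auto simp: alcove_B_def)
  then have pos: "0 < x j" if "j \<in> {1..n}" for j
    using alcove_decreasing[OF x, of j n] that by (cases "j = n") auto
  show "0 < x i" using pos i by simp
  show le: "x i \<le> x 1" using alcove_decreasing[OF x, of 1 i] i by (cases "i = 1") auto
  \<comment> \<open>For \<open>n = 1\<close> the absent coordinate is 0.\<close>
  have "x 2 \<ge> 0"
  proof (cases "2 \<le> n")
    case True
    then show ?thesis using pos[of 2] by simp
  next
    case False
    then show ?thesis using x by (auto simp: alcove_B_def points_def)
  qed
  moreover have "x 1 + x 2 < 2 * m" using x by (auto simp: alcove_B_def)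
  ultimately show "x i < 2 * m" using le by simp
qed

lemma alcove_sum_less:
  assumes x: "x \<in> alcove_B n m" and "1 \<le> i" "i < j" "j \<le> n"
  shows "x i + x j < 2 * m"
proof -
  have "x i \<le> x 1" using alcove_bounds(2)[OF x, of i] assms by auto
  moreover have "x j \<le> x 2"
    using alcove_decreasing[OF x, of 2 j] assms by (cases "j = 2") auto
  moreover have "x 1 + x 2 < 2 * m" using x by (auto simp: alcove_B_def)
  ultimately show ?thesis by simp
qed

text \<open>\<open>d = 1\<close> gives the integer points and \<open>d = 1/2\<close> the
  half-integer ones; in both cases \<open>d\<close> is also the least positive element of the
  coset.\<close>

definition coset_alcove :: "nat \<Rightarrow> real \<Rightarrow> real \<Rightarrow> (nat \<Rightarrow> real) set" where
  "coset_alcove n m d = {x \<in> alcove_B n m. \<forall>j\<in>{1..n}. x j - d \<in> \<int>}"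

text \<open>The factors of \<open>E_even\<close> and \<open>E_odd\<close> that involve
  \<eta>.\<close>

definition point_part :: "nat \<Rightarrow> real \<Rightarrow> (nat \<Rightarrow> real) \<Rightarrow> real" where
  "point_part n m x = (\<Prod>j=1..n. sin (pi * x j / (2 * m))) *
    (\<Prod>j\<in>{1..n}. \<Prod>i\<in>{i\<in>{1..n}. i < j}. sin (pi * (x i - x j) / (2 * m)) * sin (pi * (x i + x j) / (2 * m)))"

lemma prod_pairs:
  "(\<Prod>(h, t)\<in>{(h, t). 1 \<le> h \<and> h < t \<and> t \<le> n}. f h t) =
    (\<Prod>t\<in>{1..n::nat}. \<Prod>h\<in>{h\<in>{1..n}. h < t}. f h t)"
proof -
  have "(\<Prod>t\<in>{1..n}. \<Prod>h\<in>{h\<in>{1..n}. h < t}. f h t) =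
    (\<Prod>(t, h)\<in>Sigma {1..n} (\<lambda>t. {h\<in>{1..n}. h < t}). f h t)"
    by (rule prod.Sigma) auto
  also have "\<dots> = (\<Prod>(h, t)\<in>{(h, t). 1 \<le> h \<and> h < t \<and> t \<le> n}. f h t)"
    by (rule prod.reindex_bij_witness[where i = "\<lambda>(h, t). (t, h)" and j = "\<lambda>(t, h). (h, t)"]) auto
  finally show ?thesis ..
qed

lemma sin_pos_2pi: "0 < y \<Longrightarrow> y < 2 * m \<Longrightarrow> sin (pi * y / (2 * m)) > 0"
proof -
  assume y: "0 < y" "y < 2 * m"
  have "pi * y / (2 * m) = pi * (y / (2 * m))" by simp
  also have "\<dots> < pi * 1" using y by (intro mult_strict_left_mono) auto
  finally show ?thesis using y by (intro sin_gt_zero) auto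
qed

lemma point_part_pos:
  assumes x: "x \<in> alcove_B n m" and n: "n \<ge> 1"
  shows "point_part n m x > 0"
proof -
  have "x i - x j > 0" "x i + x j > 0" "x i + x j < 2 * m" "x i - x j < 2 * m"
    if "i \<in> {1..n}" "j \<in> {1..n}" "i < j" for i j
    using alcove_decreasing[OF x, of i j] alcove_sum_less[OF x, of i j] alcove_bounds[OF x n that(1)]
      alcove_bounds[OF x n that(2)] that by auto
  then show ?thesis
    unfolding point_part_def
    using alcove_bounds[OF x n] by (intro mult_pos_pos prod_pos sin_pos_2pi) auto
qed

section \<open>Product form, reflection and norm of the eigenfunction\<close>

context frequencies
begin

text \<open>For fixed \<open>t\<close> the numbers \<open>t - h\<close>, \<open>t\<close> and
  \<open>t + h\<close> with \<open>h < t\<close> run once through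
  \<open>1..2 * t - 1\<close>.\<close>

lemma E_even_eq: "E_even n m x = point_part n m x * e0 z n"
proof -
  have split: "(\<Prod>(h, t) \<in> {(h, t). 1 \<le> h \<and> h < t \<and> t \<le> n}.
        sin (pi * (x h - x t) / (2 * m)) * sin (pi * (real t - real h) / (2 * m)) *
        sin (pi * (x h + x t) / (2 * m)) * sin (pi * (real t + real h) / (2 * m))) =
     (\<Prod>t\<in>{1..n}. \<Prod>h\<in>{h\<in>{1..n}. h < t}. sin (pi * (x h - x t) / (2 * m)) * sin (pi * (x h + x t) / (2 * m))) *
     (\<Prod>t\<in>{1..n}. \<Prod>h\<in>{h\<in>{1..n}. h < t}. sin (2 * (real t - real h) * z) * sin (2 * (real t + real h) * z))"
    unfolding prod_pairs prod.distrib[symmetric]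
    by (intro prod.cong refl) (simp add: angle_eqs(2)[of "real _ - real _"] angle_eqs(2)[of "real _ + real _"])
  have e: "(\<Prod>t\<in>{1..n}. \<Prod>h\<in>{h\<in>{1..n}. h < t}. sin (2 * (real t - real h) * z) * sin (2 * (real t + real h) * z)) *
      (\<Prod>h=1..n. sin (pi * real h / (2 * m))) = e0 z n"
    unfolding e0_def prod.distrib[symmetric]
  proof (rule prod.cong[OF refl])
    fix t assume t: "t \<in> {1..n}"
    have "{h\<in>{1..n}. h < t} = {1..t-1}" using t by auto
    then have "(\<Prod>h\<in>{h\<in>{1..n}. h < t}. sin (2 * (real t - real h) * z) * sin (2 * (real t + real h) * z)) =
       (\<Prod>h=1..t-1. sin (2 * (real t - real h) * z)) * (\<Prod>h=1..t-1. sin (2 * (real t + real h) * z))"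
      by (simp add: prod.distrib)
    also have "(\<Prod>h=1..t-1. sin (2 * (real t - real h) * z)) = (\<Prod>v=1..t-1. sin (2 * real v * z))"
      by (rule prod.reindex_bij_witness[where i = "\<lambda>v. t - v" and j = "\<lambda>h. t - h"]) (auto simp: of_nat_diff)
    also have "(\<Prod>h=1..t-1. sin (2 * (real t + real h) * z)) = (\<Prod>v=t+1..2*t-1. sin (2 * real v * z))"
      by (rule prod.reindex_bij_witness[where i = "\<lambda>v. v - t" and j = "\<lambda>h. t + h"]) auto
    finally have "(\<Prod>h\<in>{h\<in>{1..n}. h < t}. sin (2 * (real t - real h) * z) * sin (2 * (real t + real h) * z)) *
        sin (pi * real t / (2 * m)) =
      (\<Prod>v=1..t-1. sin (2 * real v * z)) * (\<Prod>v=t+1..2*t-1. sin (2 * real v * z)) * sin (2 * real t * z)"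
      by (simp only: angle_eqs(2))
    also have "\<dots> = (\<Prod>v=1..2*t-1. sin (2 * real v * z))"
    proof -
      have "{1..2*t-1} = insert t ({1..t-1} \<union> {t+1..2*t-1})" using t by auto
      moreover have "(\<Prod>v\<in>{1..t-1} \<union> {t+1..2*t-1}. sin (2 * real v * z)) =
        (\<Prod>v=1..t-1. sin (2 * real v * z)) * (\<Prod>v=t+1..2*t-1. sin (2 * real v * z))"
        by (rule prod.union_disjoint) auto
      moreover have "t \<notin> {1..t-1} \<union> {t+1..2*t-1}" by auto
      ultimately show ?thesis by (simp only: prod.insert finite_Un finite_atLeastAtMost ac_simps not_False_eq_True)
    qed
    finally show "(\<Prod>h\<in>{h\<in>{1..n}. h < t}. sin (2 * (real t - real h) * z) * sin (2 * (real t + real h) * z)) *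
        sin (pi * real t / (2 * m)) = (\<Prod>v=1..2*t-1. sin (2 * real v * z))" .
  qed
  show ?thesis
    unfolding E_even_def split e[symmetric] point_part_def by (simp only: prod.distrib ac_simps)
qed

text \<open>For fixed \<open>t\<close> the numbers \<open>t - h\<close> and \<open>t + h - 1\<close>
  with \<open>h < t\<close> run once through \<open>1..2 * t - 2\<close>; the sine of
  \<open>(2 * t - 1) * z\<close> is the extra factor in \<open>e1\<close>.\<close>

lemma E_odd_eq: "E_odd n m x = point_part n m x * e1 z n"
proof -
  have split: "(\<Prod>(h, t) \<in> {(h, t). 1 \<le> h \<and> h < t \<and> t \<le> n}.
        sin (pi * (x h - x t) / (2 * m)) * sin (pi * (real t - real h) / (2 * m)) *
        sin (pi * (x h + x t) / (2 * m)) * sin (pi * (real t + real h - 1) / (2 * m))) =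
     (\<Prod>t\<in>{1..n}. \<Prod>h\<in>{h\<in>{1..n}. h < t}. sin (pi * (x h - x t) / (2 * m)) * sin (pi * (x h + x t) / (2 * m))) *
     (\<Prod>t\<in>{1..n}. \<Prod>h\<in>{h\<in>{1..n}. h < t}. sin (2 * (real t - real h) * z) * sin (2 * (real t + real h - 1) * z))"
    unfolding prod_pairs prod.distrib[symmetric]
    by (intro prod.cong refl) (simp add: angle_eqs(2)[of "real _ - real _"] angle_eqs(2)[of "real _ + real _ - 1"])
  have e: "(\<Prod>t\<in>{1..n}. \<Prod>h\<in>{h\<in>{1..n}. h < t}. sin (2 * (real t - real h) * z) * sin (2 * (real t + real h - 1) * z)) *
      (\<Prod>h=1..n. sin (pi * (2 * real h - 1) / (4 * m))) = e1 z n"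
    unfolding e1_def prod.distrib[symmetric]
  proof (rule prod.cong[OF refl])
    fix t assume t: "t \<in> {1..n}"
    have "{h\<in>{1..n}. h < t} = {1..t-1}" using t by auto
    then have "(\<Prod>h\<in>{h\<in>{1..n}. h < t}. sin (2 * (real t - real h) * z) * sin (2 * (real t + real h - 1) * z)) =
       (\<Prod>h=1..t-1. sin (2 * (real t - real h) * z)) * (\<Prod>h=1..t-1. sin (2 * (real t + real h - 1) * z))"
      by (simp add: prod.distrib)
    also have "(\<Prod>h=1..t-1. sin (2 * (real t - real h) * z)) = (\<Prod>v=1..t-1. sin (2 * real v * z))"
      by (rule prod.reindex_bij_witness[where i = "\<lambda>v. t - v" and j = "\<lambda>h. t - h"]) (auto simp: of_nat_diff)
    also have "(\<Prod>h=1..t-1. sin (2 * (real t + real h - 1) * z)) = (\<Prod>v=1..t-1. sin (2 * real (t - 1 + v) * z))"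
      using t by (intro prod.cong refl arg_cong[where f = sin]) (auto simp: of_nat_diff)
    also have "(\<Prod>v=1..t-1. sin (2 * real v * z)) * (\<Prod>v=1..t-1. sin (2 * real (t - 1 + v) * z)) =
        (\<Prod>v=1..2*(t-1). sin (2 * real v * z))"
      by (rule prod_shift_split[symmetric])
    also have "2 * (t - 1) = 2 * t - 2" by simp
    finally show "(\<Prod>h\<in>{h\<in>{1..n}. h < t}. sin (2 * (real t - real h) * z) * sin (2 * (real t + real h - 1) * z)) *
        sin (pi * (2 * real t - 1) / (4 * m)) = (\<Prod>v=1..2*t-2. sin (2 * real v * z)) * sin ((2 * real t - 1) * z)"
      by (simp only: angle_eqs(1))
  qed
  show ?thesis
    unfolding E_odd_def split e[symmetric] point_part_def by (simp only: prod.distrib ac_simps)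
qed

definition eigenfun :: "(nat \<Rightarrow> real) \<Rightarrow> real" where
  "eigenfun = alternant n (\<lambda>i v. sin (2 * freq i * v))"

text \<open>Weyl's formula at \<open>t j = pi * x j / (2 * m)\<close>. The sines of half sums and
  half differences in it are positive inside the alcove, which also shows that the cosines are
  distinct, as the formula requires.\<close>

lemma eigenfun_eq:
  assumes x: "x \<in> alcove_B n m"
  shows "eigenfun x = c4 n * point_part n m x"
proof -
  let ?t = "\<lambda>j. pi * x j / (2 * m)"
  have "eigenfun x = alternant n (\<lambda>i u. sin ((2 * real i - 1) * u)) ?t"
    unfolding eigenfun_def
    by (rule alternant_cong, rule arg_cong[where f = sin]) (simp add: freq_def)
  also have "\<dots> = (\<Prod>j=1..n. sin (?t j)) *
     (\<Prod>j\<in>{1..n}. \<Prod>i\<in>{i\<in>{1..n}. i < j}. 4 * (sin (?t i - ?t j) * sin (?t i + ?t j)))"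
  proof (rule alternant_sin, rule inj_onI, rule ccontr)
    have ne: "2 * cos (2 * ?t i) \<noteq> 2 * cos (2 * ?t j)" if "i \<in> {1..n}" "j \<in> {1..n}" "i < j" for i j
    proof -
      have "sin (pi * (x i - x j) / (2 * m)) > 0" "sin (pi * (x i + x j) / (2 * m)) > 0"
        using alcove_decreasing[OF x, of i j] alcove_sum_less[OF x, of i j] alcove_bounds[OF x n that(1)]
          alcove_bounds[OF x n that(2)] that by (auto intro!: sin_pos_2pi)
      moreover have "pi * (x i - x j) / (2 * m) = ?t i - ?t j" "pi * (x i + x j) / (2 * m) = ?t i + ?t j"
        by (simp_all add: right_diff_distrib distrib_left diff_divide_distrib add_divide_distrib)
      ultimately have "4 * (sin (?t i - ?t j) * sin (?t i + ?t j)) > 0" by simp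
      then show ?thesis unfolding cos_double_diff[symmetric] by simp
    qed
    fix i j assume "i \<in> {1..n}" "j \<in> {1..n}" "2 * cos (2 * ?t i) = 2 * cos (2 * ?t j)" "i \<noteq> j"
    then show False using ne[of i j] ne[of j i] by (cases "i < j") auto
  qed
  also have "(\<Prod>j\<in>{1..n}. \<Prod>i\<in>{i\<in>{1..n}. i < j}. 4 * (sin (?t i - ?t j) * sin (?t i + ?t j))) =
    c4 n * (\<Prod>j\<in>{1..n}. \<Prod>i\<in>{i\<in>{1..n}. i < j}. sin (pi * (x i - x j) / (2 * m)) * sin (pi * (x i + x j) / (2 * m)))"
    unfolding c4_def prod.distrib[symmetric]
  proof (rule prod.cong[OF refl])
    fix j assume "j \<in> {1..n}"
    then have "card {i\<in>{1..n}. i < j} = j - 1"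
    proof -
      have "{i\<in>{1..n}. i < j} = {1..j-1}" using \<open>j \<in> {1..n}\<close> by auto
      then show ?thesis by simp
    qed
    then have "(\<Prod>i\<in>{i\<in>{1..n}. i < j}. 4::real) = 4 ^ (j - 1)" by simp
    moreover have "pi * (x i - x j) / (2 * m) = ?t i - ?t j" "pi * (x i + x j) / (2 * m) = ?t i + ?t j" for i
      by (simp_all add: right_diff_distrib distrib_left diff_divide_distrib add_divide_distrib)
    ultimately show "(\<Prod>i\<in>{i\<in>{1..n}. i < j}. 4 * (sin (?t i - ?t j) * sin (?t i + ?t j))) =
      4 ^ (j - 1) * (\<Prod>i\<in>{i\<in>{1..n}. i < j}. sin (pi * (x i - x j) / (2 * m)) * sin (pi * (x i + x j) / (2 * m)))"
      by (simp only: prod.distrib)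
  qed
  finally show ?thesis by (simp add: point_part_def)
qed

lemma c4_pos: "c4 k > 0"
  unfolding c4_def by (intro prod_pos) auto

lemma eigenfun_pos: "x \<in> alcove_B n m \<Longrightarrow> eigenfun x > 0"
  using point_part_pos[of x n m] n c4_pos[of n] by (simp add: eigenfun_eq)

text \<open>\<open>4 * freq i * m\<close> is an odd multiple of \<open>pi\<close>.\<close>

lemma sin_reflect: "sin (2 * freq i * (2 * m - v)) = sin (2 * freq i * v)"
proof -
  have "2 * freq i * (2 * m - v) = 2 * (2 * freq i * m) - 2 * freq i * v" by (simp add: algebra_simps)
  moreover have "2 * (2 * freq i * m) = 2 * real i * pi - pi" unfolding two_freq_m by (simp add: algebra_simps)
  moreover have "sin (2 * real i * pi - pi) = 0" "cos (2 * real i * pi - pi) = -1"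
    using sin_2npi[of i] cos_2npi[of i] by (simp_all add: sin_diff cos_diff mult.assoc)
  ultimately show ?thesis by (simp add: sin_diff)
qed

lemma eigenfun_reflect: "eigenfun (x(1 := 2 * m - x 1)) = eigenfun x"
  unfolding eigenfun_def by (rule alternant_cong) (use sin_reflect in auto)

text \<open>Telescopes like the sine sum; the boundary term at the wall vanishes with
  \<open>sin (t * m)\<close>. The orthogonality relations rest on it.\<close>

lemma sum_weight_cos:
  assumes "sin (t/2) \<noteq> 0" "sin (t * m) = 0"
  shows "(\<Sum>v\<in>D. w v * cos (t * v)) = - sin (t * (d - 1/2)) / (2 * sin (t/2))"
proof -
  have tel: "2 * sin (t/2) * (\<Sum>k<M. cos (t * (d + real k))) = sin (t * (d + real M - 1/2)) - sin (t * (d - 1/2))" for M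
  proof (induction M)
    case (Suc M)
    have "2 * sin (t/2) * cos (t * (d + real M)) =
      sin (t * (d + real M) + t/2) - sin (t * (d + real M) - t/2)"
      by (simp add: sin_add sin_diff)
    also have "t * (d + real M) - t/2 = t * (d + real M - 1/2)" by (simp add: algebra_simps)
    also have "t * (d + real M) + t/2 = t * (d + real (Suc M) - 1/2)" by (simp add: algebra_simps)
    finally show ?case using Suc by (simp add: distrib_left)
  qed simp
  have "2 * sin (t/2) * (\<Sum>v\<in>D. w v * cos (t * v)) =
    sin (t * (m + e)) - sin (t * (d - 1/2)) - 2 * sin (t/2) * (e * cos (t * (m - 1/2 + e)))"
  proof -
    have "d + real N - 1/2 = m + e" using top by simp
    then show ?thesis
      unfolding sum_weight using tel[of N] by (simp add: right_diff_distrib[of "2 * sin (t/2)"])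
  qed
  also have "\<dots> = - sin (t * (d - 1/2))"
    using e
  proof
    assume "e = 0"
    then show ?thesis using assms(2) by simp
  next
    assume eh: "e = 1/2"
    have "m - 1/2 + e = m" "t * (m + e) = t * m + t/2"
      unfolding eh by (simp_all add: algebra_simps)
    then show ?thesis using assms(2) by (simp only: sin_add) (simp add: eh)
  qed
  finally show ?thesis using assms by (simp add: field_simps)
qed

lemma sin_int_pi: "sin (real_of_int k * pi) = 0"
  by (simp add: sin_zero_iff_int2)

text \<open>Product-to-sum formula. A cosine sum whose angle is not degenerate has a value
  \<open>c\<close> depending only on \<open>d\<close>, so for distinct modes the two sums cancel.
  For \<open>i = j\<close> the difference angle is 0 and its sum is the total weight
  \<open>N - e = m + c\<close>.\<close>

lemma mode_orthogonal:
  assumes d: "d = 1/2 \<or> d = 1" and ij: "i \<in> {1..n}" "j \<in> {1..n}"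
  shows "(\<Sum>v\<in>D. w v * (sin (2 * freq i * v) * sin (2 * freq j * v))) = (if i = j then m/2 else 0)"
proof -
  define c where "c = (if d = 1 then - 1/2 else (0::real))"
  have cc: "(\<Sum>v\<in>D. w v * cos (2 * x * v)) = c" if "sin x \<noteq> 0" "sin (2 * x * m) = 0" for x
  proof -
    have "(\<Sum>v\<in>D. w v * cos (2 * x * v)) = - sin (2 * x * (d - 1/2)) / (2 * sin x)"
      using sum_weight_cos[of "2 * x"] that by simp
    also have "\<dots> = c"
    proof (cases "d = 1")
      case True
      then have "2 * x * (d - 1/2) = x" by simp
      then show ?thesis using True that(1) by (simp only: c_def) simp
    next
      case False
      then have "d - 1/2 = 0" using d by auto
      then show ?thesis using False by (simp only: c_def) simp
    qed
    finally show ?thesis .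
  qed
  have "(\<Sum>v\<in>D. w v * (sin (2 * freq i * v) * sin (2 * freq j * v))) =
    ((\<Sum>v\<in>D. w v * cos (2 * (freq i - freq j) * v)) - (\<Sum>v\<in>D. w v * cos (2 * (freq i + freq j) * v))) / 2"
    unfolding sum_subtractf[symmetric] sum_divide_distrib
    by (intro sum.cong refl) (simp add: algebra_simps cos_add cos_diff)
  also have "(\<Sum>v\<in>D. w v * cos (2 * (freq i + freq j) * v)) = c"
  proof (rule cc)
    have "2 * (freq i + freq j) * m = real_of_int (int i + int j - 1) * pi"
      using two_freq_m[of i] two_freq_m[of j] by (simp add: algebra_simps)
    then show "sin (2 * (freq i + freq j) * m) = 0" by (simp only: sin_int_pi)
  qed (rule sin_freq_add_diff(1)[OF ij])
  also have "(\<Sum>v\<in>D. w v * cos (2 * (freq i - freq j) * v)) = (if i = j then c + m else c)"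
  proof (cases "i = j")
    case False
    have "2 * (freq i - freq j) * m = real_of_int (int i - int j) * pi"
      using two_freq_m[of i] two_freq_m[of j] by (simp add: algebra_simps)
    then have "sin (2 * (freq i - freq j) * m) = 0" by (simp only: sin_int_pi)
    with False show ?thesis using cc[OF sin_freq_add_diff(2)[OF ij False]] by simp
  next
    case True
    have "(\<Sum>v\<in>D. w v * 1) = real N - e" unfolding sum_weight by simp
    then show ?thesis using True top d by (auto simp: c_def)
  qed
  finally show ?thesis by auto
qed

lemma mem_D_iff:
  assumes d: "d = 1/2 \<or> d = 1"
  shows "v \<in> D \<longleftrightarrow> v - d \<in> \<int> \<and> 0 < v \<and> v \<le> m"
proof
  assume "v \<in> D"
  then obtain k where k: "k < N" "v = d + real k" by (auto simp: grid_def)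
  then have "real k \<le> real N - 1" by linarith
  then have "v \<le> m" using k top e by auto
  then show "v - d \<in> \<int> \<and> 0 < v \<and> v \<le> m" using k d by auto
next
  assume v: "v - d \<in> \<int> \<and> 0 < v \<and> v \<le> m"
  then obtain k where k: "v = d + of_int k" by (metis Ints_cases add_diff_cancel_left' diff_add_cancel add.commute)
  have "real_of_int k > - 1" using v d k by auto
  then have k0: "k \<ge> 0" by linarith
  have "real_of_int k < real N" using v k top e by auto
  then have "nat k < N" using k0 by linarith
  moreover have "v = d + real (nat k)" using k k0 by simp
  ultimately show "v \<in> D" by (auto simp: grid_def)
qed

text \<open>On the near side of the wall \<open>x 1 + x 2 < 2 * m\<close> follows from
  \<open>x 2 < x 1\<close> and \<open>x 1 \<le> m\<close>, so only the order and the grid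
  remain.\<close>

lemma ordered_eq:
  assumes d: "d = 1/2 \<or> d = 1"
  shows "ordered n D = {x \<in> coset_alcove n m d. x 1 \<le> m}"
proof (intro equalityI subsetI)
  fix x assume x: "x \<in> ordered n D"
  then have xD: "x i \<in> D" if "i \<in> {1..n}" for i using that by (auto simp: ordered_def tuples_def)
  have dec: "x j < x i" if "1 \<le> i" "i < j" "j \<le> n" for i j using x that by (auto simp: ordered_def)
  have x1: "x 1 \<le> m" "x n > 0" "x 1 > 0" using xD[of 1] xD[of n] n by (auto simp: mem_D_iff[OF d])
  have "x 1 + x 2 < 2 * m"
  proof (cases "2 \<le> n")
    case True
    with dec[of 1 2] x1 show ?thesis by simp
  next
    case False
    then have "x 2 = 0" using x by (auto simp: ordered_def tuples_def)
    with x1 show ?thesis by simp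
  qed
  moreover have "x \<in> points n" using x by (auto simp: ordered_def tuples_def points_def)
  moreover have "\<forall>i\<in>{1..<n}. x (i + 1) < x i" using dec by auto
  ultimately show "x \<in> {x \<in> coset_alcove n m d. x 1 \<le> m}"
    using x1 xD mem_D_iff[OF d] by (auto simp: coset_alcove_def alcove_B_def)
next
  fix x assume "x \<in> {x \<in> coset_alcove n m d. x 1 \<le> m}"
  then have x: "x \<in> alcove_B n m" "\<And>j. j \<in> {1..n} \<Longrightarrow> x j - d \<in> \<int>" "x 1 \<le> m"
    by (auto simp: coset_alcove_def)
  have "x i \<in> D" if "i \<in> {1..n}" for i
    using alcove_bounds[OF x(1) n that] x that by (auto simp: mem_D_iff[OF d])
  moreover have "x i = 0" if "i \<notin> {1..n}" for i using x(1) that by (auto simp: alcove_B_def points_def)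
  ultimately show "x \<in> ordered n D"
    using alcove_decreasing[OF x(1)] by (auto simp: ordered_def tuples_def)
qed

text \<open>The reflection exchanges the inequalities \<open>x 1 > x 2\<close> and
  \<open>x 1 + x 2 < 2 * m\<close>, and preserves the coset because \<open>2 * m - 2 * d\<close> is
  an integer.\<close>

lemma reflect_coset_alcove:
  assumes "x \<in> coset_alcove n m d"
  shows "x(1 := 2 * m - x 1) \<in> coset_alcove n m d"
proof -
  let ?y = "x(1 := 2 * m - x 1)"
  have x: "x \<in> alcove_B n m" using assms by (auto simp: coset_alcove_def)
  have x12: "x 1 + x 2 < 2 * m" using x by (auto simp: alcove_B_def)
  have "2 * m - x 1 - d = (2 * real N - 1 - 2 * e) - (x 1 - d)" using top by (simp add: algebra_simps)
  moreover have "2 * real N - 1 - 2 * e = of_int (2 * int N - 1) \<or> 2 * real N - 1 - 2 * e = of_int (2 * int N - 2)"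
    using e by auto
  then have "2 * real N - 1 - 2 * e \<in> \<int>" by (metis Ints_of_int)
  moreover have "x 1 - d \<in> \<int>" using assms n by (auto simp: coset_alcove_def)
  ultimately have "2 * m - x 1 - d \<in> \<int>" by (metis Ints_diff)
  then have coset: "\<forall>j\<in>{1..n}. ?y j - d \<in> \<int>" using assms by (auto simp: coset_alcove_def)
  have "?y i > ?y (i + 1)" if "i \<in> {1..<n}" for i
  proof (cases "i = 1")
    case True
    then have i2: "i + 1 = 2" by simp
    show ?thesis unfolding i2 using True x12 by simp
  qed (use x that in \<open>auto simp: alcove_B_def\<close>)
  moreover have "?y n > 0"
    using alcove_bounds[OF x n, of n] alcove_bounds[OF x n, of 1] n by auto
  moreover have "?y 1 + ?y 2 < 2 * m"
  proof (cases "2 \<le> n")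
    case True
    then show ?thesis using alcove_decreasing[OF x, of 1 2] by simp
  next
    case False
    then have "x 2 = 0" using x by (auto simp: alcove_B_def points_def)
    then show ?thesis using alcove_bounds[OF x n, of 1] n by simp
  qed
  moreover have "?y \<in> points n" using x n by (auto simp: alcove_B_def points_def)
  ultimately show ?thesis using coset by (auto simp: coset_alcove_def alcove_B_def)
qed

lemma finite_coset_alcove:
  assumes d: "d = 1/2 \<or> d = 1"
  shows "finite (coset_alcove n m d)"
proof -
  have fin: "finite (ordered n D)"
    by (rule finite_subset[OF _ finite_tuples[of "{1..n}" D]]) (auto simp: ordered_def)
  have "coset_alcove n m d \<subseteq> ordered n D \<union> (\<lambda>x. x(1 := 2 * m - x 1)) ` ordered n D"
  proof
    fix x assume x: "x \<in> coset_alcove n m d"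
    show "x \<in> ordered n D \<union> (\<lambda>x. x(1 := 2 * m - x 1)) ` ordered n D"
    proof (cases "x 1 \<le> m")
      case True
      with x show ?thesis by (simp add: ordered_eq[OF d])
    next
      case False
      then have "x(1 := 2 * m - x 1) \<in> ordered n D"
        using reflect_coset_alcove[OF x] by (simp add: ordered_eq[OF d])
      moreover have "x = (x(1 := 2 * m - x 1))(1 := 2 * m - (x(1 := 2 * m - x 1)) 1)" by auto
      ultimately show ?thesis by blast
    qed
  qed
  then show ?thesis using fin by (meson finite_UnI finite_imageI finite_subset)
qed

text \<open>Points with \<open>x 1 > m\<close> are mirror images of those with
  \<open>x 1 < m\<close>. Points with \<open>x 1 = m\<close> are their own images and are counted by
  twice the weight 1/2; on the near side no other coordinate can reach the wall.\<close>

lemma sum_coset_alcove: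
  assumes d: "d = 1/2 \<or> d = 1" and inv: "\<And>x. \<Phi> (x(1 := 2 * m - x 1)) = \<Phi> x"
  shows "(\<Sum>x\<in>coset_alcove n m d. \<Phi> x) = 2 * (\<Sum>y\<in>ordered n D. (\<Prod>i=1..n. w (y i)) * \<Phi> y)"
proof -
  let ?L = "{x \<in> coset_alcove n m d. x 1 < m}" and ?E = "{x \<in> coset_alcove n m d. x 1 = m}"
    and ?G = "{x \<in> coset_alcove n m d. x 1 > m}"
  note fin = finite_coset_alcove[OF d]
  have "(\<Sum>x\<in>?G. \<Phi> x) = (\<Sum>x\<in>?L. \<Phi> x)"
    by (rule sum.reindex_bij_witness[where i = "\<lambda>x. x(1 := 2 * m - x 1)" and j = "\<lambda>x. x(1 := 2 * m - x 1)"])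
       (use reflect_coset_alcove inv in auto)
  moreover have "coset_alcove n m d = (?L \<union> ?E) \<union> ?G" by auto
  moreover have "(\<Sum>x\<in>(?L \<union> ?E) \<union> ?G. \<Phi> x) = (\<Sum>x\<in>?L \<union> ?E. \<Phi> x) + (\<Sum>x\<in>?G. \<Phi> x)"
    using fin by (intro sum.union_disjoint) auto
  moreover have "(\<Sum>x\<in>?L \<union> ?E. \<Phi> x) = (\<Sum>x\<in>?L. \<Phi> x) + (\<Sum>x\<in>?E. \<Phi> x)"
    using fin by (intro sum.union_disjoint) auto
  ultimately have 1: "(\<Sum>x\<in>coset_alcove n m d. \<Phi> x) = 2 * (\<Sum>x\<in>?L. \<Phi> x) + (\<Sum>x\<in>?E. \<Phi> x)" by simp
  have less: "x i < m" if "x \<in> coset_alcove n m d" "x 1 \<le> m" "i \<in> {2..n}" for x i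
    using alcove_decreasing[of x n m 1 i] that by (auto simp: coset_alcove_def)
  have N: "{1..n} = insert 1 {2..n}" using n by auto
  have W: "(\<Prod>i=1..n. w (x i)) = w (x 1)" if "x \<in> coset_alcove n m d" "x 1 \<le> m" for x
  proof -
    have "(\<Prod>i=2..n. w (x i)) = 1"
    proof (intro prod.neutral ballI)
      fix i assume "i \<in> {2..n}"
      then have "x i \<noteq> m" using less[OF that] by (metis less_irrefl)
      then show "w (x i) = 1" by (simp add: wall_weight_def)
    qed
    then show ?thesis unfolding N by simp
  qed
  have "ordered n D = ?L \<union> ?E" unfolding ordered_eq[OF d] by auto
  moreover have "(\<Sum>x\<in>?L \<union> ?E. (\<Prod>i=1..n. w (x i)) * \<Phi> x) =
     (\<Sum>x\<in>?L. (\<Prod>i=1..n. w (x i)) * \<Phi> x) + (\<Sum>x\<in>?E. (\<Prod>i=1..n. w (x i)) * \<Phi> x)"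
    using fin by (intro sum.union_disjoint) auto
  moreover have "(\<Sum>x\<in>?L. (\<Prod>i=1..n. w (x i)) * \<Phi> x) = (\<Sum>x\<in>?L. \<Phi> x)"
  proof (rule sum.cong[OF refl])
    fix x assume x: "x \<in> ?L"
    then have "(\<Prod>i=1..n. w (x i)) = w (x 1)" by (intro W) auto
    moreover have "w (x 1) = 1" using x by (simp add: wall_weight_def)
    ultimately show "(\<Prod>i=1..n. w (x i)) * \<Phi> x = \<Phi> x" by (simp only: mult_1)
  qed
  moreover have "(\<Sum>x\<in>?E. (\<Prod>i=1..n. w (x i)) * \<Phi> x) = (\<Sum>x\<in>?E. \<Phi> x / 2)"
  proof (rule sum.cong[OF refl])
    fix x assume x: "x \<in> ?E"
    then have "(\<Prod>i=1..n. w (x i)) = w (x 1)" by (intro W) auto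
    moreover have "w (x 1) = 1/2" using x by (simp add: wall_weight_def)
    ultimately show "(\<Prod>i=1..n. w (x i)) * \<Phi> x = \<Phi> x / 2" by simp
  qed
  ultimately show ?thesis using 1 by (simp add: sum_divide_distrib[symmetric])
qed

lemma sum_eigenfun:
  assumes d: "d = 1/2 \<or> d = 1"
  shows "(\<Sum>x\<in>coset_alcove n m d. eigenfun x) = 2 * sorted_sum D mode {1..n}"
proof -
  have "(\<Sum>x\<in>coset_alcove n m d. eigenfun x) = 2 * (\<Sum>y\<in>ordered n D. (\<Prod>i=1..n. w (y i)) * eigenfun y)"
    by (rule sum_coset_alcove[OF d, of eigenfun]) (rule eigenfun_reflect)
  also have "\<dots> = 2 * sorted_sum D mode {1..n}"
    unfolding eigenfun_def by (subst sum_ordered_alternant) simp_all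
  finally show ?thesis .
qed

text \<open>The factor 2 counts the mirror images, and \<open>m/2\<close> is the common norm of the
  modes, the same on both cosets.\<close>

lemma sum_eigenfun_square:
  assumes d: "d = 1/2 \<or> d = 1"
  shows "(\<Sum>x\<in>coset_alcove n m d. (eigenfun x)\<^sup>2) = 2 * (m/2) ^ n"
proof -
  have "(\<Sum>x\<in>coset_alcove n m d. (eigenfun x)\<^sup>2) =
      2 * (\<Sum>y\<in>ordered n D. (\<Prod>i=1..n. w (y i)) * (eigenfun y)\<^sup>2)"
    by (rule sum_coset_alcove[OF d]) (simp only: eigenfun_reflect)
  also have "(\<Sum>y\<in>ordered n D. (\<Prod>i=1..n. w (y i)) * (eigenfun y)\<^sup>2) = (m/2) ^ n"
    unfolding eigenfun_def
    by (rule sum_ordered_alternant_square) (use mode_orthogonal[OF d] in auto)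
  finally show ?thesis .
qed

end

subsection \<open>Convergence for positive symmetric kernels\<close>

text \<open>\<open>reach\<close> is Doeblin's minorization with constant 1, available because the
  kernel will count walks. The operator is spelled out there since \<open>B\<close> is defined only
  afterwards.\<close>

locale symmetric_kernel =
  fixes X :: "'a set" and b :: "'a \<Rightarrow> 'a \<Rightarrow> real" and f :: "'a \<Rightarrow> real" and lam :: real
    and base :: 'a and L :: nat
  assumes fin: "finite X" and base: "base \<in> X" and b_nonneg: "\<And>x y. b x y \<ge> 0"
    and b_sym: "\<And>x y. b x y = b y x" and f_pos: "\<And>x. x \<in> X \<Longrightarrow> f x > 0" and lam: "lam > 0"
    and eigen: "\<And>x. x \<in> X \<Longrightarrow> (\<Sum>y\<in>X. b x y * f y) = lam * f x"
    and reach: "\<And>v x. (\<And>y. y \<in> X \<Longrightarrow> v y \<ge> 0) \<Longrightarrow> x \<in> X \<Longrightarrow>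
      ((\<lambda>v x. \<Sum>y\<in>X. b x y * v y) ^^ L) v x \<ge> v base"
begin

definition B :: "('a \<Rightarrow> real) \<Rightarrow> 'a \<Rightarrow> real" where "B v = (\<lambda>x. \<Sum>y\<in>X. b x y * v y)"

lemma B_reach: "(\<And>y. y \<in> X \<Longrightarrow> v y \<ge> 0) \<Longrightarrow> x \<in> X \<Longrightarrow> (B ^^ L) v x \<ge> v base"
  using reach by (simp add: B_def[abs_def])

lemma B_cong: "(\<And>x. x \<in> X \<Longrightarrow> v x = w x) \<Longrightarrow> B v = B w"
  unfolding B_def by (intro ext sum.cong) auto

lemma B_linear: "(B ^^ k) (\<lambda>x. s * v x + t * w x) = (\<lambda>x. s * (B ^^ k) v x + t * (B ^^ k) w x)"
proof (induction k)
  case (Suc k)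
  then show ?case
    by (simp add: B_def sum.distrib sum_distrib_left algebra_simps)
qed simp

lemma B_eigen: "x \<in> X \<Longrightarrow> (B ^^ k) f x = lam ^ k * f x"
proof (induction k arbitrary: x)
  case (Suc k)
  have "B ((B ^^ k) f) = B (\<lambda>x. lam ^ k * f x)" by (rule B_cong) (rule Suc.IH)
  moreover have "B (\<lambda>x. lam ^ k * f x) x = lam ^ k * (lam * f x)"
    using eigen[OF Suc.prems] by (simp add: B_def sum_distrib_left[symmetric] mult.left_commute)
  ultimately show ?case by simp
qed simp

lemma B_mono: "(\<And>x. x \<in> X \<Longrightarrow> v x \<le> w x) \<Longrightarrow> B v x \<le> B w x"
  unfolding B_def by (intro sum_mono mult_left_mono b_nonneg) auto

text \<open>By the symmetry of \<open>b\<close>, \<open>f\<close> is also a left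
  eigenvector.\<close>

lemma B_adjoint: "(\<Sum>x\<in>X. f x * (B ^^ k) v x) = lam ^ k * (\<Sum>x\<in>X. f x * v x)"
proof (induction k)
  case (Suc k)
  have "(\<Sum>x\<in>X. f x * B w x) = (\<Sum>y\<in>X. (\<Sum>x\<in>X. b y x * f x) * w y)" for w
    unfolding B_def sum_distrib_left sum_distrib_right
    by (subst sum.swap) (intro sum.cong refl, simp add: b_sym[of _ y for y] ac_simps)
  then have "(\<Sum>x\<in>X. f x * B w x) = lam * (\<Sum>x\<in>X. f x * w x)" for w
    by (simp add: eigen sum_distrib_left mult.assoc)
  then show ?case using Suc by simp
qed simp

text \<open>The iterate of \<open>u\<close> is pinched between two multiples of the exact solution
  \<open>lam ^ j * f\<close>.\<close>

definition bounded_by where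
  "bounded_by u j lo hi \<longleftrightarrow> (\<forall>x\<in>X. lo * (lam ^ j * f x) \<le> (B ^^ j) u x \<and> (B ^^ j) u x \<le> hi * (lam ^ j * f x))"

lemma bounded_by_Suc:
  assumes "bounded_by u j lo hi"
  shows "bounded_by u (Suc j) lo hi"
  unfolding bounded_by_def
proof (intro ballI conjI)
  fix x assume x: "x \<in> X"
  have e: "B (\<lambda>x. t * (lam ^ j * f x)) x = t * (lam ^ Suc j * f x)" for t
    using eigen[OF x] by (simp add: B_def sum_distrib_left[symmetric] mult.left_commute)
  show "lo * (lam ^ Suc j * f x) \<le> (B ^^ Suc j) u x"
    unfolding e[symmetric] using assms by (simp add: bounded_by_def B_mono)
  show "(B ^^ Suc j) u x \<le> hi * (lam ^ Suc j * f x)"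
    unfolding e[symmetric] using assms by (simp add: bounded_by_def B_mono)
qed

lemma bounded_by_add: "bounded_by u j lo hi \<Longrightarrow> bounded_by u (j + k) lo hi"
  by (induction k) (auto intro: bounded_by_Suc)

lemma norm_pos: "(\<Sum>x\<in>X. (f x)\<^sup>2) > 0"
proof (rule sum_pos)
  fix x assume "x \<in> X"
  then show "0 < (f x)\<^sup>2" using f_pos[of x] by simp
qed (use fin base in auto)

text \<open>The component along \<open>f\<close> is scaled by exactly \<open>lam\<close> in each
  step, so the projection coefficient of \<open>u\<close> lies between any two valid bounds.\<close>

lemma bounded_by_mean:
  assumes "bounded_by u j lo hi"
  shows "lo \<le> (\<Sum>x\<in>X. f x * u x) / (\<Sum>x\<in>X. (f x)\<^sup>2)" "(\<Sum>x\<in>X. f x * u x) / (\<Sum>x\<in>X. (f x)\<^sup>2) \<le> hi"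
proof -
  have lp: "lam ^ j > 0" using lam by simp
  have "(\<Sum>x\<in>X. f x * (lo * (lam ^ j * f x))) \<le> (\<Sum>x\<in>X. f x * (B ^^ j) u x)"
    using assms f_pos by (intro sum_mono mult_left_mono) (auto simp: bounded_by_def less_imp_le)
  then have "lam ^ j * (lo * (\<Sum>x\<in>X. (f x)\<^sup>2)) \<le> lam ^ j * (\<Sum>x\<in>X. f x * u x)"
    unfolding B_adjoint by (simp add: sum_distrib_left power2_eq_square ac_simps)
  then show "lo \<le> (\<Sum>x\<in>X. f x * u x) / (\<Sum>x\<in>X. (f x)\<^sup>2)"
    using lp norm_pos by (simp add: pos_le_divide_eq)
  have "(\<Sum>x\<in>X. f x * (B ^^ j) u x) \<le> (\<Sum>x\<in>X. f x * (hi * (lam ^ j * f x)))"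
    using assms f_pos by (intro sum_mono mult_left_mono) (auto simp: bounded_by_def less_imp_le)
  then have "lam ^ j * (\<Sum>x\<in>X. f x * u x) \<le> lam ^ j * (hi * (\<Sum>x\<in>X. (f x)\<^sup>2))"
    unfolding B_adjoint by (simp add: sum_distrib_left power2_eq_square ac_simps)
  then show "(\<Sum>x\<in>X. f x * u x) / (\<Sum>x\<in>X. (f x)\<^sup>2) \<le> hi"
    using lp norm_pos by (simp add: pos_divide_le_eq)
qed

text \<open>Factor by which the width of the bounds shrinks in \<open>L\<close> steps: the value at
  \<open>base\<close> arrives everywhere, and is measured against the maximum of
  \<open>f\<close>.\<close>

definition contraction where "contraction = 1 - f base / (lam ^ L * Max (f ` X))"

lemma f_le_Max: "x \<in> X \<Longrightarrow> f x \<le> Max (f ` X)"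
  using fin by simp

lemma Max_pos: "Max (f ` X) > 0"
  using f_le_Max[OF base] f_pos[OF base] by simp

lemma contraction_bounds: "0 \<le> contraction" "contraction < 1"
proof -
  have "f base \<le> (B ^^ L) f base" using f_pos base by (intro B_reach) (auto simp: less_imp_le)
  also have "\<dots> \<le> lam ^ L * Max (f ` X)"
    using lam by (simp add: B_eigen[OF base] f_le_Max[OF base])
  finally show "0 \<le> contraction" using lam Max_pos by (simp add: contraction_def)
  show "contraction < 1" using lam Max_pos f_pos[OF base] by (simp add: contraction_def)
qed

text \<open>Doeblin's argument: from every point at least the mass at \<open>base\<close> arrives, so the gap
  between the bounds shrinks by a fixed factor.\<close>

lemma bounded_by_contract:
  assumes bd: "bounded_by u j lo hi"
  shows "\<exists>lo' hi'. bounded_by u (j + L) lo' hi' \<and> hi' - lo' = contraction * (hi - lo)"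
proof -
  define F where "F = Max (f ` X)"
  \<comment> \<open>The slack of the lower and of the upper bound at \<open>base\<close>.\<close>
  define p q where "p = (B ^^ j) u base - lo * (lam ^ j * f base)"
    and "q = hi * (lam ^ j * f base) - (B ^^ j) u base"
  define c where "c = lam ^ j * (lam ^ L * F)"
  have F: "F > 0" "\<And>x. x \<in> X \<Longrightarrow> f x \<le> F" using Max_pos f_le_Max by (auto simp: F_def)
  have c: "c > 0" using F lam by (simp add: c_def)
  have pq: "p \<ge> 0" "q \<ge> 0" using bd base by (auto simp: bounded_by_def p_def q_def)
  \<comment> \<open>Converts a constant gain \<open>t\<close> into a multiple of
    \<open>f\<close>.\<close>
  have scale: "t / c * (lam ^ (j + L) * f x) \<le> t" if "x \<in> X" "t \<ge> 0" for t x
  proof -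
    have "t / c * (lam ^ (j + L) * f x) = t * (f x / F)"
      using lam F by (simp add: c_def power_add)
    also have "\<dots> \<le> t * 1" using F that by (intro mult_left_mono) auto
    finally show ?thesis by simp
  qed
  have "bounded_by u (j + L) (lo + p / c) (hi - q / c)"
    unfolding bounded_by_def
  proof (intro ballI conjI)
    fix x assume x: "x \<in> X"
    have Bj: "(B ^^ L) ((B ^^ j) u) x = (B ^^ (j + L)) u x"
      by (simp add: add.commute funpow_add)
    have "p \<le> (B ^^ L) (\<lambda>y. 1 * (B ^^ j) u y + (- lo * lam ^ j) * f y) x"
      using B_reach[of "\<lambda>y. 1 * (B ^^ j) u y + (- lo * lam ^ j) * f y" x] bd x
      by (simp add: bounded_by_def p_def mult.assoc)
    also have "\<dots> = (B ^^ (j + L)) u x - lo * (lam ^ (j + L) * f x)"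
      unfolding B_linear Bj B_eigen[OF x] by (simp add: power_add)
    finally show "(lo + p / c) * (lam ^ (j + L) * f x) \<le> (B ^^ (j + L)) u x"
      using scale[OF x pq(1)] by (simp add: distrib_right)
    have "q \<le> (B ^^ L) (\<lambda>y. (-1) * (B ^^ j) u y + (hi * lam ^ j) * f y) x"
      using B_reach[of "\<lambda>y. (-1) * (B ^^ j) u y + (hi * lam ^ j) * f y" x] bd x
      by (simp add: bounded_by_def q_def mult.assoc)
    also have "\<dots> = hi * (lam ^ (j + L) * f x) - (B ^^ (j + L)) u x"
      unfolding B_linear Bj B_eigen[OF x] by (simp add: power_add)
    finally show "(B ^^ (j + L)) u x \<le> (hi - q / c) * (lam ^ (j + L) * f x)"
      using scale[OF x pq(2)] by (simp add: left_diff_distrib)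
  qed
  moreover have "(hi - q / c) - (lo + p / c) = contraction * (hi - lo)"
  proof -
    have pq: "p + q = (hi - lo) * (lam ^ j * f base)" by (simp add: p_def q_def algebra_simps)
    have "(hi - q / c) - (lo + p / c) = (hi - lo) - (p + q) / c"
      by (simp add: add_divide_distrib)
    also have "(p + q) / c = (hi - lo) * (f base / (lam ^ L * F))"
      unfolding pq using lam by (simp add: c_def)
    also have "a - a * t = (1 - t) * a" for a t :: real
      by (simp add: algebra_simps)
    finally show ?thesis by (simp only: contraction_def F_def)
  qed
  ultimately show ?thesis by blast
qed

text \<open>All valid bounds enclose the projection coefficient, and their widths tend to 0.\<close>

theorem tendsto_projection:
  assumes x: "x \<in> X"
  shows "(\<lambda>j. (B ^^ j) u x / lam ^ j) \<longlonglongrightarrow> f x * ((\<Sum>x\<in>X. f x * u x) / (\<Sum>x\<in>X. (f x)\<^sup>2))"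
proof -
  define c where "c = (\<Sum>x\<in>X. f x * u x) / (\<Sum>x\<in>X. (f x)\<^sup>2)"
  define W where "W = Max ((\<lambda>y. \<bar>u y\<bar> / f y) ` X)"
  have W: "\<bar>u y\<bar> \<le> W * f y" if "y \<in> X" for y
  proof -
    have "\<bar>u y\<bar> / f y \<le> W" unfolding W_def using fin that by (intro Max_ge) auto
    then show ?thesis using f_pos[OF that] by (simp add: pos_divide_le_eq)
  qed
  have ex: "\<exists>lo hi. bounded_by u (i * L) lo hi \<and> hi - lo = contraction ^ i * (2 * W)" for i
  proof (induction i)
    case 0
    have "- W * f x \<le> u x" "u x \<le> W * f x" if "x \<in> X" for x
      using W[OF that] by simp_all
    then have "bounded_by u 0 (- W) W" by (simp add: bounded_by_def)
    then show ?case by force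
  next
    case (Suc i)
    then obtain lo hi where *: "bounded_by u (i * L) lo hi" "hi - lo = contraction ^ i * (2 * W)" by blast
    from bounded_by_contract[OF *(1)] obtain lo' hi' where
      "bounded_by u (i * L + L) lo' hi'" "hi' - lo' = contraction * (hi - lo)" by blast
    with *(2) show ?case by (auto simp: add.commute mult.assoc)
  qed
  have close: "\<bar>(B ^^ j) u x / lam ^ j - f x * c\<bar> \<le> contraction ^ i * (2 * W) * f x" if ij: "i * L \<le> j" for i j
  proof -
    obtain lo hi where b: "bounded_by u (i * L) lo hi" "hi - lo = contraction ^ i * (2 * W)" using ex by blast
    from bounded_by_add[OF b(1), of "j - i * L"] ij have bj: "bounded_by u j lo hi" by simp
    have lj: "lam ^ j > 0" using lam by simp
    have "lo * f x \<le> (B ^^ j) u x / lam ^ j" "(B ^^ j) u x / lam ^ j \<le> hi * f x"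
      using bj x lj by (auto simp: bounded_by_def pos_le_divide_eq pos_divide_le_eq ac_simps)
    moreover have "lo * f x \<le> f x * c" "f x * c \<le> hi * f x"
      using bounded_by_mean[OF bj, folded c_def] f_pos[OF x]
      by (simp_all add: mult.commute[of _ "f x"] mult_left_mono)
    ultimately have "\<bar>(B ^^ j) u x / lam ^ j - f x * c\<bar> \<le> hi * f x - lo * f x" by linarith
    also have "\<dots> = contraction ^ i * (2 * W) * f x" unfolding b(2)[symmetric] by (simp add: left_diff_distrib)
    finally show ?thesis .
  qed
  have "(\<lambda>i. contraction ^ i * (2 * W) * f x) \<longlonglongrightarrow> 0 * (2 * W) * f x"
    using contraction_bounds by (intro tendsto_intros LIMSEQ_power_zero) auto
  then have lim0: "(\<lambda>i. contraction ^ i * (2 * W) * f x) \<longlonglongrightarrow> 0" by simp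
  have "(\<lambda>j. (B ^^ j) u x / lam ^ j) \<longlonglongrightarrow> f x * c"
  proof (rule LIMSEQ_I)
    fix r :: real assume "r > 0"
    with lim0 obtain i where "\<bar>contraction ^ i * (2 * W) * f x\<bar> < r"
      by (metis LIMSEQ_D diff_zero le_refl real_norm_def)
    then have "norm ((B ^^ j) u x / lam ^ j - f x * c) < r" if "i * L \<le> j" for j
      using close[OF that] by simp
    then show "\<exists>no. \<forall>j\<ge>no. norm ((B ^^ j) u x / lam ^ j - f x * c) < r" by blast
  qed
  then show ?thesis by (simp add: c_def)
qed

end

subsection \<open>Counting walks\<close>

definition neighbours :: "nat \<Rightarrow> (nat \<Rightarrow> real) \<Rightarrow> (nat \<Rightarrow> real) set" where
  "neighbours n x = {y. (\<lambda>j. y j - x j) \<in> diagonal_steps n}"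

lemma diagonal_steps_eq: "diagonal_steps n = tuples {1..n} {1/2, -1/2}"
  by (auto simp: diagonal_steps_def tuples_def points_def)

lemma neighbours_eq: "neighbours n x = (\<lambda>s j. x j + s j) ` diagonal_steps n"
proof (intro equalityI subsetI)
  fix y assume "y \<in> neighbours n x"
  then show "y \<in> (\<lambda>s j. x j + s j) ` diagonal_steps n"
    by (intro image_eqI[where x = "\<lambda>j. y j - x j"]) (auto simp: neighbours_def)
qed (auto simp: neighbours_def)

lemma finite_neighbours [simp]: "finite (neighbours n x)"
  unfolding neighbours_eq diagonal_steps_eq by (simp add: finite_tuples)

lemma neighbours_sym: "y \<in> neighbours n x \<longleftrightarrow> x \<in> neighbours n y"
proof -
  have "y \<in> neighbours n x \<Longrightarrow> x \<in> neighbours n y" for x y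
    by (fastforce simp: neighbours_def diagonal_steps_def points_def)
  then show ?thesis by blast
qed

lemma neighbour_coord:
  assumes "y \<in> neighbours n x" "j \<in> {1..n}"
  shows "y j = x j + 1/2 \<or> y j = x j - 1/2"
proof -
  have "y j - x j = 1/2 \<or> y j - x j = - (1/2)"
    using assms by (auto simp: neighbours_def diagonal_steps_def)
  then show ?thesis by auto
qed

lemma walks_0: "x \<in> R \<Longrightarrow> diagonal_walks n R x 0 = {[x]}"
  by (auto simp: diagonal_walks_def length_Suc_conv)

lemma walks_Suc:
  assumes x: "x \<in> R"
  shows "diagonal_walks n R x (Suc k) = (\<Union>y\<in>neighbours n x \<inter> R. (#) x ` diagonal_walks n R y k)"
proof (intro equalityI subsetI)
  fix p assume p: "p \<in> diagonal_walks n R x (Suc k)"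
  then have len: "length p = Suc (Suc k)" and p0: "p ! 0 = x" and R: "set p \<subseteq> R"
    and st: "\<And>i. i \<in> {1..Suc k} \<Longrightarrow> (\<lambda>j. (p ! i) j - (p ! (i - 1)) j) \<in> diagonal_steps n"
    by (auto simp: diagonal_walks_def)
  from len obtain q where q: "p = x # q" "length q = Suc k"
    using p0 by (cases p) auto
  have "q ! 0 \<in> R" using R q by (auto intro!: nth_mem)
  moreover have "q ! 0 \<in> neighbours n x" using st[of 1] q by (simp add: neighbours_def)
  moreover have "q \<in> diagonal_walks n R (q ! 0) k"
  proof -
    have "(\<lambda>j. (q ! i) j - (q ! (i - 1)) j) \<in> diagonal_steps n" if "i \<in> {1..k}" for i
      using st[of "Suc i"] that q by (simp add: nth_Cons')
    then show ?thesis using q R by (auto simp: diagonal_walks_def)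
  qed
  ultimately show "p \<in> (\<Union>y\<in>neighbours n x \<inter> R. (#) x ` diagonal_walks n R y k)" using q by blast
next
  fix p assume "p \<in> (\<Union>y\<in>neighbours n x \<inter> R. (#) x ` diagonal_walks n R y k)"
  then obtain y q where y: "y \<in> neighbours n x" "y \<in> R" and q: "q \<in> diagonal_walks n R y k" "p = x # q" by auto
  have "(\<lambda>j. (p ! i) j - (p ! (i - 1)) j) \<in> diagonal_steps n" if i: "i \<in> {1..Suc k}" for i
  proof (cases "i = 1")
    case True
    then show ?thesis using y q by (simp add: neighbours_def diagonal_walks_def)
  next
    case False
    obtain i' where "i = Suc i'" using i by (cases i) auto
    moreover from this have "i' \<in> {1..k}" using i False by auto
    ultimately show ?thesis using q by (auto simp: diagonal_walks_def nth_Cons')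
  qed
  then show "p \<in> diagonal_walks n R x (Suc k)"
    using q x by (auto simp: diagonal_walks_def)
qed

lemma finite_walks: "x \<in> R \<Longrightarrow> finite (diagonal_walks n R x k)"
proof (induction k arbitrary: x)
  case (Suc k)
  then show ?case by (auto simp: walks_Suc)
qed (simp add: walks_0)

definition count :: "nat \<Rightarrow> (nat \<Rightarrow> real) set \<Rightarrow> nat \<Rightarrow> (nat \<Rightarrow> real) \<Rightarrow> real" where
  "count n R k x = real (card (diagonal_walks n R x k))"

lemma count_0: "x \<in> R \<Longrightarrow> count n R 0 x = 1"
  by (simp add: count_def walks_0)

lemma count_Suc:
  assumes "x \<in> R"
  shows "count n R (Suc k) x = (\<Sum>y\<in>neighbours n x \<inter> R. count n R k y)"
proof -
  have "card (diagonal_walks n R x (Suc k)) = (\<Sum>y\<in>neighbours n x \<inter> R. card ((#) x ` diagonal_walks n R y k))"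
    unfolding walks_Suc[OF assms]
  proof (rule card_UN_disjoint)
    show "\<forall>i\<in>neighbours n x \<inter> R. \<forall>j\<in>neighbours n x \<inter> R. i \<noteq> j \<longrightarrow>
        (#) x ` diagonal_walks n R i k \<inter> (#) x ` diagonal_walks n R j k = {}"
      by (auto simp: diagonal_walks_def)
  qed (auto simp: finite_walks)
  also have "\<dots> = (\<Sum>y\<in>neighbours n x \<inter> R. card (diagonal_walks n R y k))"
    by (intro sum.cong refl card_image) auto
  finally show ?thesis by (simp add: count_def)
qed

lemma K_factor_eq: "K_factor n m k = K_factor n m 1 ^ k"
  by (simp add: K_factor_def)

text \<open>\<open>3/2 - d\<close> exchanges 1 and 1/2, just as every diagonal step exchanges
  integers and half-integers.\<close>

lemma coset_half_diff:
  fixes u v d :: real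
  assumes "u - d \<in> \<int>" "d = 1/2 \<or> d = 1" "v = u + 1/2 \<or> v = u - 1/2"
  shows "v - (3/2 - d) \<in> \<int>"
proof -
  have "\<exists>t::int. v - (3/2 - d) = (u - d) + of_int t"
    using assms(2,3)
  proof (elim disjE)
    assume "d = 1/2" "v = u + 1/2"
    then show ?thesis by (intro exI[of _ 0]) simp
  next
    assume "d = 1/2" "v = u - 1/2"
    then show ?thesis by (intro exI[of _ "-1"]) simp
  next
    assume "d = 1" "v = u + 1/2"
    then show ?thesis by (intro exI[of _ 1]) simp
  next
    assume "d = 1" "v = u - 1/2"
    then show ?thesis by (intro exI[of _ 0]) simp
  qed
  then show ?thesis using assms(1) by (metis Ints_add Ints_of_int)
qed

lemma neighbours_coset:
  assumes "x \<in> coset_alcove n m d" "d = 1/2 \<or> d = 1"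
  shows "neighbours n x \<inter> alcove_B n m = neighbours n x \<inter> coset_alcove n m (3/2 - d)"
proof -
  have "y \<in> coset_alcove n m (3/2 - d)" if "y \<in> neighbours n x" "y \<in> alcove_B n m" for y
    using that assms coset_half_diff[OF _ assms(2) neighbour_coord[OF that(1)]]
    by (auto simp: coset_alcove_def)
  then show ?thesis by (auto simp: coset_alcove_def)
qed

section \<open>The eigenvalue equation on the alcove\<close>

context frequencies
begin

abbreviation "A \<equiv> alcove_B n m"
abbreviation "K \<equiv> K_factor n m 1"

lemma K_eq: "K = (\<Prod>i=1..n. 2 * cos (freq i))"
  by (simp add: K_factor_def freq_def prod.distrib)

lemma K_pos: "K > 0"
  unfolding K_eq using cos_freq_pos by (intro prod_pos) auto

text \<open>The sum over all steps factors by coordinates, each giving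
  \<open>2 * cos (freq i) * sin (2 * freq i * v)\<close>; the product of the cosines is
  \<open>K\<close> for every permutation.\<close>

lemma sum_steps_eigenfun: "(\<Sum>y\<in>neighbours n x. eigenfun y) = K * eigenfun x"
proof -
  have "(\<Sum>y\<in>neighbours n x. eigenfun y) = (\<Sum>s\<in>diagonal_steps n. eigenfun (\<lambda>j. x j + s j))"
    unfolding neighbours_eq
    by (subst sum.reindex) (auto simp: inj_on_def fun_eq_iff)
  also have "\<dots> = (\<Sum>p\<in>{p. p permutes {1..n}}. of_int (sign p) *
      (\<Sum>s\<in>diagonal_steps n. \<Prod>i=1..n. sin (2 * freq (p i) * (x i + s i))))"
    unfolding eigenfun_def alternant_def sum_distrib_left by (rule sum.swap)
  also have "\<dots> = (\<Sum>p\<in>{p. p permutes {1..n}}. of_int (sign p) *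
      (K * (\<Prod>i=1..n. sin (2 * freq (p i) * x i))))"
  proof (intro sum.cong refl arg_cong2[where f = "(*)"])
    fix p assume "p \<in> {p. p permutes {1..n}}"
    then have p: "p permutes {1..n}" by simp
    have "(\<Sum>s\<in>diagonal_steps n. \<Prod>i=1..n. sin (2 * freq (p i) * (x i + s i))) =
      (\<Prod>i=1..n. \<Sum>v\<in>{1/2, -1/2}. sin (2 * freq (p i) * (x i + v)))"
      unfolding diagonal_steps_eq
      by (rule sum_prod_tuples[of "{1..n}" "\<lambda>i v. sin (2 * freq (p i) * (x i + v))"]) simp
    also have "\<dots> = (\<Prod>i=1..n. 2 * cos (freq (p i)) * sin (2 * freq (p i) * x i))"
      by (intro prod.cong refl) (simp add: distrib_left right_diff_distrib sin_add sin_diff)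
    also have "\<dots> = (\<Prod>i=1..n. 2 * cos (freq (p i))) * (\<Prod>i=1..n. sin (2 * freq (p i) * x i))"
      by (rule prod.distrib)
    also have "(\<Prod>i=1..n. 2 * cos (freq (p i))) = K"
      unfolding K_eq using prod.permute[OF p, of "\<lambda>i. 2 * cos (freq i)"] by (simp add: o_def)
    finally show "(\<Sum>s\<in>diagonal_steps n. \<Prod>i=1..n. sin (2 * freq (p i) * (x i + s i))) =
      K * (\<Prod>i=1..n. sin (2 * freq (p i) * x i))" .
  qed
  finally show ?thesis
    by (simp add: eigenfun_def alternant_def sum_distrib_left ac_simps)
qed

lemma eigenfun_zero_coord:
  assumes "i \<in> {1..n}" "y i = 0"
  shows "eigenfun y = 0"
proof -
  have *: "(\<Prod>k=1..n. sin (2 * freq (p k) * y k)) = 0" for p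
    using assms by (intro prod_zero bexI[of _ i]) auto
  show ?thesis unfolding eigenfun_def alternant_def * by simp
qed

text \<open>A step changes each of \<open>x i - x (i + 1)\<close>, \<open>2 * x n\<close> and
  \<open>2 * m - (x 1 + x 2)\<close> by at most 1, and inside the alcove each is a positive integer
  if \<open>n\<close> is at least 2. So a step out of the alcove lands exactly on a wall, where the
  alternant vanishes.\<close>

lemma eigenfun_outside:
  assumes m2: "2 * m \<in> \<int>" and c: "c = 1/2 \<or> c = 1" and x: "x \<in> coset_alcove n m c"
    and y: "y \<in> neighbours n x" "y \<notin> A"
  shows "eigenfun y = 0"
proof -
  have xA: "x \<in> A" and xc: "\<And>j. j \<in> {1..n} \<Longrightarrow> x j - c \<in> \<int>" using x by (auto simp: coset_alcove_def)
  note yx = neighbour_coord[OF y(1)]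
  have "2 * c = 1 \<or> 2 * c = 2" using c by auto
  then have c2: "2 * c \<in> \<int>" by (metis Ints_1 Ints_numeral)
  have ge1: "t \<ge> 1" if "t \<in> \<int>" "t > 0" for t :: real
    using that by (auto elim!: Ints_cases)
  have "y \<in> points n" using xA y(1)
    by (fastforce simp: neighbours_def diagonal_steps_def alcove_B_def points_def)
  then consider i where "i \<in> {1..<n}" "y i \<le> y (i + 1)" | "y n \<le> 0" | "y 1 + y 2 \<ge> 2 * m"
    using y(2) by (fastforce simp: alcove_B_def not_less)
  then show ?thesis
  proof cases
    case (1 i)
    have "x i - x (i + 1) = (x i - c) - (x (i + 1) - c)" by simp
    moreover have "i \<in> {1..n}" "i + 1 \<in> {1..n}" using 1 by auto
    ultimately have "x i - x (i + 1) \<in> \<int>" using Ints_diff[OF xc xc] by metis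
    moreover have "x i - x (i + 1) > 0" using xA 1 by (auto simp: alcove_B_def)
    ultimately have "x i - x (i + 1) \<ge> 1" by (rule ge1)
    then have "y i = y (i + 1)" using 1 yx[of i] yx[of "i + 1"] by auto
    then show ?thesis
      unfolding eigenfun_def using 1 by (intro alternant_eq_0[of i n "i + 1"]) auto
  next
    case 2
    have "x n > 0" using xA by (auto simp: alcove_B_def)
    moreover have "x n - c \<in> \<int>" using xc n by simp
    moreover have "x n \<ge> 1/2"
    proof (cases "c = 1")
      case True
      then have "x n \<in> \<int>" using \<open>x n - c \<in> \<int>\<close> by (metis Ints_1 Ints_add diff_add_cancel)
      then show ?thesis using ge1[of "x n"] \<open>x n > 0\<close> by simp
    next
      case False
      then have "x n + 1/2 \<in> \<int>"
      proof -
        have "x n + 1/2 = (x n - c) + 1" using False c by auto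
        then show ?thesis using \<open>x n - c \<in> \<int>\<close> by (metis Ints_1 Ints_add)
      qed
      then have "x n + 1/2 \<ge> 1" using \<open>x n > 0\<close> by (intro ge1) auto
      then show ?thesis by simp
    qed
    ultimately have "y n = 0" using yx[of n] n 2 by auto
    then show ?thesis using n by (intro eigenfun_zero_coord[of n]) auto
  next
    case 3
    show ?thesis
    proof (cases "2 \<le> n")
      case True
      have "2 * m - (x 1 + x 2) = 2 * m - ((x 1 - c) + (x 2 - c) + 2 * c)" by simp
      then have "2 * m - (x 1 + x 2) \<in> \<int>"
        using c2 m2 xc[of 1] xc[of 2] True by (metis Ints_add Ints_diff atLeastAtMost_iff le_trans one_le_numeral order_refl)
      moreover have "2 * m - (x 1 + x 2) > 0" using xA by (auto simp: alcove_B_def)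
      ultimately have "2 * m - (x 1 + x 2) \<ge> 1" by (rule ge1)
      \<comment> \<open>The reflection carries this wall to the wall
        \<open>x 1 = x 2\<close>.\<close>
      then have "2 * m - y 1 = y 2" using 3 yx[of 1] yx[of 2] True by auto
      then have "eigenfun (y(1 := 2 * m - y 1)) = 0"
        unfolding eigenfun_def using True by (intro alternant_eq_0[of 1 n 2]) auto
      then show ?thesis by (simp only: eigenfun_reflect)
    next
      case False
      \<comment> \<open>For \<open>n = 1\<close> the upper wall is \<open>x 1 = 2 * m\<close>, which
        the reflection carries to 0. The distance to it may be a half-integer, so its double is
        used.\<close>
      then have "y 2 = 0" using \<open>y \<in> points n\<close> by (auto simp: points_def)
      have "x 1 < 2 * m" using alcove_bounds(3)[OF xA n] n by simp
      moreover have "2 * (2 * m - x 1) \<in> \<int>"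
      proof -
        have "2 * (2 * m - x 1) = 2 * (2 * m) - (2 * (x 1 - c) + 2 * c)" by simp
        moreover note c2
        moreover have "2 * (x 1 - c) \<in> \<int>" "2 * (2 * m) \<in> \<int>"
          by (rule Ints_mult[OF Ints_numeral xc], use n in simp, rule Ints_mult[OF Ints_numeral m2])
        ultimately show ?thesis by (metis Ints_add Ints_diff)
      qed
      ultimately have "2 * (2 * m - x 1) \<ge> 1" by (intro ge1) auto
      then have "2 * m - y 1 = 0" using 3 yx[of 1] n \<open>y 2 = 0\<close> by auto
      then have "eigenfun (y(1 := 2 * m - y 1)) = 0"
        using n by (intro eigenfun_zero_coord[of 1]) auto
      then show ?thesis by (simp only: eigenfun_reflect)
    qed
  qed
qed

lemma eigenfun_neighbours:
  assumes "2 * m \<in> \<int>" "c = 1/2 \<or> c = 1" "x \<in> coset_alcove n m c"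
  shows "(\<Sum>y\<in>neighbours n x \<inter> coset_alcove n m (3/2 - c). eigenfun y) = K * eigenfun x"
proof -
  have "(\<Sum>y\<in>neighbours n x \<inter> A. eigenfun y) = (\<Sum>y\<in>neighbours n x. eigenfun y)"
    using eigenfun_outside[OF assms] by (intro sum.mono_neutral_left) auto
  then show ?thesis
    unfolding neighbours_coset[OF assms(3,2)] sum_steps_eigenfun .
qed

end

section \<open>Smallest points and the size of the alcove\<close>

lemma coset_alcove_lower:
  assumes x: "x \<in> coset_alcove n m d" and d: "d \<le> 1" and n: "n \<ge> 1" and i: "i \<in> {1..n}"
  shows "x i \<ge> real n - real i + d"
proof -
  have xA: "x \<in> alcove_B n m" and xc: "\<And>j. j \<in> {1..n} \<Longrightarrow> x j - d \<in> \<int>"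
    using x by (auto simp: coset_alcove_def)
  have ge: "t \<ge> of_int k" if "t \<in> \<int>" "t > of_int k - 1" for t :: real and k :: int
    using that by (auto elim!: Ints_cases)
  have "k < n \<Longrightarrow> x (n - k) \<ge> real k + d" for k
  proof (induction k)
    case 0
    have "x n - d > of_int 0 - 1" using alcove_bounds(1)[OF xA n, of n] n d by auto
    then have "x n - d \<ge> of_int 0" using xc[of n] n by (intro ge) auto
    then show ?case by simp
  next
    case (Suc k)
    have "x (n - k) < x (n - Suc k)"
      using Suc.prems by (intro alcove_decreasing[OF xA]) auto
    then have "x (n - Suc k) - x (n - k) > of_int 1 - 1" by simp
    moreover have "n - k \<in> {1..n}" "n - Suc k \<in> {1..n}" using Suc.prems by auto
    then have "x (n - Suc k) - x (n - k) \<in> \<int>" using Ints_diff[OF xc xc] by fastforce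
    ultimately have "x (n - Suc k) - x (n - k) \<ge> of_int 1" by (intro ge)
    then show ?case using Suc by simp
  qed
  from this[of "n - i"] show ?thesis using i by (auto simp: of_nat_diff)
qed

lemma integer_alcove_lower:
  "x \<in> coset_alcove n m 1 \<Longrightarrow> n \<ge> 1 \<Longrightarrow> i \<in> {1..n} \<Longrightarrow> x i \<ge> real n + 1 - real i"
  using coset_alcove_lower[of x n m 1 i] by simp

text \<open>Only a weak inequality: for \<open>2 * m = 2 * n - 1\<close> the alcove has half-integer
  points but no integer ones.\<close>

lemma half_alcove_size:
  assumes x: "x \<in> coset_alcove n m (1/2)" and n: "n \<ge> 1" and m2: "2 * m \<in> \<int>"
  shows "2 * real n - 1 \<le> 2 * m"
proof -
  have xA: "x \<in> alcove_B n m" using x by (simp add: coset_alcove_def)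
  then have s: "x 1 + x 2 < 2 * m" by (simp add: alcove_B_def)
  have "2 * m > 2 * real n - 2"
  proof (cases "2 \<le> n")
    case True
    then show ?thesis using coset_alcove_lower[OF x _ n, of 1] coset_alcove_lower[OF x _ n, of 2] s by auto
  next
    case False
    then have "n = 1" "x 2 = 0" using n xA by (auto simp: alcove_B_def points_def)
    then show ?thesis using coset_alcove_lower[OF x _ n, of 1] s by auto
  qed
  moreover obtain k where k: "2 * m = of_int k" using m2 by (auto elim: Ints_cases)
  ultimately have "k > 2 * int n - 2" by linarith
  then have "k \<ge> 2 * int n - 1" by simp
  then show ?thesis unfolding k by linarith
qed

text \<open>A single integer point in the alcove forces the assumption of the locale
  \<open>frequencies\<close>.\<close>

lemma integer_alcove_size:
  assumes x: "x \<in> coset_alcove n m 1" and n: "n \<ge> 1"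
  shows "2 * real n - 1 < 2 * m"
proof -
  have xA: "x \<in> alcove_B n m" using x by (simp add: coset_alcove_def)
  then have s: "x 1 + x 2 < 2 * m" by (simp add: alcove_B_def)
  show ?thesis
  proof (cases "2 \<le> n")
    case True
    then show ?thesis using integer_alcove_lower[OF x n, of 1] integer_alcove_lower[OF x n, of 2] s by auto
  next
    case False
    then have "n = 1" "x 2 = 0" using n xA by (auto simp: alcove_B_def points_def)
    then show ?thesis using integer_alcove_lower[OF x n, of 1] s by auto
  qed
qed

lemma tendsto_even_filter:
  assumes "(\<lambda>j. g (2 * j)) \<longlonglongrightarrow> l"
  shows "(g \<longlongrightarrow> l) (inf at_top (principal {k::nat. even k}))"
proof (rule topological_tendstoI)
  fix S assume "open S" "l \<in> S"
  from topological_tendstoD[OF assms this] obtain J where J: "\<And>j. j \<ge> J \<Longrightarrow> g (2 * j) \<in> S"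
    by (auto simp: eventually_sequentially)
  have "g k \<in> S" if "k \<ge> 2 * J" "even k" for k
    using that J by (auto elim!: evenE)
  then show "eventually (\<lambda>k. g k \<in> S) (inf at_top (principal {k. even k}))"
    unfolding eventually_inf_principal eventually_sequentially by auto
qed

lemma tendsto_odd_filter:
  assumes "(\<lambda>j. g (2 * j + 1)) \<longlonglongrightarrow> l"
  shows "(g \<longlongrightarrow> l) (inf at_top (principal {k::nat. odd k}))"
proof (rule topological_tendstoI)
  fix S assume "open S" "l \<in> S"
  from topological_tendstoD[OF assms this] obtain J where J: "\<And>j. j \<ge> J \<Longrightarrow> g (2 * j + 1) \<in> S"
    by (auto simp: eventually_sequentially)
  have "g k \<in> S" if "k \<ge> 2 * J + 1" "odd k" for k
    using that J by (auto elim!: oddE)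
  then show "eventually (\<lambda>k. g k \<in> S) (inf at_top (principal {k. odd k}))"
    unfolding eventually_inf_principal eventually_sequentially by auto
qed

lemma asymp_equiv_geometric:
  assumes "((\<lambda>k. g k / K ^ k) \<longlongrightarrow> C) F" "C \<noteq> 0" "K \<noteq> (0::real)"
  shows "g \<sim>[F] (\<lambda>k. C * K ^ k)"
proof (rule asymp_equivI')
  have "((\<lambda>k. (g k / K ^ k) / C) \<longlongrightarrow> C / C) F" by (intro tendsto_divide assms(1) tendsto_const assms(2))
  then show "((\<lambda>k. g k / (C * K ^ k)) \<longlongrightarrow> 1) F" using assms(2) by (simp add: field_simps)
qed

section \<open>Two-step kernel on the integer points\<close>

context frequencies
begin

abbreviation "ints \<equiv> coset_alcove n m 1"
abbreviation "halves \<equiv> coset_alcove n m (1/2)"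

text \<open>Kernel of the square of the neighbour operator. Counting the middle points makes its
  symmetry evident.\<close>

definition two_step :: "(nat \<Rightarrow> real) \<Rightarrow> (nat \<Rightarrow> real) \<Rightarrow> real" where
  "two_step x y = real (card (neighbours n x \<inter> neighbours n y \<inter> halves))"

text \<open>Groups the walks of two steps by their middle point.\<close>

lemma sum_two_step:
  assumes fin: "finite ints"
  shows "(\<Sum>y\<in>ints. two_step x y * v y) = (\<Sum>u\<in>neighbours n x \<inter> halves. \<Sum>y\<in>neighbours n u \<inter> ints. v y)"
proof -
  have "two_step x y = (\<Sum>u\<in>neighbours n x \<inter> halves. if y \<in> neighbours n u then 1 else 0)" for y
  proof -
    have "(\<Sum>u\<in>neighbours n x \<inter> halves. if y \<in> neighbours n u then 1 else 0) =
      (\<Sum>u\<in>neighbours n x \<inter> halves. if u \<in> neighbours n y then 1 else (0::real))"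
      by (subst neighbours_sym) (rule refl)
    also have "\<dots> = real (card {u \<in> neighbours n x \<inter> halves. u \<in> neighbours n y})"
      by (simp add: sum.If_cases Int_def)
    also have "{u \<in> neighbours n x \<inter> halves. u \<in> neighbours n y} = neighbours n x \<inter> neighbours n y \<inter> halves"
      by auto
    finally show ?thesis by (simp add: two_step_def)
  qed
  then have "(\<Sum>y\<in>ints. two_step x y * v y) =
    (\<Sum>y\<in>ints. \<Sum>u\<in>neighbours n x \<inter> halves. if y \<in> neighbours n u then v y else 0)"
    by (auto simp: sum_distrib_right intro!: sum.cong)
  also have "\<dots> = (\<Sum>u\<in>neighbours n x \<inter> halves. \<Sum>y\<in>ints. if y \<in> neighbours n u then v y else 0)"
    by (rule sum.swap)
  also have "\<dots> = (\<Sum>u\<in>neighbours n x \<inter> halves. \<Sum>y\<in>neighbours n u \<inter> ints. v y)"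
  proof (rule sum.cong[OF refl])
    fix u
    show "(\<Sum>y\<in>ints. if y \<in> neighbours n u then v y else 0) = (\<Sum>y\<in>neighbours n u \<inter> ints. v y)"
      using fin by (subst Int_commute, subst sum.inter_restrict) auto
  qed
  finally show ?thesis .
qed

text \<open>The point \<open>(n, ..., 2, 1)\<close>, smallest in every coordinate among the integer
  points; it is the base of the Doeblin condition.\<close>

definition lowest :: "nat \<Rightarrow> real" where
  "lowest i = (if i \<in> {1..n} then real n + 1 - real i else 0)"

lemma lowest_in: "lowest \<in> ints"
  using nm n by (auto simp: lowest_def coset_alcove_def alcove_B_def points_def)

text \<open>Lowering all coordinates by 1/2 keeps an integer point in the alcove, since its last
  coordinate is at least 1. The result is the middle point of all two-step moves used below.\<close>

definition shift_down :: "(nat \<Rightarrow> real) \<Rightarrow> nat \<Rightarrow> real" where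
  "shift_down x j = (if j \<in> {1..n} then x j - 1/2 else 0)"

lemma shift_down_props:
  assumes x: "x \<in> ints"
  shows "shift_down x \<in> halves" "shift_down x \<in> neighbours n x"
proof -
  have xA: "x \<in> A" using x by (simp add: coset_alcove_def)
  have "x n \<ge> 1" using integer_alcove_lower[OF x n, of n] n by simp
  moreover have "shift_down x 1 + shift_down x 2 < 2 * m"
    using xA n by (auto simp: alcove_B_def shift_down_def points_def)
  ultimately have "shift_down x \<in> A"
    using xA n by (auto simp: alcove_B_def shift_down_def points_def)
  moreover have "x j - 1 \<in> \<int> \<Longrightarrow> x j - 1/2 - 1/2 \<in> \<int>" for j by simp
  ultimately show "shift_down x \<in> halves"
    using x by (auto simp: coset_alcove_def shift_down_def)
  show "shift_down x \<in> neighbours n x"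
    using xA by (auto simp: neighbours_def diagonal_steps_def shift_down_def points_def alcove_B_def)
qed

lemma two_step_ge_1:
  assumes "x \<in> ints" "shift_down x \<in> neighbours n y"
  shows "two_step x y \<ge> 1"
proof -
  have "shift_down x \<in> neighbours n x \<inter> neighbours n y \<inter> halves"
    using assms shift_down_props by auto
  then have "card (neighbours n x \<inter> neighbours n y \<inter> halves) > 0" by (auto simp: card_gt_0_iff)
  then show ?thesis by (simp add: two_step_def)
qed

text \<open>Lower by 1 the last coordinate that is above its minimum: the next one is minimal, so
  the gap is at least 2 and the order survives. Both points are neighbours of
  \<open>shift_down x\<close>.\<close>

lemma lower_neighbour:
  assumes x: "x \<in> ints" and ne: "x \<noteq> lowest"
  shows "\<exists>y\<in>ints. two_step x y \<ge> 1 \<and> (\<Sum>j=1..n. y j) = (\<Sum>j=1..n. x j) - 1"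
proof -
  have xA: "x \<in> A" and xc: "\<And>j. j \<in> {1..n} \<Longrightarrow> x j - 1 \<in> \<int>" using x by (auto simp: coset_alcove_def)
  have x0: "x j = 0" if "j \<notin> {1..n}" for j using xA that by (auto simp: alcove_B_def points_def)
  let ?S = "{i\<in>{1..n}. x i \<noteq> real n + 1 - real i}"
  have "?S \<noteq> {}"
  proof
    assume "?S = {}"
    then have "x = lowest" using x0 by (auto simp: lowest_def fun_eq_iff)
    with ne show False by simp
  qed
  define i where "i = Max ?S"
  have "i \<in> ?S" unfolding i_def using \<open>?S \<noteq> {}\<close> by (intro Max_in) auto
  then have i: "i \<in> {1..n}" "x i \<noteq> real n + 1 - real i" by auto
  have above: "x j = real n + 1 - real j" if "j \<in> {1..n}" "i < j" for j
  proof (rule ccontr)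
    assume "x j \<noteq> real n + 1 - real j"
    then have "j \<le> i" unfolding i_def using that by (intro Max_ge) auto
    with that show False by simp
  qed
  have xi: "x i \<ge> real n + 2 - real i"
  proof -
    have "x i > real n + 1 - real i" using integer_alcove_lower[OF x n i(1)] i(2) by simp
    moreover have "x i - (real n + 1 - real i) = of_int (int i - int n) + (x i - 1)" by simp
    then have "x i - (real n + 1 - real i) \<in> \<int>" using xc[OF i(1)] by (metis Ints_add Ints_of_int)
    moreover have "t \<ge> 1" if "t \<in> \<int>" "t > 0" for t :: real
      using that by (auto elim!: Ints_cases)
    ultimately have "x i - (real n + 1 - real i) \<ge> 1" by simp
    then show ?thesis by simp
  qed
  define y where "y = x(i := x i - 1)"
  have dec: "y (k + 1) < y k" if "k \<in> {1..<n}" for k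
  proof -
    have "x (k + 1) < x k" using xA that by (auto simp: alcove_B_def)
    moreover have "x (k + 1) < x k - 1" if "k = i"
      using above[of "k + 1"] xi that \<open>k \<in> {1..<n}\<close> by auto
    ultimately show ?thesis by (auto simp: y_def)
  qed
  have "y n > 0" using xi alcove_bounds(1)[OF xA n, of n] n by (auto simp: y_def)
  moreover have "y 1 + y 2 < 2 * m" using xA by (auto simp: y_def alcove_B_def)
  moreover have "y \<in> points n" using xA i by (auto simp: y_def alcove_B_def points_def)
  ultimately have "y \<in> A" using dec by (auto simp: alcove_B_def)
  moreover have "y j - 1 \<in> \<int>" if "j \<in> {1..n}" for j
    using xc[OF that] Ints_diff[OF xc[OF that] Ints_1] by (auto simp: y_def)
  ultimately have "y \<in> ints" by (auto simp: coset_alcove_def)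
  moreover have "shift_down x \<in> neighbours n y"
    using x0 i by (auto simp: neighbours_def diagonal_steps_def shift_down_def points_def y_def)
  then have "two_step x y \<ge> 1" by (rule two_step_ge_1[OF x])
  moreover have "(\<Sum>j=1..n. y j) = (\<Sum>j=1..n. x j) - 1"
  proof -
    have "(\<Sum>j\<in>{1..n}-{i}. y j) = (\<Sum>j\<in>{1..n}-{i}. x j)"
      by (intro sum.cong) (auto simp: y_def)
    moreover have "(\<Sum>j=1..n. t j) = t i + (\<Sum>j\<in>{1..n}-{i}. t j)" for t :: "nat \<Rightarrow> real"
      by (rule sum.remove) (use i in auto)
    ultimately show ?thesis by (simp only:) (simp add: y_def)
  qed
  ultimately show ?thesis by blast
qed

text \<open>Induction on the number of steps left, which bounds the excess of the coordinate sum
  over that of \<open>lowest\<close>. At \<open>lowest\<close> the walk waits by going to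
  \<open>shift_down lowest\<close> and back.\<close>

lemma two_step_reach:
  assumes fin: "finite ints" and v: "\<And>y. y \<in> ints \<Longrightarrow> v y \<ge> 0"
  shows "x \<in> ints \<Longrightarrow> (\<Sum>j=1..n. x j) \<le> (\<Sum>j=1..n. lowest j) + real L \<Longrightarrow>
    ((\<lambda>v x. \<Sum>y\<in>ints. two_step x y * v y) ^^ L) v x \<ge> v lowest"
proof (induction L arbitrary: x)
  case 0
  have "x = lowest"
  proof (rule ccontr)
    assume "x \<noteq> lowest"
    from lower_neighbour[OF 0(1) this] obtain y where "y \<in> ints" "(\<Sum>j=1..n. y j) = (\<Sum>j=1..n. x j) - 1" by blast
    moreover from this have "(\<Sum>j=1..n. lowest j) \<le> (\<Sum>j=1..n. y j)"
      using integer_alcove_lower[OF _ n] by (intro sum_mono) (auto simp: lowest_def)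
    ultimately show False using 0 by simp
  qed
  then show ?case by simp
next
  case (Suc L)
  let ?B = "\<lambda>v x. \<Sum>y\<in>ints. two_step x y * v y"
  have nn: "(?B ^^ k) v y \<ge> 0" if "y \<in> ints" for k y
    using that
  proof (induction k arbitrary: y)
    case (Suc k)
    then show ?case by (auto intro!: sum_nonneg mult_nonneg_nonneg simp: two_step_def)
  qed (use v in auto)
  obtain y where y: "y \<in> ints" "two_step x y \<ge> 1" "(\<Sum>j=1..n. y j) \<le> (\<Sum>j=1..n. lowest j) + real L"
  proof (cases "x = lowest")
    case True
    then show ?thesis using that[of x] Suc.prems two_step_ge_1[OF Suc.prems(1) shift_down_props(2)[OF Suc.prems(1)]]
      by simp
  next
    case False
    from lower_neighbour[OF Suc.prems(1) False] that Suc.prems(2) show ?thesis by fastforce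
  qed
  have "v lowest \<le> (?B ^^ L) v y" by (rule Suc.IH) (use y in auto)
  also have "\<dots> \<le> two_step x y * (?B ^^ L) v y"
    using y nn[OF y(1), of L] by (simp add: mult_le_cancel_right1)
  also have "\<dots> \<le> (\<Sum>y\<in>ints. two_step x y * (?B ^^ L) v y)"
    using fin y(1) nn by (intro member_le_sum) (auto simp: two_step_def)
  finally show ?case by simp
qed

abbreviation "Count \<equiv> count n A"

lemma Count_Suc:
  assumes "c = 1/2 \<or> c = 1" "x \<in> coset_alcove n m c"
  shows "Count (Suc k) x = (\<Sum>y\<in>neighbours n x \<inter> coset_alcove n m (3/2 - c). Count k y)"
  using count_Suc[of x A n k] assms neighbours_coset[OF assms(2,1)] by (simp add: coset_alcove_def)

text \<open>\<open>tendsto_projection\<close> is applied to \<open>Count 0\<close> for even and to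
  \<open>Count 1\<close> for odd lengths. In the odd case, exchanging the order of summation turns
  the sum of \<open>eigenfun y * Count 1 y\<close> into \<open>K\<close> times the sum of
  \<open>eigenfun\<close> over the half-integer points.\<close>

lemma Count_limits_ints:
  assumes finX: "finite ints" and finY: "finite halves" and m2: "2 * m \<in> \<int>" and x: "x \<in> ints"
  shows "(\<lambda>j. Count (2 * j) x / K ^ (2 * j)) \<longlonglongrightarrow>
      eigenfun x * ((\<Sum>y\<in>ints. eigenfun y) / (\<Sum>y\<in>ints. (eigenfun y)\<^sup>2))"
    and "(\<lambda>j. Count (2 * j + 1) x / K ^ (2 * j + 1)) \<longlonglongrightarrow>
      eigenfun x * ((\<Sum>y\<in>halves. eigenfun y) / (\<Sum>y\<in>ints. (eigenfun y)\<^sup>2))"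
proof -
  have half: "3/2 - 1 = (1/2::real)" "3/2 - 1/2 = (1::real)" by simp_all
  note Cs = Count_Suc[of 1, unfolded half(1)] Count_Suc[of "1/2", unfolded half(2)]
  note es = eigenfun_neighbours[OF m2, of 1, unfolded half(1)] eigenfun_neighbours[OF m2, of "1/2", unfolded half(2)]
  \<comment> \<open>Bounds every coordinate sum in the alcove, hence the number of lowering
    moves.\<close>
  define L where "L = nat \<lceil>real n * (2 * m)\<rceil>"
  interpret symmetric_kernel ints two_step eigenfun "K\<^sup>2" lowest L
  proof
    show "two_step u v = two_step v u" for u v
      by (simp add: two_step_def Int_commute Int_left_commute)
    show "two_step u v \<ge> 0" for u v by (simp add: two_step_def)
    show "eigenfun u > 0" if "u \<in> ints" for u
      using that eigenfun_pos by (simp add: coset_alcove_def)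
    show "K\<^sup>2 > 0" using K_pos by simp
    show "(\<Sum>y\<in>ints. two_step u y * eigenfun y) = K\<^sup>2 * eigenfun u" if "u \<in> ints" for u
    proof -
      have "(\<Sum>y\<in>ints. two_step u y * eigenfun y) = (\<Sum>w\<in>neighbours n u \<inter> halves. K * eigenfun w)"
        unfolding sum_two_step[OF finX] by (intro sum.cong refl es(2)) auto
      also have "\<dots> = K * (K * eigenfun u)"
        unfolding sum_distrib_left[symmetric] using es(1)[OF _ that] by simp
      finally show ?thesis by (simp add: power2_eq_square)
    qed
    show "((\<lambda>v x. \<Sum>y\<in>ints. two_step x y * v y) ^^ L) v u \<ge> v lowest"
      if "\<And>y. y \<in> ints \<Longrightarrow> v y \<ge> 0" "u \<in> ints" for v u
    proof (rule two_step_reach[OF finX that])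
      have uA: "u \<in> A" using that by (simp add: coset_alcove_def)
      have "(\<Sum>j=1..n. u j) \<le> (\<Sum>j=1..n. 2 * m)"
        using alcove_bounds(3)[OF uA n] by (intro sum_mono) (auto simp: less_imp_le)
      also have "\<dots> \<le> real L" unfolding L_def by simp linarith
      also have "\<dots> \<le> (\<Sum>j=1..n. lowest j) + real L"
        by (simp, intro sum_nonneg) (auto simp: lowest_def)
      finally show "(\<Sum>j=1..n. u j) \<le> (\<Sum>j=1..n. lowest j) + real L" .
    qed
  qed (use finX lowest_in in auto)
  have step: "B (Count k) u = Count (k + 2) u" if "u \<in> ints" for k u
  proof -
    have "Count (k + 2) u = (\<Sum>w\<in>neighbours n u \<inter> halves. Count (Suc k) w)"
      using Cs(1)[OF _ that, of "Suc k"] by simp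
    also have "\<dots> = (\<Sum>w\<in>neighbours n u \<inter> halves. \<Sum>y\<in>neighbours n w \<inter> ints. Count k y)"
      by (intro sum.cong refl Cs(2)) auto
    finally show ?thesis unfolding B_def sum_two_step[OF finX] ..
  qed
  have iter: "(B ^^ j) (Count k) u = Count (2 * j + k) u" if "u \<in> ints" for j k u
    using that
  proof (induction j arbitrary: u)
    case (Suc j)
    have "B ((B ^^ j) (Count k)) = B (Count (2 * j + k))" by (rule B_cong) (rule Suc.IH)
    then show ?case using step[OF Suc.prems, of "2 * j + k"] by (simp add: add.commute)
  qed simp
  have lim: "(\<lambda>j. Count (2 * j + k) x / (K\<^sup>2) ^ j) \<longlonglongrightarrow>
    eigenfun x * ((\<Sum>y\<in>ints. eigenfun y * Count k y) / (\<Sum>y\<in>ints. (eigenfun y)\<^sup>2))" for k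
    using tendsto_projection[OF x, of "Count k"] unfolding iter[OF x] .
  have "(\<Sum>y\<in>ints. eigenfun y * Count 0 y) = (\<Sum>y\<in>ints. eigenfun y)"
    by (intro sum.cong refl) (simp add: coset_alcove_def count_0)
  then show "(\<lambda>j. Count (2 * j) x / K ^ (2 * j)) \<longlonglongrightarrow>
      eigenfun x * ((\<Sum>y\<in>ints. eigenfun y) / (\<Sum>y\<in>ints. (eigenfun y)\<^sup>2))"
    using lim[of 0] by (simp add: power_mult)
  have S: "(\<Sum>y\<in>ints. eigenfun y * Count 1 y) = K * (\<Sum>w\<in>halves. eigenfun w)"
  proof -
    have "(\<Sum>y\<in>ints. eigenfun y * Count 1 y) = (\<Sum>y\<in>ints. \<Sum>w\<in>halves. if w \<in> neighbours n y then eigenfun y else 0)"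
    proof (rule sum.cong[OF refl])
      fix y assume y: "y \<in> ints"
      have "Count 1 y = (\<Sum>w\<in>neighbours n y \<inter> halves. Count 0 w)" using Cs(1)[OF _ y, of 0] by simp
      also have "\<dots> = (\<Sum>w\<in>neighbours n y \<inter> halves. 1)"
        by (intro sum.cong refl) (simp add: coset_alcove_def count_0)
      finally have "eigenfun y * Count 1 y = (\<Sum>w\<in>neighbours n y \<inter> halves. eigenfun y)" by simp
      also have "\<dots> = (\<Sum>w\<in>halves. if w \<in> neighbours n y then eigenfun y else 0)"
        using finY by (subst Int_commute, subst sum.inter_restrict) auto
      finally show "eigenfun y * Count 1 y = (\<Sum>w\<in>halves. if w \<in> neighbours n y then eigenfun y else 0)" .
    qed
    also have "\<dots> = (\<Sum>w\<in>halves. \<Sum>y\<in>ints. if w \<in> neighbours n y then eigenfun y else 0)"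
      by (rule sum.swap)
    also have "\<dots> = (\<Sum>w\<in>halves. K * eigenfun w)"
    proof (rule sum.cong[OF refl])
      fix w assume w: "w \<in> halves"
      have "(\<Sum>y\<in>ints. if w \<in> neighbours n y then eigenfun y else 0) = (\<Sum>y\<in>ints. if y \<in> neighbours n w then eigenfun y else 0)"
        by (subst neighbours_sym) (rule refl)
      also have "\<dots> = (\<Sum>y\<in>neighbours n w \<inter> ints. eigenfun y)"
        using finX by (subst Int_commute, subst sum.inter_restrict) auto
      also have "\<dots> = K * eigenfun w" using es(2)[OF _ w] by simp
      finally show "(\<Sum>y\<in>ints. if w \<in> neighbours n y then eigenfun y else 0) = K * eigenfun w" .
    qed
    finally show ?thesis by (simp add: sum_distrib_left)
  qed
  have "(\<lambda>j. Count (2 * j + 1) x / (K\<^sup>2) ^ j / K) \<longlonglongrightarrow>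
    eigenfun x * ((K * (\<Sum>w\<in>halves. eigenfun w)) / (\<Sum>y\<in>ints. (eigenfun y)\<^sup>2)) / K"
    using lim[of 1] K_pos unfolding S by (intro tendsto_divide tendsto_const) auto
  moreover have "Count (2 * j + 1) x / (K\<^sup>2) ^ j / K = Count (2 * j + 1) x / K ^ (2 * j + 1)" for j
    unfolding power_add power_mult by simp
  moreover have "eigenfun x * ((K * (\<Sum>w\<in>halves. eigenfun w)) / (\<Sum>y\<in>ints. (eigenfun y)\<^sup>2)) / K =
      eigenfun x * ((\<Sum>y\<in>halves. eigenfun y) / (\<Sum>y\<in>ints. (eigenfun y)\<^sup>2))"
    using K_pos by simp
  ultimately show "(\<lambda>j. Count (2 * j + 1) x / K ^ (2 * j + 1)) \<longlonglongrightarrow>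
      eigenfun x * ((\<Sum>y\<in>halves. eigenfun y) / (\<Sum>y\<in>ints. (eigenfun y)\<^sup>2))"
    by (simp only:)
qed

text \<open>The first step leads to integer points, and the eigenvalue equation combines their
  limits to the value at \<open>x\<close>. The normalization stays the one on the integer
  points.\<close>

lemma Count_limits_halves:
  assumes fin: "finite ints" "finite halves" and m2: "2 * m \<in> \<int>" and x: "x \<in> halves"
  shows "(\<lambda>j. Count (2 * j + 1) x / K ^ (2 * j + 1)) \<longlonglongrightarrow>
      eigenfun x * ((\<Sum>y\<in>ints. eigenfun y) / (\<Sum>y\<in>ints. (eigenfun y)\<^sup>2))"
    and "(\<lambda>j. Count (2 * j) x / K ^ (2 * j)) \<longlonglongrightarrow>
      eigenfun x * ((\<Sum>y\<in>halves. eigenfun y) / (\<Sum>y\<in>ints. (eigenfun y)\<^sup>2))"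
proof -
  have half: "3/2 - 1/2 = (1::real)" by simp
  have C: "Count (Suc k) x / K ^ Suc k = (\<Sum>y\<in>neighbours n x \<inter> ints. Count k y / K ^ k) / K" for k
    using Count_Suc[of "1/2" x k, unfolded half] x by (simp add: sum_divide_distrib[symmetric] mult.commute)
  have lim: "(\<lambda>j. Count (Suc (g j)) x / K ^ Suc (g j)) \<longlonglongrightarrow> eigenfun x * M"
    if "\<And>y. y \<in> ints \<Longrightarrow> (\<lambda>j. Count (g j) y / K ^ g j) \<longlonglongrightarrow> eigenfun y * M" for g M
  proof -
    have "(\<lambda>j. Count (Suc (g j)) x / K ^ Suc (g j)) \<longlonglongrightarrow> (\<Sum>y\<in>neighbours n x \<inter> ints. eigenfun y * M) / K"
      unfolding C using K_pos that by (intro tendsto_divide tendsto_sum tendsto_const) auto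
    also have "(\<Sum>y\<in>neighbours n x \<inter> ints. eigenfun y * M) / K = eigenfun x * M"
      unfolding sum_distrib_right[symmetric]
      using eigenfun_neighbours[OF m2, of "1/2" x, unfolded half] x K_pos by simp
    finally show ?thesis .
  qed
  show "(\<lambda>j. Count (2 * j + 1) x / K ^ (2 * j + 1)) \<longlonglongrightarrow>
      eigenfun x * ((\<Sum>y\<in>ints. eigenfun y) / (\<Sum>y\<in>ints. (eigenfun y)\<^sup>2))"
    using lim[OF Count_limits_ints(1)[OF fin m2]] by simp
  \<comment> \<open>One step followed by \<open>2 * j + 1\<close> further ones, hence the shifted
    sequence.\<close>
  have "(\<lambda>j. Count (2 * Suc j) x / K ^ (2 * Suc j)) \<longlonglongrightarrow>
      eigenfun x * ((\<Sum>y\<in>halves. eigenfun y) / (\<Sum>y\<in>ints. (eigenfun y)\<^sup>2))"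
    using lim[OF Count_limits_ints(2)[OF fin m2]] by simp
  then show "(\<lambda>j. Count (2 * j) x / K ^ (2 * j)) \<longlonglongrightarrow>
      eigenfun x * ((\<Sum>y\<in>halves. eigenfun y) / (\<Sum>y\<in>ints. (eigenfun y)\<^sup>2))"
    by (rule LIMSEQ_imp_Suc)
qed

end

section \<open>Parity of the length and assembly of the constants\<close>

lemma half_integer_iff: "half_integer v \<longleftrightarrow> v - 1/2 \<in> \<int>"
proof
  assume "half_integer v"
  then obtain a :: int where "odd a" "v = of_int a / 2" by (auto simp: half_integer_def)
  then obtain b where "v = of_int (2 * b + 1) / 2" by (auto elim: oddE)
  then have "v - 1/2 = of_int b" by simp
  then show "v - 1/2 \<in> \<int>" by simp
next
  assume "v - 1/2 \<in> \<int>"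
  then obtain b :: int where "v - 1/2 = of_int b" by (auto elim: Ints_cases)
  then have "v = of_int (2 * b + 1) / 2" by simp
  then show "half_integer v" unfolding half_integer_def by (intro exI[of _ "2 * b + 1"]) simp
qed

lemma floor_double_int: "v \<in> \<int> \<Longrightarrow> even \<lfloor>2 * v\<rfloor>" for v :: real
proof -
  assume "v \<in> \<int>"
  then obtain b :: int where "v = of_int b" by (auto elim: Ints_cases)
  then have "2 * v = of_int (2 * b)" by simp
  then have "\<lfloor>2 * v\<rfloor> = 2 * b" by (simp only: floor_of_int)
  then show ?thesis by simp
qed

lemma floor_double_half: "v - 1/2 \<in> \<int> \<Longrightarrow> odd \<lfloor>2 * v\<rfloor>" for v :: real
proof -
  assume "v - 1/2 \<in> \<int>"
  then obtain b :: int where "v - 1/2 = of_int b" by (auto elim: Ints_cases)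
  then have "2 * v = of_int (2 * b + 1)" by simp
  then have "\<lfloor>2 * v\<rfloor> = 2 * b + 1" by (simp only: floor_of_int)
  then show ?thesis by simp
qed

lemma parity_filters_int:
  assumes "n \<ge> 1" "\<forall>j\<in>{1..n}. \<eta> j \<in> \<int>"
  shows "at_top_even n \<eta> = inf at_top (principal {k. even k})"
    and "at_top_odd n \<eta> = inf at_top (principal {k. odd k})"
proof -
  have "even \<lfloor>2 * \<eta> j\<rfloor>" if "j \<in> {1..n}" for j using floor_double_int assms(2) that by blast
  then have "{k. \<forall>j\<in>{1..n}. even (int k + \<lfloor>2 * \<eta> j\<rfloor>)} = {k. even k}"
    "{k. \<forall>j\<in>{1..n}. odd (int k + \<lfloor>2 * \<eta> j\<rfloor>)} = {k. odd k}"
    using assms(1) by auto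
  then show "at_top_even n \<eta> = inf at_top (principal {k. even k})"
    "at_top_odd n \<eta> = inf at_top (principal {k. odd k})"
    by (simp_all only: at_top_even_def at_top_odd_def)
qed

lemma parity_filters_half:
  assumes "n \<ge> 1" "\<forall>j\<in>{1..n}. \<eta> j - 1/2 \<in> \<int>"
  shows "at_top_even n \<eta> = inf at_top (principal {k. odd k})"
    and "at_top_odd n \<eta> = inf at_top (principal {k. even k})"
proof -
  have "odd \<lfloor>2 * \<eta> j\<rfloor>" if "j \<in> {1..n}" for j using floor_double_half assms(2) that by blast
  then have "{k. \<forall>j\<in>{1..n}. even (int k + \<lfloor>2 * \<eta> j\<rfloor>)} = {k. odd k}"
    "{k. \<forall>j\<in>{1..n}. odd (int k + \<lfloor>2 * \<eta> j\<rfloor>)} = {k. even k}"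
    using assms(1) by auto
  then show "at_top_even n \<eta> = inf at_top (principal {k. odd k})"
    "at_top_odd n \<eta> = inf at_top (principal {k. even k})"
    by (simp_all only: at_top_even_def at_top_odd_def)
qed

context frequencies
begin

text \<open>The parity of \<open>k + 2 * \<eta> j\<close> tells the type of the end points: integers
  if it is even, half-integers if it is odd, whatever the type of \<eta>.\<close>

lemma Count_asymp:
  assumes fin: "finite ints" "finite halves" and m2: "2 * m \<in> \<int>" and \<eta>: "\<eta> \<in> A"
    and type: "(\<forall>j\<in>{1..n}. \<eta> j \<in> \<int>) \<or> (\<forall>j\<in>{1..n}. \<eta> j - 1/2 \<in> \<int>)"
  shows "(\<lambda>k. Count k \<eta>) \<sim>[at_top_even n \<eta>]
      (\<lambda>k. eigenfun \<eta> * ((\<Sum>y\<in>ints. eigenfun y) / (\<Sum>y\<in>ints. (eigenfun y)\<^sup>2)) * K_factor n m k)"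
    and "(\<lambda>k. Count k \<eta>) \<sim>[at_top_odd n \<eta>]
      (\<lambda>k. eigenfun \<eta> * ((\<Sum>y\<in>halves. eigenfun y) / (\<Sum>y\<in>ints. (eigenfun y)\<^sup>2)) * K_factor n m k)"
proof -
  have "(\<Sum>y\<in>ints. (eigenfun y)\<^sup>2) > 0"
  proof (rule sum_pos)
    fix y assume "y \<in> ints"
    then show "0 < (eigenfun y)\<^sup>2" using eigenfun_pos[of y] by (simp add: coset_alcove_def)
  qed (use fin lowest_in in auto)
  moreover have "(\<Sum>y\<in>ints. eigenfun y) > 0"
    using fin lowest_in by (intro sum_pos eigenfun_pos) (auto simp: coset_alcove_def)
  moreover have "(\<Sum>y\<in>halves. eigenfun y) > 0"
    using fin shift_down_props(1)[OF lowest_in]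
    by (intro sum_pos eigenfun_pos) (auto simp: coset_alcove_def)
  ultimately have nz: "eigenfun \<eta> * ((\<Sum>y\<in>ints. eigenfun y) / (\<Sum>y\<in>ints. (eigenfun y)\<^sup>2)) \<noteq> 0"
    "eigenfun \<eta> * ((\<Sum>y\<in>halves. eigenfun y) / (\<Sum>y\<in>ints. (eigenfun y)\<^sup>2)) \<noteq> 0"
    using eigenfun_pos[OF \<eta>] by auto
  have K0: "K \<noteq> 0" using K_pos by simp
  have power_K: "(\<lambda>k. C * K_factor n m k) = (\<lambda>k. C * K ^ k)" for C
    by (rule ext, rule arg_cong[OF K_factor_eq])
  from type have "(((\<lambda>k. Count k \<eta> / K ^ k) \<longlongrightarrow> eigenfun \<eta> * ((\<Sum>y\<in>ints. eigenfun y) / (\<Sum>y\<in>ints. (eigenfun y)\<^sup>2)))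
      (at_top_even n \<eta>)) \<and>
     (((\<lambda>k. Count k \<eta> / K ^ k) \<longlongrightarrow> eigenfun \<eta> * ((\<Sum>y\<in>halves. eigenfun y) / (\<Sum>y\<in>ints. (eigenfun y)\<^sup>2)))
      (at_top_odd n \<eta>))"
  proof
    assume ints: "\<forall>j\<in>{1..n}. \<eta> j \<in> \<int>"
    with \<eta> have "\<eta> \<in> ints" by (auto simp: coset_alcove_def)
    from Count_limits_ints[OF fin m2 this] show ?thesis
      unfolding parity_filters_int[OF n ints] by (intro conjI tendsto_even_filter tendsto_odd_filter)
  next
    assume halves: "\<forall>j\<in>{1..n}. \<eta> j - 1/2 \<in> \<int>"
    with \<eta> have "\<eta> \<in> halves" by (auto simp: coset_alcove_def)
    from Count_limits_halves[OF fin m2 this] show ?thesis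
      unfolding parity_filters_half[OF n halves] by (intro conjI tendsto_even_filter tendsto_odd_filter)
  qed
  then show "(\<lambda>k. Count k \<eta>) \<sim>[at_top_even n \<eta>]
      (\<lambda>k. eigenfun \<eta> * ((\<Sum>y\<in>ints. eigenfun y) / (\<Sum>y\<in>ints. (eigenfun y)\<^sup>2)) * K_factor n m k)"
    "(\<lambda>k. Count k \<eta>) \<sim>[at_top_odd n \<eta>]
      (\<lambda>k. eigenfun \<eta> * ((\<Sum>y\<in>halves. eigenfun y) / (\<Sum>y\<in>ints. (eigenfun y)\<^sup>2)) * K_factor n m k)"
    unfolding power_K using nz K0 by (blast intro: asymp_equiv_geometric)+
qed

text \<open>Origin of the constant: \<open>eigenfun \<eta>\<close> and the sum \<open>S\<close> each
  contribute \<open>c4 n\<close>, the norm contributes \<open>2 ^ n / m ^ n\<close>, and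
  \<open>4 ^ n * (c4 n)\<^sup>2 = 4 ^ (n\<^sup>2)\<close>.\<close>

lemma constant_eq:
  assumes "\<eta> \<in> A" "S = 2 * (c4 n * q * Z)" "T = 2 * (m/2) ^ n"
  shows "eigenfun \<eta> * (S / T) * k = 4 ^ (n\<^sup>2) / (2 * m) ^ n * k * (point_part n m \<eta> * q) * Z"
proof -
  have "(4::real) ^ n = 2 ^ n * 2 ^ n" by (simp flip: power_mult_distrib)
  then have "4 ^ (n\<^sup>2) / (2 * m) ^ n = (2 ^ n * 2 ^ n * (c4 n)\<^sup>2) / (2 ^ n * m ^ n)"
    unfolding c4_square[symmetric] by (simp add: power_mult_distrib)
  then have 1: "4 ^ (n\<^sup>2) / (2 * m) ^ n = 2 ^ n * (c4 n * c4 n) / m ^ n"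
    by (simp add: power2_eq_square)
  have "S / T = c4 n * q * Z * 2 ^ n / m ^ n"
    unfolding assms(2,3) using m_pos by (simp add: power_divide)
  then show ?thesis
    unfolding 1 eigenfun_eq[OF assms(1)] by simp
qed

lemma Count_asymp_even:
  assumes "finite ints" "finite halves" "2 * m \<in> \<int>" and \<eta>: "\<eta> \<in> A"
    and "(\<forall>j\<in>{1..n}. \<eta> j \<in> \<int>) \<or> (\<forall>j\<in>{1..n}. \<eta> j - 1/2 \<in> \<int>)"
    and T: "(\<Sum>y\<in>ints. (eigenfun y)\<^sup>2) = 2 * (m/2) ^ n"
    and S: "(\<Sum>y\<in>ints. eigenfun y) = 2 * (c4 n * e0 z n * Z)"
  shows "(\<lambda>k. real (card (diagonal_walks n A \<eta> k))) \<sim>[at_top_even n \<eta>]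
    (\<lambda>k. 4 ^ (n\<^sup>2) / (2 * m) ^ n * K_factor n m k * E_even n m \<eta> * Z)"
  using Count_asymp(1)[OF assms(1-5)]
  unfolding constant_eq[OF \<eta> S T] E_even_eq count_def .

lemma Count_asymp_odd:
  assumes "finite ints" "finite halves" "2 * m \<in> \<int>" and \<eta>: "\<eta> \<in> A"
    and "(\<forall>j\<in>{1..n}. \<eta> j \<in> \<int>) \<or> (\<forall>j\<in>{1..n}. \<eta> j - 1/2 \<in> \<int>)"
    and T: "(\<Sum>y\<in>ints. (eigenfun y)\<^sup>2) = 2 * (m/2) ^ n"
    and S: "(\<Sum>y\<in>halves. eigenfun y) = 2 * (c4 n * e1 z n * Z)"
  shows "(\<lambda>k. real (card (diagonal_walks n A \<eta> k))) \<sim>[at_top_odd n \<eta>]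
    (\<lambda>k. 4 ^ (n\<^sup>2) / (2 * m) ^ n * K_factor n m k * E_odd n m \<eta> * Z)"
  using Count_asymp(2)[OF assms(1-5)]
  unfolding constant_eq[OF \<eta> S T] E_odd_eq count_def .

end

text \<open>The hypotheses force \<open>2 * m = 2 * n - 1\<close> and a half-integer start. A step
  would have to end at an integer point, of which there are none, and the eigenvalue contains
  \<open>cos (pi/2)\<close>.\<close>

lemma count_degenerate:
  assumes n: "n \<ge> 1" and \<eta>: "\<eta> \<in> alcove_B n m" and m2: "2 * m \<in> \<int>"
    and type: "(\<forall>j\<in>{1..n}. \<eta> j \<in> \<int>) \<or> (\<forall>j\<in>{1..n}. \<eta> j - 1/2 \<in> \<int>)"
    and deg: "\<not> 2 * real n - 1 < 2 * m"
  shows "count n (alcove_B n m) (Suc k) \<eta> = 0" "K_factor n m (Suc k) = 0"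
proof -
  have empty: "coset_alcove n m 1 = {}" using integer_alcove_size n deg by blast
  have "\<eta> \<notin> coset_alcove n m 1" using empty by simp
  with \<eta> have "\<not> (\<forall>j\<in>{1..n}. \<eta> j \<in> \<int>)" by (auto simp: coset_alcove_def)
  with type \<eta> have half: "\<eta> \<in> coset_alcove n m (1/2)" by (auto simp: coset_alcove_def)
  have "3/2 - 1/2 = (1::real)" by simp
  then show "count n (alcove_B n m) (Suc k) \<eta> = 0"
    using count_Suc[OF \<eta>, of n k] neighbours_coset[OF half] empty by simp
  have m: "2 * real n - 1 = 2 * m" using half_alcove_size[OF half n m2] deg by simp
  then have "m > 0" using n by linarith
  have "(2 * real n - 1) * pi / (4 * m) = pi / 2" unfolding m using \<open>m > 0\<close> by simp
  then have "cos ((2 * real n - 1) * pi / (4 * m)) = 0" by (simp only: cos_pi_half)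
  then have "(\<Prod>j=1..n. cos ((2 * real j - 1) * pi / (4 * m))) = 0"
    using n by (intro prod_zero bexI[of _ n]) auto
  then show "K_factor n m (Suc k) = 0" by (simp add: K_factor_def)
qed

text \<open>Eventually equal functions are asymptotically equivalent, also when both vanish.\<close>

lemma asymp_equiv_parity_degenerate:
  assumes "\<And>k. f (Suc k) = g (Suc k)"
  shows "f \<sim>[at_top_even n \<eta>] g" "f \<sim>[at_top_odd n \<eta>] g"
proof -
  have "eventually (\<lambda>k. f k = g k) at_top"
    using eventually_gt_at_top[of 0] by eventually_elim (metis assms gr0_conv_Suc)
  then have "eventually (\<lambda>k. f k = g k) (inf at_top (principal S))" for S
    by (simp add: eventually_inf_principal eventually_mono)
  then show "f \<sim>[at_top_even n \<eta>] g" "f \<sim>[at_top_odd n \<eta>] g"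
    unfolding at_top_even_def at_top_odd_def by (blast intro: asymp_equiv_refl_ev)+
qed

theorem theorem28:
  fixes n :: nat and m :: real and \<eta> :: "nat \<Rightarrow> real"
  assumes "n \<ge> 1"
    and "m > 0"
    and "m \<in> \<int> \<or> half_integer m"
    and "\<eta> \<in> alcove_B n m"
    and "(\<forall>j\<in>{1..n}. \<eta> j \<in> \<int>) \<or> (\<forall>j\<in>{1..n}. half_integer (\<eta> j))"
  shows
    "(m \<in> \<int> \<longrightarrow>
       asymp_equiv (\<lambda>k. real (card (diagonal_walks n (alcove_B n m) \<eta> k))) (at_top_even n \<eta>)
         (\<lambda>k. 4 ^ (n\<^sup>2) / (2 * (2 * m) ^ n) * K_factor n m k * E_even n m \<eta> *
              (A_factor n m m + A_factor n m (m - 1)))) \<and>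
     (half_integer m \<longrightarrow>
       asymp_equiv (\<lambda>k. real (card (diagonal_walks n (alcove_B n m) \<eta> k))) (at_top_even n \<eta>)
         (\<lambda>k. 4 ^ (n\<^sup>2) / (2 * m) ^ n * K_factor n m k * E_even n m \<eta> *
              A_factor n m (of_int \<lfloor>m\<rfloor>))) \<and>
     (m \<in> \<int> \<longrightarrow>
       asymp_equiv (\<lambda>k. real (card (diagonal_walks n (alcove_B n m) \<eta> k))) (at_top_odd n \<eta>)
         (\<lambda>k. 4 ^ (n\<^sup>2) / (2 * m) ^ n * K_factor n m k * E_odd n m \<eta> *
              U_factor n m m)) \<and>
     (half_integer m \<longrightarrow>
       asymp_equiv (\<lambda>k. real (card (diagonal_walks n (alcove_B n m) \<eta> k))) (at_top_odd n \<eta>)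
         (\<lambda>k. 4 ^ (n\<^sup>2) / (2 * (2 * m) ^ n) * K_factor n m k * E_odd n m \<eta> *
              (U_factor n m (of_int \<lceil>m\<rceil>) + U_factor n m (of_int \<lfloor>m\<rfloor>))))"
proof -
  note n = assms(1) and m = assms(2) and \<eta> = assms(4)
  have type: "(\<forall>j\<in>{1..n}. \<eta> j \<in> \<int>) \<or> (\<forall>j\<in>{1..n}. \<eta> j - 1/2 \<in> \<int>)"
    using assms(5) by (simp add: half_integer_iff)
  have m2: "2 * m \<in> \<int>"
  proof (cases "m \<in> \<int>")
    case False
    then obtain a :: int where "m = of_int a / 2" using assms(3) by (auto simp: half_integer_def)
    then have "2 * m = of_int a" by simp
    then show ?thesis by simp
  qed simp
  show ?thesis
  proof (cases "2 * real n - 1 < 2 * m")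
    case False
    note zero = count_degenerate[OF n \<eta> m2 type False, unfolded count_def]
    show ?thesis
      by (intro conjI impI asymp_equiv_parity_degenerate) (simp_all add: zero)
  next
    case nm: True
    show ?thesis
    proof (cases "m \<in> \<int>")
      case int: True
      then obtain k where k: "m = of_int k" by (auto elim: Ints_cases)
      define M where "M = nat k"
      have M: "m = real M" "M > 0" using k m by (auto simp: M_def)
      \<comment> \<open>The integer grid \<open>1..M\<close> ends on the wall, the half-integer grid
        at \<open>m - 1/2\<close>.\<close>
      interpret I: frequencies m 1 "1/2" M n
        by unfold_locales (use M nm n in auto)
      interpret H: frequencies m "1/2" 0 M n
        by unfold_locales (use M nm n in auto)
      have fin: "finite (coset_alcove n m 1)" "finite (coset_alcove n m (1/2))"
        using I.finite_coset_alcove H.finite_coset_alcove by auto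
      have "2 * m = of_int (2 * k)" using k by simp
      then have "\<not> half_integer m"
        using floor_double_int[OF int] floor_double_half[of m] by (auto simp: half_integer_iff)
      moreover have "(\<Sum>y\<in>coset_alcove n m 1. I.eigenfun y) =
          2 * (c4 n * e0 I.z n * ((A_factor n m m + A_factor n m (m - 1)) / 2))"
        using I.sum_eigenfun I.sorted_sum_int_int by simp
      from I.Count_asymp_even[OF fin m2 \<eta> type I.sum_eigenfun_square this]
      have "(\<lambda>k. real (card (diagonal_walks n (alcove_B n m) \<eta> k))) \<sim>[at_top_even n \<eta>]
         (\<lambda>k. 4 ^ (n\<^sup>2) / (2 * (2 * m) ^ n) * K_factor n m k * E_even n m \<eta> *
              (A_factor n m m + A_factor n m (m - 1)))"
        by (simp add: mult_ac)
      \<comment> \<open>\<open>eigenfun\<close> and \<open>z\<close> depend on \<open>m\<close> and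
        \<open>n\<close> only, so the interpretations \<open>I\<close> and \<open>H\<close> share
        them.\<close>
      moreover have "(\<Sum>y\<in>coset_alcove n m (1/2). I.eigenfun y) = 2 * (c4 n * e1 I.z n * U_factor n m m)"
        using H.sum_eigenfun H.sorted_sum_half_int by simp
      from I.Count_asymp_odd[OF fin m2 \<eta> type I.sum_eigenfun_square this]
      have "(\<lambda>k. real (card (diagonal_walks n (alcove_B n m) \<eta> k))) \<sim>[at_top_odd n \<eta>]
         (\<lambda>k. 4 ^ (n\<^sup>2) / (2 * m) ^ n * K_factor n m k * E_odd n m \<eta> * U_factor n m m)"
        by simp
      ultimately show ?thesis by blast
    next
      case False
      then have "m - 1/2 \<in> \<int>" using assms(3) by (simp add: half_integer_iff)
      then obtain k where k: "m - 1/2 = of_int k" by (auto elim: Ints_cases)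
      have mk: "m = of_int k + 1/2" using k by simp
      define M where "M = nat k"
      have M: "m = real M + 1/2"
      proof -
        have "real_of_int k > - 1" using mk m by simp
        then have "k \<ge> 0" by linarith
        then show ?thesis using mk by (simp add: M_def)
      qed
      have M0: "M > 0" using M nm n by linarith
      have floor: "of_int \<lfloor>m\<rfloor> = m - 1/2" "of_int \<lceil>m\<rceil> = m + 1/2"
      proof -
        have "\<lfloor>m\<rfloor> = k" "\<lceil>m\<rceil> = k + 1" unfolding mk by linarith+
        then show "of_int \<lfloor>m\<rfloor> = m - 1/2" "of_int \<lceil>m\<rceil> = m + 1/2" using mk by simp_all
      qed
      \<comment> \<open>Now the half-integer grid reaches the wall, with \<open>M + 1\<close>
        points, and the integer grid ends at \<open>m - 1/2\<close>.\<close>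
      interpret I: frequencies m 1 0 M n
        by unfold_locales (use M M0 nm n in auto)
      interpret H: frequencies m "1/2" "1/2" "M + 1" n
        by unfold_locales (use M nm n in auto)
      have fin: "finite (coset_alcove n m 1)" "finite (coset_alcove n m (1/2))"
        using I.finite_coset_alcove H.finite_coset_alcove by auto
      have "(\<Sum>y\<in>coset_alcove n m 1. I.eigenfun y) = 2 * (c4 n * e0 I.z n * A_factor n m (m - 1/2))"
        using I.sum_eigenfun I.sorted_sum_int_half by simp
      from I.Count_asymp_even[OF fin m2 \<eta> type I.sum_eigenfun_square this]
      have "(\<lambda>k. real (card (diagonal_walks n (alcove_B n m) \<eta> k))) \<sim>[at_top_even n \<eta>]
         (\<lambda>k. 4 ^ (n\<^sup>2) / (2 * m) ^ n * K_factor n m k * E_even n m \<eta> * A_factor n m (of_int \<lfloor>m\<rfloor>))"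
        unfolding floor by simp
      moreover have "(\<Sum>y\<in>coset_alcove n m (1/2). I.eigenfun y) =
          2 * (c4 n * e1 I.z n * ((U_factor n m (m + 1/2) + U_factor n m (m - 1/2)) / 2))"
        using H.sum_eigenfun H.sorted_sum_half_half by simp
      from I.Count_asymp_odd[OF fin m2 \<eta> type I.sum_eigenfun_square this]
      have "(\<lambda>k. real (card (diagonal_walks n (alcove_B n m) \<eta> k))) \<sim>[at_top_odd n \<eta>]
         (\<lambda>k. 4 ^ (n\<^sup>2) / (2 * (2 * m) ^ n) * K_factor n m k * E_odd n m \<eta> *
              (U_factor n m (of_int \<lceil>m\<rceil>) + U_factor n m (of_int \<lfloor>m\<rfloor>)))"
        unfolding floor by (simp add: mult_ac)
      ultimately show ?thesis using False by blast
    qed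
  qed
qed

end
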